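(* The following decision problem is solvable in polynomial time: given a matrix $A\in\mathbb{Q}^{n\times n}$ and an entrywise nonnegative matrix $\Delta\in\mathbb{Q}^{n\times n}$, decide whether $r(A,\Delta)=\infty$.
   Context: For $A\in\mathbb{R}^{n\times n}$ and an entrywise nonnegative $\Delta\in\mathbb{R}^{n\times n}$, the regularity radius is $r(A,\Delta)=\min\{\delta\ge 0 : [A-\delta\Delta,A+\delta\Delta]\text{ is singular}\}$, with value $\infty$ if no such $\delta$ exists. Here $[A-\delta\Delta,A+\delta\Delta]$ is the set of all real matrices $A'$ with $A-\delta\Delta\le A'\le A+\delta\Delta$ entrywise; it is called singular if it contains at least one singular matrix. Polynomial time is measured in the bit size of the rational input. *)

theory Defs
  imports
    "Jordan_Normal_Form.Matrix"
    "HOL-Computational_Algebra.Polynomial"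
    "HOL-Library.Extended_Real"
begin

section \<open>The regularity radius\<close>

definition singular_mat :: "'a :: semiring_1 mat \<Rightarrow> bool" where
  "singular_mat A \<longleftrightarrow> square_mat A \<and> \<not> invertible_mat A"

(* The order on matrices is the entrywise one and includes equality of dimensions. *)
definition interval_mat :: "real mat \<Rightarrow> real mat \<Rightarrow> real mat set" where
  "interval_mat L U = {M. L \<le> M \<and> M \<le> U}"

definition singular_interval :: "real mat set \<Rightarrow> bool" where
  "singular_interval I \<longleftrightarrow> (\<exists>M \<in> I. singular_mat M)"

definition singular_radius :: "real mat \<Rightarrow> real mat \<Rightarrow> real \<Rightarrow> bool" where
  "singular_radius A D \<delta> \<longleftrightarrow>
     \<delta> \<ge> 0 \<and> singular_interval (interval_mat (A - \<delta> \<cdot>\<^sub>m D) (A + \<delta> \<cdot>\<^sub>m D))"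

(* LEAST is the minimum of the set of such radii: for square A and D of the same size with
   D nonnegative, this set is closed and bounded below, so it has a minimum if nonempty. *)
definition regularity_radius :: "real mat \<Rightarrow> real mat \<Rightarrow> ereal" where
  "regularity_radius A D =
     (if \<exists>\<delta>. singular_radius A D \<delta> then ereal (LEAST \<delta>. singular_radius A D \<delta>) else \<infinity>)"


section \<open>Deterministic multi-tape Turing machines\<close>

datatype direction = Move_Left | Stay | Move_Right

(* States are 0 (start), 1 (accept), 2 (reject) and further numbers below num_states; tape
   symbols are 0 (blank), 1 and 2 (the two input bits) and further numbers below num_symbols.
   The transition function takes the state and the scanned symbols, one per tape. *)
record turing_machine =
  num_tapes :: nat
  num_states :: nat
  num_symbols :: nat
  transition :: "nat \<Rightarrow> nat list \<Rightarrow> nat \<times> (nat \<times> direction) list"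

(* By closure, a run only ever consults finitely many values of the transition function, so
   that it is a finite table although its type is infinite. *)
definition wf_tm :: "turing_machine \<Rightarrow> bool" where
  "wf_tm M \<longleftrightarrow>
     num_tapes M \<ge> 1 \<and> num_states M \<ge> 3 \<and> num_symbols M \<ge> 3 \<and>
     (\<forall>q ss. q < num_states M \<longrightarrow> length ss = num_tapes M \<longrightarrow> set ss \<subseteq> {..<num_symbols M} \<longrightarrow>
        (case transition M q ss of (q', acts) \<Rightarrow>
           q' < num_states M \<and> length acts = num_tapes M \<and>
           (\<forall>(s, d) \<in> set acts. s < num_symbols M)))"

(* Tapes are infinite in both directions: cell contents and head position. *)
type_synonym tape = "(int \<Rightarrow> nat) \<times> int"
type_synonym config = "nat \<times> tape list"

fun read_tape :: "tape \<Rightarrow> nat" where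
  "read_tape (c, h) = c h"

fun offset :: "direction \<Rightarrow> int" where
  "offset Move_Left = -1"
| "offset Stay = 0"
| "offset Move_Right = 1"

fun act_tape :: "nat \<times> direction \<Rightarrow> tape \<Rightarrow> tape" where
  "act_tape (s, d) (c, h) = (c(h := s), h + offset d)"

fun tm_step :: "turing_machine \<Rightarrow> config \<Rightarrow> config" where
  "tm_step M (q, ts) =
     (if q = 1 \<or> q = 2 then (q, ts)
      else case transition M q (map read_tape ts) of (q', acts) \<Rightarrow> (q', map2 act_tape acts ts))"

fun bit_symbol :: "bool \<Rightarrow> nat" where
  "bit_symbol False = 1"
| "bit_symbol True = 2"

definition input_tape :: "bool list \<Rightarrow> tape" where
  "input_tape w =
     ((\<lambda>i. if 0 \<le> i \<and> i < int (length w) then bit_symbol (w ! nat i) else 0), 0)"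

definition blank_tape :: tape where
  "blank_tape = ((\<lambda>_. 0), 0)"

definition init_config :: "turing_machine \<Rightarrow> bool list \<Rightarrow> config" where
  "init_config M w = (0, input_tape w # replicate (num_tapes M - 1) blank_tape)"

definition accepts_within :: "turing_machine \<Rightarrow> bool list \<Rightarrow> nat \<Rightarrow> bool" where
  "accepts_within M w t \<longleftrightarrow> fst ((tm_step M ^^ t) (init_config M w)) = 1"

definition rejects_within :: "turing_machine \<Rightarrow> bool list \<Rightarrow> nat \<Rightarrow> bool" where
  "rejects_within M w t \<longleftrightarrow> fst ((tm_step M ^^ t) (init_config M w)) = 2"

(* The problem with instance set I, instance encoding enc, and question P. *)
definition poly_time_decidable :: "('i \<Rightarrow> bool list) \<Rightarrow> 'i set \<Rightarrow> ('i \<Rightarrow> bool) \<Rightarrow> bool" where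
  "poly_time_decidable enc I P \<longleftrightarrow>
     (\<exists>M. \<exists>p :: nat poly. wf_tm M \<and>
        (\<forall>x \<in> I. let t = poly p (length (enc x)) in
           (P x \<longrightarrow> accepts_within M (enc x) t) \<and> (\<not> P x \<longrightarrow> rejects_within M (enc x) t)))"


section \<open>Binary encoding of rational matrices\<close>

(* Least significant bit first, no leading zeros; 0 has no bits. *)
fun bits :: "nat \<Rightarrow> bool list" where
  "bits n = (if n = 0 then [] else odd n # bits (n div 2))"

declare bits.simps [simp del]

(* Self-delimiting: each bit is preceded by True, and False marks the end of the number.
   The length is twice the number of bits plus one. *)
definition enc_nat :: "nat \<Rightarrow> bool list" where
  "enc_nat n = concat (map (\<lambda>b. [True, b]) (bits n)) @ [False]"

definition enc_int :: "int \<Rightarrow> bool list" where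
  "enc_int k = (k < 0) # enc_nat (nat \<bar>k\<bar>)"

(* quotient_of yields the reduced fraction with positive denominator. *)
definition enc_rat :: "rat \<Rightarrow> bool list" where
  "enc_rat r = (case quotient_of r of (a, b) \<Rightarrow> enc_int a @ enc_nat (nat b))"

definition enc_entries :: "rat mat \<Rightarrow> bool list" where
  "enc_entries A = concat (map enc_rat (concat (mat_to_list A)))"

(* For a pair of n x n matrices: n, the entries of the first, the entries of the second. *)
definition enc_mat_pair :: "rat mat \<times> rat mat \<Rightarrow> bool list" where
  "enc_mat_pair = (\<lambda>(A, D). enc_nat (dim_row A) @ enc_entries A @ enc_entries D)"

end

theory Submission
  imports Defs "Jordan_Normal_Form.Determinant" "HOL-Number_Theory.Cong"
begin

text \<open>
  The determinant of $A + X$, as a function of the entries of $X$ allowed by the support of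
  $\Delta$, is affine in each of them, so it has no zero iff it is a nonzero constant. This holds iff
  $A$ is nonsingular and the digraph with an edge from row $i$ to row $i'$ whenever $\Delta_{ij} > 0$
  and the cofactor of $A$ at $(i', j)$ is nonzero for some $j$ is acyclic: if $(A + X) u = 0$, then
  the support of $Au$ is a set in which every row has a successor; conversely, from such a set of
  rows a singular completion is built with a generic vector supported on it.

  Whether a cofactor vanishes is decided modulo small primes. Since the least common multiple of the
  first $m$ numbers is at least $2^{m-1}$, some prime of polynomial size divides neither a denominator
  nor the numerator of a nonzero determinant. Modulo such a prime, determinants are computed by
  Chio condensation on numbers small enough to be held in unary.

  On the machine side, programs may store only bits in arrays, and numbers occur only as values of
  expressions and as loop variables. All numbers are then bounded by a polynomial in the input length
  that depends on the program alone, and so is the running time.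
\<close>

text \<open>The machine holds numbers in unary, so elimination over the rationals or the integers is
  ruled out: the magnitudes of intermediate values can be exponential in the input length. The
  modular test is one-sided. Full rank modulo a single prime that divides no denominator proves a
  determinant nonzero; the lcm bound only ensures that every nonzero determinant has such a witness
  in the searched range.

  The cofactor at row i and column j is the determinant of A with row i replaced by the j-th unit
  vector. All determinants thus have the same size, and the out-of-range row index n yields det A
  itself, so one table serves both.

  An expression can compare a stored symbol but never load a stored number; otherwise a loop could
  square a value repeatedly. A table of numbers is therefore kept as marks at
  \<open>pair a x\<close>, and a lookup is a bounded search for x. A failed search
  \<open>least_below\<close> returns its limit. The same convention holds in the mathematics and in
  the programs, so the two agree even on values that carry no meaning.\<close>

definition least_below :: "nat \<Rightarrow> (nat \<Rightarrow> bool) \<Rightarrow> nat" where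
  "least_below n P = (LEAST i. i < n \<longrightarrow> P i)"

lemma least_below_eqI:
  assumes "i < n" "P i" "\<And>j. j < i \<Longrightarrow> \<not> P j"
  shows "least_below n P = i"
  unfolding least_below_def using assms by (intro Least_equality) (auto intro: leI)

lemma least_below_le: "least_below n P \<le> n"
  unfolding least_below_def by (rule Least_le) simp

lemma least_below_prop: "least_below n P < n \<Longrightarrow> P (least_below n P)"
  using LeastI[of "\<lambda>i. i < n \<longrightarrow> P i" n] unfolding least_below_def by simp

lemma not_less_least_below: "i < least_below n P \<Longrightarrow> \<not> P i"
  unfolding least_below_def using not_less_Least by blast

lemma least_below_less: "i < n \<Longrightarrow> P i \<Longrightarrow> least_below n P < n"
  unfolding least_below_def by (rule le_less_trans[OF Least_le]) auto

section \<open>Small primes not dividing a given integer\<close>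

(* Rows of Leibniz' harmonic triangle: all reciprocals of its entries divide the same lcm. *)
lemma leibniz_triangle_dvd_Lcm:
  "k \<le> n \<Longrightarrow> Suc n * (n choose k) dvd Lcm {1..Suc n}"
proof (induction k arbitrary: n)
  case 0
  then show ?case by (simp add: dvd_Lcm)
next
  case (Suc k)
  define L where "L = Lcm {1..Suc n}"
  obtain m where m: "n = Suc m" using Suc.prems by (cases n) auto
  have "Lcm {1..Suc m} dvd L"
    unfolding L_def m by (rule Lcm_subset) auto
  then have "Suc m * (m choose k) dvd L"
    using Suc m by (metis Suc_le_mono dvd_trans)
  then obtain x where x: "L = Suc m * (m choose k) * x" by (elim dvdE)
  have "Suc n * (n choose k) dvd L"
    unfolding L_def using Suc by simp
  then obtain y where y: "L = Suc n * (n choose k) * y" by (elim dvdE)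
  have r1: "Suc k * (n choose Suc k) = n * (m choose k)"
    unfolding m by (rule Suc_times_binomial_eq[symmetric, of m k, simplified mult.commute])
  have r2: "(n - k) * (n choose k) = n * (m choose k)"
    unfolding m using binomial_absorb_comp[of "Suc m" k] by simp
  \<comment> \<open>With \<open>x\<close> = L / (n C(n-1,k)) and \<open>y\<close> = L / ((n+1)
    C(n,k)), this chain is the recurrence 1/((n+1) C(n,k+1)) = 1/(n C(n-1,k)) - 1/((n+1) C(n,k)) of
    the triangle, multiplied by \<open>L\<close> and freed of division and subtraction.\<close>
  have "Suc k * (Suc n * (n choose Suc k) * x) = Suc n * (Suc k * (n choose Suc k)) * x"
    by (simp only: ac_simps)
  also have "\<dots> = Suc n * L"
    unfolding r1 x by (simp only: m ac_simps)
  also have "\<dots> = (n - k) * L + Suc k * L"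
    using Suc.prems by (simp flip: distrib_right)
  also have "(n - k) * L = Suc n * ((n - k) * (n choose k)) * y"
    unfolding y by (simp only: ac_simps)
  also have "\<dots> = Suc k * (Suc n * (n choose Suc k) * y)"
    unfolding r2 r1[symmetric] by (simp only: ac_simps)
  finally have "Suc k * (Suc n * (n choose Suc k) * x) = Suc k * (Suc n * (n choose Suc k) * y + L)"
    by (simp only: distrib_left)
  then have "Suc n * (n choose Suc k) * x = Suc n * (n choose Suc k) * y + L"
    by (metis mult_left_cancel nat.distinct(1))
  then show ?case
    unfolding L_def[symmetric] by (metis dvd_add_right_iff dvd_triv_left)
qed

text \<open>Each of the n+1 binomial coefficients of row n is at most the lcm divided by n+1, and
  they add up to 2^n. This elementary bound takes the place of an estimate on the density of
  primes.\<close>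

lemma Lcm_ge_power: "2 ^ n \<le> Lcm {1..Suc n}"
proof -
  have pos: "0 < Lcm {1..Suc n}"
    by (auto intro!: Nat.gr0I)
  have "2 ^ n = (\<Sum>k\<le>n. n choose k)"
    by (rule choose_row_sum[symmetric])
  also have "\<dots> \<le> (\<Sum>k\<le>n. Lcm {1..Suc n} div Suc n)"
  proof (rule sum_mono)
    fix k assume "k \<in> {..n}"
    then have "Suc n * (n choose k) \<le> Lcm {1..Suc n}"
      using leibniz_triangle_dvd_Lcm[of k n] pos by (intro dvd_imp_le) auto
    then show "n choose k \<le> Lcm {1..Suc n} div Suc n"
      by (simp add: less_eq_div_iff_mult_less_eq mult.commute)
  qed
  also have "\<dots> = Suc n * (Lcm {1..Suc n} div Suc n)"
    by simp
  also have "\<dots> \<le> Lcm {1..Suc n}"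
    by (rule times_div_less_eq_dividend)
  finally show ?thesis .
qed

text \<open>A prime occurs in \<open>m\<close> with exponent below k because m < 2^k, and every
  prime of \<open>m\<close> occurs in d^k with exponent at least k.\<close>

lemma dvd_power_if_prime_factors:
  fixes m d :: nat
  assumes "0 < m" "m < 2 ^ k" "0 < d" and "\<And>p. prime p \<Longrightarrow> p dvd m \<Longrightarrow> p dvd d"
  shows "m dvd d ^ k"
proof (rule multiplicity_le_imp_dvd)
  fix p :: nat assume p: "prime p"
  show "multiplicity p m \<le> multiplicity p (d ^ k)"
  proof (cases "p dvd m")
    case True
    have "2 ^ multiplicity p m \<le> p ^ multiplicity p m"
      using prime_ge_2_nat[OF p] by (rule power_mono) simp
    also have "\<dots> \<le> m"
      using multiplicity_dvd[of p m] \<open>0 < m\<close> by (rule dvd_imp_le)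
    finally have "(2::nat) ^ multiplicity p m < 2 ^ k"
      using assms(2) by linarith
    then have "multiplicity p m \<le> k"
      by simp
    also have "k \<le> k * multiplicity p d"
    proof -
      have "0 < multiplicity p d"
        using assms(3,4) p True by (simp add: prime_multiplicity_gt_zero_iff)
      then show ?thesis by simp
    qed
    also have "\<dots> = multiplicity p (d ^ k)"
      using p assms(3) by (simp add: prime_elem_multiplicity_power_distrib)
    finally show ?thesis .
  qed (simp add: not_dvd_imp_multiplicity_0)
qed (use assms in auto)

text \<open>If all primes up to n divided z, every m \<le> n would divide |z|^k, as m < 2^k. Then
  lcm(1..n) \<le> |z|^k < 2^(b k) \<le> 2^(n-1), against the lower bound on the lcm. The parameter k
  is merely a bound on the bit length of n.\<close>

lemma ex_prime_not_dvd:
  fixes z :: int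
  assumes "z \<noteq> 0" "\<bar>z\<bar> < 2 ^ b" "n < 2 ^ k" "b * k < n"
  shows "\<exists>p. prime p \<and> p \<le> n \<and> \<not> int p dvd z"
proof (rule ccontr)
  assume "\<not> ?thesis"
  then have all: "int p dvd z" if "prime p" "p \<le> n" for p
    using that by blast
  define d where "d = nat \<bar>z\<bar>"
  have d: "0 < d" "d < 2 ^ b"
    using assms(1,2) by (auto simp: d_def nat_less_iff)
  have "Lcm {1..n} dvd d ^ k"
  proof (rule Lcm_least)
    fix m assume m: "m \<in> {1..n}"
    show "m dvd d ^ k"
    proof (rule dvd_power_if_prime_factors)
      fix p assume p: "prime p" "p dvd m"
      then have "p \<le> n"
        using m dvd_imp_le[of p m] by auto
      then show "p dvd d"
        using all[OF p(1)] by (simp add: d_def dvd_nat_abs_iff)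
    qed (use m d assms(3) in auto)
  qed
  then have "Lcm {1..n} \<le> d ^ k"
    using d by (intro dvd_imp_le) auto
  also have "\<dots> < (2 ^ b) ^ k"
  proof -
    have "k \<noteq> 0"
      using assms(3,4) by (cases k) auto
    then show ?thesis
      using d by (intro power_strict_mono) auto
  qed
  also have "\<dots> = 2 ^ (b * k)"
    by (simp add: power_mult)
  also have "\<dots> \<le> 2 ^ (n - 1)"
    using assms(4) by (intro power_increasing) auto
  also have "\<dots> \<le> Lcm {1..Suc (n - 1)}"
    by (rule Lcm_ge_power)
  finally show False
    using assms(4) by simp
qed

section \<open>Chio condensation modulo a prime\<close>

lemma det_cong:
  assumes "\<And>i j. i < n \<Longrightarrow> j < n \<Longrightarrow> [f i j = g i j] (mod m)"
  shows "[det (mat n n (\<lambda>(i, j). f i j)) = det (mat n n (\<lambda>(i, j). g i j))] (mod (m :: int))"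
proof -
  let ?S = "\<lambda>h. \<Sum>p | p permutes {0..<n}. signof p * (\<Prod>i = 0..<n. h i (p i)) :: int"
  have "[signof p * (\<Prod>i = 0..<n. f i (p i)) = signof p * (\<Prod>i = 0..<n. g i (p i))] (mod m)"
    if "p permutes {0..<n}" for p
    using that assms by (intro cong_mult cong_prod cong_refl) (auto dest: permutes_in_image)
  then have "[?S f = ?S g] (mod m)"
    by (intro cong_sum) auto
  moreover have "det (mat n n (\<lambda>(i, j). h i j))
    = ?S h" for h :: "nat \<Rightarrow> nat \<Rightarrow> int"
    unfolding det_def'[OF mat_carrier]
    by (intro sum.cong arg_cong2[of _ _ _ _ "(*)"] prod.cong) (auto dest: permutes_in_image)
  ultimately show ?thesis by simp
qed

text \<open>Multiplication by \<open>E\<close> from the left turns every row i other than r into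
  \<open>b\<close> times row i minus \<open>f i 0\<close> times row r, which clears column 0 outside
  row r; expansion along that column leaves the smaller matrix. No division occurs, so the identity
  holds in every commutative ring, also for \<open>f r 0 = 0\<close>.\<close>

lemma det_condense:
  fixes f :: "nat \<Rightarrow> nat \<Rightarrow> 'a :: comm_ring_1"
  assumes r: "r \<le> n"
  shows "f r 0 ^ n * det (mat (Suc n) (Suc n) (\<lambda>(i, j). f i j)) = (- 1) ^ r * f r 0 *
    det (mat n n (\<lambda>(i, j). f r 0 * f (insert_index r i) (Suc j) - f (insert_index r i) 0 * f r (Suc j)))"
proof -
  let ?N = "Suc n"
  define b where "b = f r 0"
  define B where "B = mat ?N ?N (\<lambda>(i, j). f i j)"
  define E where "E = mat ?N ?N (\<lambda>(i, j). if i = r then of_bool (j = r)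
    else if j = r then - f i 0 else if i = j then b else 0)"
  define C where "C = mat ?N ?N (\<lambda>(i, j). if i = r then f r j else b * f i j - f i 0 * f r j)"
  have carr: "B \<in> carrier_mat ?N ?N" "E \<in> carrier_mat ?N ?N" "C \<in> carrier_mat ?N ?N"
    by (auto simp: B_def E_def C_def)
  \<comment> \<open>Row r of \<open>E\<close> is a unit vector. Deleting row and column r removes
    all entries \<open>- f i 0\<close> and leaves \<open>b\<close> times the identity.\<close>
  have "det E = (\<Sum>j<?N. E $$ (r, j) * cofactor E r j)"
    using r by (intro laplace_expansion_row[OF carr(2)]) auto
  also have "\<dots> = (\<Sum>j<?N. if j = r then cofactor E r r else 0)"
    using r by (intro sum.cong) (auto simp: E_def)
  also have "\<dots> = det (mat_delete E r r)"
    using r by (simp add: cofactor_def)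
  also have "mat_delete E r r = b \<cdot>\<^sub>m 1\<^sub>m n"
    by (rule eq_matI) (auto simp: mat_delete_def E_def)
  finally have E: "det E = b ^ n" by simp
  have EB: "E * B = C"
  proof (rule eq_matI)
    fix i j assume "i < dim_row C" "j < dim_col C"
    then have ij: "i < ?N" "j < ?N" by (auto simp: C_def)
    have "(E * B) $$ (i, j) = (\<Sum>k<?N. E $$ (i, k) * B $$ (k, j))"
      using ij carr by (auto simp: scalar_prod_def lessThan_atLeast0 intro!: sum.cong)
    also have "\<dots> = (\<Sum>k<?N. if k = r then E $$ (i, r) * f r j else 0)
        + (\<Sum>k<?N. if k = i then (if i = r then 0 else b * f i j) else 0)"
      unfolding sum.distrib[symmetric] using ij r by (intro sum.cong) (auto simp: E_def B_def)
    also have "\<dots> = C $$ (i, j)"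
      using ij r by (simp add: C_def E_def)
    finally show "(E * B) $$ (i, j) = C $$ (i, j)" .
  qed (auto simp: E_def B_def C_def)
  have "det C = (\<Sum>i<?N. C $$ (i, 0) * cofactor C i 0)"
    by (rule laplace_expansion_column[OF carr(3)]) simp
  also have "\<dots> = (\<Sum>i<?N. if i = r then b * cofactor C r 0 else 0)"
    using r by (intro sum.cong) (auto simp: C_def b_def)
  also have "\<dots> = (- 1) ^ r * b * det (mat_delete C r 0)"
    using r by (simp add: cofactor_def)
  also have "mat_delete C r 0 = mat n n (\<lambda>(i, j). b * f (insert_index r i) (Suc j) - f (insert_index r i) 0 * f r (Suc j))"
    by (rule eq_matI) (auto simp: mat_delete_def C_def insert_index_def)
  finally have "det C = (- 1) ^ r * b *
    det (mat n n (\<lambda>(i, j). b * f (insert_index r i) (Suc j) - f (insert_index r i) 0 * f r (Suc j)))" .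
  moreover have "det C = b ^ n * det B"
    using det_mult[OF carr(2,1)] unfolding EB E .
  ultimately show ?thesis
    by (simp add: b_def B_def)
qed

text \<open>The pivot search omits the last row: if no earlier row has a nonzero first entry, the
  default \<open>n - 1\<close> is the last row, the only remaining candidate. The term
  \<open>p - g r (Suc j)\<close> is a negative modulo \<open>p\<close>, which keeps the computation
  in the naturals.\<close>

definition condense :: "nat \<Rightarrow> nat \<Rightarrow> (nat \<Rightarrow> nat \<Rightarrow> nat) \<Rightarrow> nat \<Rightarrow> nat \<Rightarrow> nat" where
  "condense p n g i j = (let r = least_below (n - 1) (\<lambda>r. g r 0 \<noteq> 0); i' = insert_index r i
     in (g r 0 * g i' (Suc j) + g i' 0 * (p - g r (Suc j))) mod p)"

primrec chio :: "nat \<Rightarrow> nat \<Rightarrow> (nat \<Rightarrow> nat \<Rightarrow> nat) \<Rightarrow> nat \<Rightarrow> nat \<Rightarrow> nat \<Rightarrow> nat" where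
  "chio p n g 0 = g"
| "chio p n g (Suc t) = condense p (n - t) (chio p n g t)"

text \<open>\<open>chio\<close> recurses on the last condensation, whereas the induction in its
  correctness proof peels off the first one.\<close>

lemma chio_Suc: "chio p (Suc n) g (Suc t) = chio p n (condense p (Suc n) g) t"
  by (induction t) simp_all

text \<open>The pivot lies strictly between 0 and \<open>p\<close>, hence is invertible modulo
  \<open>p\<close>; so the power, the sign and the factor \<open>g r 0\<close> in the condensation
  identity do not affect divisibility.\<close>

lemma prime_dvd_det_condense:
  assumes p: "prime p" and g: "\<And>i j. i \<le> n \<Longrightarrow> j \<le> n \<Longrightarrow> g i j < p" and ex: "i \<le> n" "g i 0 \<noteq> 0"
  shows "int p dvd det (mat (Suc n) (Suc n) (\<lambda>(i, j). int (g i j))) \<longleftrightarrow>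
    int p dvd det (mat n n (\<lambda>(i, j). int (condense p (Suc n) g i j)))"
proof -
  define r where "r = least_below n (\<lambda>r. g r 0 \<noteq> 0)"
  \<comment> \<open>If the search below n fails, then \<open>r = n\<close>, and the row
    \<open>i\<close> with a nonzero first entry must be that last row.\<close>
  have r: "r \<le> n" "g r 0 \<noteq> 0"
    using least_below_le[of n "\<lambda>r. g r 0 \<noteq> 0"] least_below_prop[of n "\<lambda>r. g r 0 \<noteq> 0"]
      least_below_less[of i n "\<lambda>r. g r 0 \<noteq> 0"] ex unfolding r_def by (auto simp: le_less)
  let ?M = "mat n n (\<lambda>(i, j). int (g r 0) * int (g (insert_index r i) (Suc j)) - int (g (insert_index r i) 0) * int (g r (Suc j)))"
  have ndvd: "\<not> int p dvd int (g r 0)"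
    using r g[of r 0] by (auto dest: dvd_imp_le)
  have prime: "prime (int p)" using p by simp
  have "[int (condense p (Suc n) g i j) =
      int (g r 0) * int (g (insert_index r i) (Suc j)) - int (g (insert_index r i) 0) * int (g r (Suc j))] (mod int p)"
    if "i < n" "j < n" for i j
  proof -
    have "g r (Suc j) \<le> p" using g[of r "Suc j"] r that by simp
    then have "int (p - g r (Suc j)) = int p - int (g r (Suc j))" by (simp add: of_nat_diff)
    then have "int (condense p (Suc n) g i j) = (int (g r 0) * int (g (insert_index r i) (Suc j))
      + int (g (insert_index r i) 0) * (int p - int (g r (Suc j)))) mod int p"
      unfolding condense_def Let_def diff_Suc_1 r_def[symmetric] by (simp only: zmod_int of_nat_add of_nat_mult)
    also have "\<dots> = (int (g r 0) * int (g (insert_index r i) (Suc j))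
      - int (g (insert_index r i) 0) * int (g r (Suc j)) + int p * int (g (insert_index r i) 0)) mod int p"
      by (simp only: algebra_simps)
    finally show ?thesis by (simp add: cong_def)
  qed
  from det_cong[of n, OF this]
  have "int p dvd det (mat n n (\<lambda>(i, j). int (condense p (Suc n) g i j))) \<longleftrightarrow>
     int p dvd det ?M"
    by (rule cong_dvd_iff)
  also have "\<dots> \<longleftrightarrow> int p dvd (- 1) ^ r * int (g r 0) * det ?M"
    using ndvd prime by (auto simp: prime_dvd_mult_iff minus_one_power_iff)
  also have "\<dots> \<longleftrightarrow> int p dvd int (g r 0) ^ n * det (mat (Suc n) (Suc n) (\<lambda>(i, j). int (g i j)))"
    unfolding det_condense[OF r(1), of "\<lambda>i j. int (g i j)"] ..
  also have "\<dots> \<longleftrightarrow> int p dvd det (mat (Suc n) (Suc n) (\<lambda>(i, j). int (g i j)))"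
  proof -
    have "\<not> int p dvd int (g r 0) ^ n"
      using ndvd prime prime_dvd_power by blast
    then show ?thesis using prime by (simp add: prime_dvd_mult_iff)
  qed
  finally show ?thesis ..
qed

text \<open>A nonzero first column permits a condensation that preserves divisibility by
  \<open>p\<close>; a zero first column makes the determinant vanish. Stages after a failed one are
  meaningless, but the conjunction over \<open>t\<close> is already false then. The empty
  determinant 1 starts the induction.\<close>

lemma chio_correct:
  assumes p: "prime p" and "\<And>i j. i < n \<Longrightarrow> j < n \<Longrightarrow> g i j < p"
  shows "\<not> int p dvd det (mat n n (\<lambda>(i, j). int (g i j))) \<longleftrightarrow>
    (\<forall>t<n. \<exists>r<n - t. chio p n g t r 0 \<noteq> 0)"
  using assms(2)
proof (induction n arbitrary: g)
  case 0
  have "\<not> int p dvd 1" using p by auto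
  then show ?case by simp
next
  case (Suc n)
  show ?case
  proof (cases "\<exists>i\<le>n. g i 0 \<noteq> 0")
    case True
    then obtain i where i: "i \<le> n" "g i 0 \<noteq> 0" by blast
    have "\<not> int p dvd det (mat (Suc n) (Suc n) (\<lambda>(i, j). int (g i j))) \<longleftrightarrow>
      \<not> int p dvd det (mat n n (\<lambda>(i, j). int (condense p (Suc n) g i j)))"
      using prime_dvd_det_condense[of p n g i, OF p] i Suc.prems by simp
    also have "\<dots> \<longleftrightarrow> (\<forall>t<n. \<exists>r<n - t. chio p n (condense p (Suc n) g) t r 0 \<noteq> 0)"
      using p prime_gt_0_nat by (intro Suc.IH) (auto simp: condense_def Let_def)
    also have "\<dots> \<longleftrightarrow> (\<forall>t<Suc n. \<exists>r<Suc n - t. chio p (Suc n) g t r 0 \<noteq> 0)"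
      unfolding All_less_Suc2 chio_Suc diff_Suc_Suc using i by (auto simp: less_Suc_eq_le)
    finally show ?thesis .
  next
    case False
    have "det (mat (Suc n) (Suc n) (\<lambda>(i, j). int (g i j))) = 0"
    proof -
      have "det (mat (Suc n) (Suc n) (\<lambda>(i, j). int (g i j)))
        = (\<Sum>i<Suc n. mat (Suc n) (Suc n) (\<lambda>(i, j). int (g i j)) $$ (i, 0) * cofactor (mat (Suc n) (Suc n) (\<lambda>(i, j). int (g i j))) i 0)"
        by (rule laplace_expansion_column) auto
      then show ?thesis using False by simp
    qed
    moreover have "\<not> (\<exists>r<Suc n - 0. chio p (Suc n) g 0 r 0 \<noteq> 0)"
      using False by auto
    ultimately show ?thesis by fastforce
  qed
qed

section \<open>Reduction of rational determinants modulo primes\<close>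

text \<open>The fractions may be unreduced: the 0s and 1s of a replaced row are written over the
  denominators of the original matrix, so that the same condition on denominators serves all
  replacements.\<close>

locale rational_matrix =
  fixes n :: nat and num den :: "nat \<Rightarrow> nat \<Rightarrow> int"
  assumes den_pos: "\<And>i j. i < n \<Longrightarrow> j < n \<Longrightarrow> 0 < den i j"
begin

definition ratmat :: "rat mat" where
  "ratmat = mat n n (\<lambda>(i, j). of_int (num i j) / of_int (den i j))"

definition common_den :: int where "common_den = (\<Prod>i<n. \<Prod>j<n. den i j)"

definition intmat :: "int mat" where
  "intmat = mat n n (\<lambda>(i, j). num i j * (common_den div den i j))"

lemma den_dvd: "i < n \<Longrightarrow> j < n \<Longrightarrow> den i j dvd common_den"
  unfolding common_den_def
  by (rule dvd_trans[OF dvd_prodI[of "{..<n}" j "den i"] dvd_prodI[of "{..<n}" i "\<lambda>i. \<Prod>j<n. den i j"]]) auto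

lemma common_den_pos: "0 < common_den"
  unfolding common_den_def using den_pos by (intro prod_pos) auto

lemma det_intmat: "of_int (det intmat) = of_int common_den ^ n * det ratmat"
proof -
  have "map_mat of_int intmat = of_int common_den \<cdot>\<^sub>m ratmat"
  proof (rule eq_matI)
    fix i j assume "i < dim_row (of_int common_den \<cdot>\<^sub>m ratmat)" "j < dim_col (of_int common_den \<cdot>\<^sub>m ratmat)"
    then have ij: "i < n" "j < n" by (auto simp: ratmat_def)
    have "rat_of_int (common_den div den i j) = of_int common_den / of_int (den i j)"
      using den_dvd[OF ij] den_pos[OF ij] by (auto simp: dvd_def)
    then show "map_mat rat_of_int intmat $$ (i, j) = (of_int common_den \<cdot>\<^sub>m ratmat) $$ (i, j)"
      using ij by (simp add: intmat_def ratmat_def)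
  qed (auto simp: intmat_def ratmat_def)
  then have "det (map_mat of_int intmat) = of_int common_den ^ n * det ratmat"
    by (simp add: ratmat_def)
  then show ?thesis
    by simp
qed

lemma det_intmat_eq_0_iff: "det intmat = 0 \<longleftrightarrow> det ratmat = 0"
  using det_intmat common_den_pos
  by (metis less_irrefl mult_eq_0_iff of_int_0_eq_iff power_eq_0_iff)

lemma prime_dvd_common_den_iff:
  "prime p \<Longrightarrow> int p dvd common_den \<longleftrightarrow> (\<exists>i<n. \<exists>j<n. int p dvd den i j)"
  unfolding common_den_def by (subst prime_dvd_prod_iff, auto simp: prime_dvd_prod_iff)

text \<open>Multiplying the residues by \<open>common_den\<close> gives \<open>intmat\<close> modulo
  p entrywise, and \<open>common_den\<close> is invertible modulo p; so the two determinants differ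
  by a unit.\<close>

lemma prime_dvd_det_residues_iff:
  assumes p: "prime p" and ndvd: "\<And>i j. i < n \<Longrightarrow> j < n \<Longrightarrow> \<not> int p dvd den i j"
    and v: "\<And>i j. i < n \<Longrightarrow> j < n \<Longrightarrow> [den i j * v i j = num i j] (mod int p)"
  shows "int p dvd det (mat n n (\<lambda>(i, j). v i j)) \<longleftrightarrow> int p dvd det intmat"
proof -
  have D: "\<not> int p dvd common_den"
    using ndvd prime_dvd_common_den_iff[OF p] by blast
  have prime: "prime (int p)" using p by simp
  have "[common_den * v i j = num i j * (common_den div den i j)] (mod int p)" if ij: "i < n" "j < n" for i j
  proof -
    have c: "common_den = den i j * (common_den div den i j)"
      using den_dvd[OF ij] by simp
    have "[(den i j * v i j) * (common_den div den i j) = num i j * (common_den div den i j)] (mod int p)"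
      by (intro cong_mult v ij cong_refl)
    then show ?thesis
      by (subst c) (simp add: ac_simps)
  qed
  from det_cong[OF this]
  have "[det (mat n n (\<lambda>(i, j). common_den * v i j)) = det intmat] (mod int p)"
    unfolding intmat_def .
  moreover have "mat n n (\<lambda>(i, j). common_den * v i j) = common_den \<cdot>\<^sub>m mat n n (\<lambda>(i, j). v i j)"
    by (rule eq_matI) auto
  ultimately have "[common_den ^ n * det (mat n n (\<lambda>(i, j). v i j)) = det intmat] (mod int p)"
    by simp
  from cong_dvd_iff[OF this] have "int p dvd common_den ^ n * det (mat n n (\<lambda>(i, j). v i j)) \<longleftrightarrow> int p dvd det intmat" .
  moreover have "\<not> int p dvd common_den ^ n"
    using D prime prime_dvd_power by blast
  ultimately show ?thesis
    using prime by (simp add: prime_dvd_mult_iff)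
qed

text \<open>The product of the n^2 denominators is at most 2^(b n^2), each entry of
  \<open>intmat\<close> at most 2^(b + b n^2), and there are n! \<le> 2^(n^2) Leibniz terms. The
  product of \<open>common_den\<close> and the determinant is bounded because one prime has to avoid
  both.\<close>

lemma abs_common_den_det_less:
  assumes "\<And>i j. i < n \<Longrightarrow> j < n \<Longrightarrow> \<bar>num i j\<bar> \<le> 2 ^ b" "\<And>i j. i < n \<Longrightarrow> j < n \<Longrightarrow> den i j \<le> 2 ^ b"
  shows "\<bar>common_den * det intmat\<bar> \<le> 2 ^ (b * n ^ 2 + n * (n + b + b * n ^ 2))"
proof -
  have "common_den \<le> (\<Prod>i<n. \<Prod>j<n. 2 ^ b)"
    unfolding common_den_def using assms(2) den_pos by (intro prod_mono conjI prod_nonneg) (auto intro: less_imp_le)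
  also have "\<dots> = 2 ^ (b * n ^ 2)"
    by (simp add: power_mult[symmetric] power2_eq_square mult.assoc)
  finally have D: "common_den \<le> 2 ^ (b * n ^ 2)" .
  have entry: "\<bar>intmat $$ (i, j)\<bar> \<le> 2 ^ (b + b * n ^ 2)" if ij: "i < n" "j < n" for i j
  proof -
    define q where "q = common_den div den i j"
    have q: "common_den = den i j * q"
      using den_dvd[OF ij] by (simp add: q_def)
    then have "0 < q"
      using common_den_pos den_pos[OF ij] by (simp add: zero_less_mult_iff)
    then have "q \<le> common_den"
      unfolding q using den_pos[OF ij] by simp
    then have "\<bar>num i j\<bar> * q \<le> 2 ^ b * 2 ^ (b * n ^ 2)"
      using assms(1)[OF ij] D \<open>0 < q\<close> \<open>q \<le> common_den\<close> by (intro mult_mono) auto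
    then show ?thesis
      using ij \<open>0 < q\<close> by (simp add: intmat_def abs_mult power_add q_def)
  qed
  have "\<bar>det intmat\<bar> \<le> (\<Sum>p | p permutes {0..<n}. \<bar>signof p * (\<Prod>i = 0..<n. intmat $$ (i, p i))\<bar>)"
    by (subst det_def'[of _ n]) (auto simp: intmat_def sum_abs)
  also have "\<dots> \<le> (\<Sum>p | p permutes {0..<n}. (2 ^ (b + b * n ^ 2)) ^ n)"
  proof (rule sum_mono)
    fix p assume "p \<in> {p. p permutes {0..<n}}"
    then have p: "p permutes {0..<n}" by simp
    have "\<bar>signof p * (\<Prod>i = 0..<n. intmat $$ (i, p i))\<bar> = (\<Prod>i = 0..<n. \<bar>intmat $$ (i, p i)\<bar>)"
      by (simp add: abs_mult abs_prod sign_def)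
    also have "\<dots> \<le> (\<Prod>i = 0..<n. 2 ^ (b + b * n ^ 2))"
      using p by (intro prod_mono conjI entry) (auto dest: permutes_in_image)
    finally show "\<bar>signof p * (\<Prod>i = 0..<n. intmat $$ (i, p i))\<bar> \<le> (2 ^ (b + b * n ^ 2)) ^ n"
      by simp
  qed
  also have "\<dots> = fact n * (2 ^ (b + b * n ^ 2)) ^ n"
    by (simp add: card_permutations[OF refl])
  also have "\<dots> \<le> 2 ^ (n * n) * (2 ^ (b + b * n ^ 2)) ^ n"
  proof (rule mult_right_mono)
    have "fact n \<le> n ^ n"
      using fact_le_power[of n, where 'a = nat] by simp
    also have "n ^ n \<le> (2 ^ n) ^ n"
      by (rule power_mono[OF less_imp_le[OF less_exp]]) simp
    finally have "fact n \<le> (2::nat) ^ (n * n)"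
      by (simp add: power_mult)
    then show "fact n \<le> (2::int) ^ (n * n)"
      by (metis of_nat_fact of_nat_le_iff of_nat_numeral of_nat_power)
  qed simp
  also have "\<dots> = 2 ^ (n * (n + b + b * n ^ 2))"
    by (simp add: power_mult[symmetric] power_add[symmetric] algebra_simps)
  finally have "\<bar>det intmat\<bar> \<le> 2 ^ (n * (n + b + b * n ^ 2))" .
  then have "common_den * \<bar>det intmat\<bar> \<le> 2 ^ (b * n ^ 2) * 2 ^ (n * (n + b + b * n ^ 2))"
    using D common_den_pos by (intro mult_mono) auto
  then show ?thesis
    using common_den_pos by (simp add: abs_mult power_add)
qed

text \<open>With x = b + 2 the exponent of the size bound is below x^6. Since x^12 \<le> 2^(12 x),
  the existence lemma applies with k = 12 x once 12 x^7 < x^12 - 1, which holds for x \<ge> 2. The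
  exponent 12 leaves room and is not meant to be optimal.\<close>

lemma ex_small_prime:
  assumes "det ratmat \<noteq> 0" and "n \<le> b"
    and "\<And>i j. i < n \<Longrightarrow> j < n \<Longrightarrow> \<bar>num i j\<bar> \<le> 2 ^ b" "\<And>i j. i < n \<Longrightarrow> j < n \<Longrightarrow> den i j \<le> 2 ^ b"
  shows "\<exists>p. prime p \<and> p < (b + 2) ^ 12 \<and> (\<forall>i<n. \<forall>j<n. \<not> int p dvd den i j) \<and> \<not> int p dvd det intmat"
proof -
  define x where "x = b + 2"
  have x: "2 \<le> x" "b \<le> x" "n \<le> x" using assms(2) by (auto simp: x_def)
  have sq: "n ^ 2 \<le> x ^ 2" using x(3) by (rule power_mono) simp
  have x2: "2 * x ^ k \<le> x ^ Suc k" for k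
    using x(1) by simp
  have pos: "0 < x ^ k" for k
    using x(1) by simp
  have "b * n ^ 2 + n * (n + b + b * n ^ 2) \<le> x * x ^ 2 + x * (x + x + x * x ^ 2)"
    using x sq by (intro add_mono mult_mono) auto
  also have "\<dots> = x ^ 3 + 2 * x ^ 2 + x ^ 4"
    by (simp add: algebra_simps power2_eq_square power3_eq_cube power4_eq_xxxx)
  also have "\<dots> < x ^ 6"
  proof -
    have "2 * x ^ 2 \<le> x ^ 3" "2 * x ^ 3 \<le> x ^ 4" "2 * x ^ 4 \<le> x ^ 5" "2 * x ^ 5 \<le> x ^ 6"
      using x2[of 2] x2[of 3] x2[of 4] x2[of 5] by simp_all
    then show ?thesis using pos[of 5] by linarith
  qed
  finally have e: "b * n ^ 2 + n * (n + b + b * n ^ 2) < x ^ 6" .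
  have "\<exists>p. prime p \<and> p \<le> x ^ 12 - 1 \<and> \<not> int p dvd common_den * det intmat"
  proof (rule ex_prime_not_dvd)
    show "common_den * det intmat \<noteq> 0"
      using assms(1) common_den_pos det_intmat_eq_0_iff by simp
    have "\<bar>common_den * det intmat\<bar> \<le> 2 ^ (b * n ^ 2 + n * (n + b + b * n ^ 2))"
      using assms(3,4) by (rule abs_common_den_det_less)
    also have "\<dots> < 2 ^ (x ^ 6)"
      using e by (rule power_strict_increasing) simp
    finally show "\<bar>common_den * det intmat\<bar> < 2 ^ (x ^ 6)" .
    have "x ^ 12 \<le> (2 ^ x) ^ 12"
      by (rule power_mono[OF less_imp_le[OF less_exp]]) simp
    also have "\<dots> = 2 ^ (12 * x)"
      by (simp add: power_mult[symmetric] mult.commute)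
    finally show "x ^ 12 - 1 < 2 ^ (12 * x)"
      using pos[of 12] by linarith
    have "x ^ 6 * (12 * x) = 12 * x ^ 7"
      using power_Suc2[of x 6] by simp
    moreover have "2 * x ^ 7 \<le> x ^ 8" "2 * x ^ 8 \<le> x ^ 9" "2 * x ^ 9 \<le> x ^ 10" "2 * x ^ 10 \<le> x ^ 11"
        "2 * x ^ 11 \<le> x ^ 12"
      using x2[of 7] x2[of 8] x2[of 9] x2[of 10] x2[of 11] by simp_all
    ultimately show "x ^ 6 * (12 * x) < x ^ 12 - 1"
      using pos[of 7] by linarith
  qed
  then obtain p where p: "prime p" "p \<le> x ^ 12 - 1" "\<not> int p dvd common_den * det intmat"
    by blast
  have "p < x ^ 12"
    using p(2) pos[of 12] by linarith
  moreover have "\<not> int p dvd common_den" "\<not> int p dvd det intmat"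
    using p(3) by auto
  ultimately show ?thesis
    using p(1) prime_dvd_common_den_iff[OF p(1)] unfolding x_def by blast
qed

end

section \<open>Decoding\<close>

definition bit_at :: "bool list \<Rightarrow> nat \<Rightarrow> bool" where
  "bit_at w s \<longleftrightarrow> s < length w \<and> w ! s"

text \<open>The continuation flags of a number that starts at \<open>s\<close> stand at
  \<open>s\<close>, \<open>s + 2\<close>, and so on; the first one that is false ends the number.
  The position returned is the one behind it.\<close>

definition nat_end :: "bool list \<Rightarrow> nat \<Rightarrow> nat" where
  "nat_end w s = Suc (s + 2 * least_below (length w) (\<lambda>i. \<not> bit_at w (s + 2 * i)))"

text \<open>Horner's scheme modulo \<open>p\<close> on the bits between the flags, least significant
  first. The value at \<open>s\<close> depends only on the one at \<open>s + 2\<close>, so a table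
  over all positions can be filled from the end of the word.\<close>

function residue_at :: "bool list \<Rightarrow> nat \<Rightarrow> nat \<Rightarrow> nat" where
  "residue_at w p s = (if s + 2 \<le> length w \<and> bit_at w s
     then (of_bool (bit_at w (s + 1)) + 2 * residue_at w p (s + 2)) mod p else 0)"
  by auto
termination by (relation "measure (\<lambda>(w, p, s). length w - s)") auto

declare residue_at.simps [simp del]

lemma bits_0 [simp]: "bits 0 = []"
  by (simp add: bits.simps)

lemma bits_pos: "0 < m \<Longrightarrow> bits m = odd m # bits (m div 2)"
  by (simp add: bits.simps[of m])

lemma enc_nat_0: "enc_nat 0 = [False]"
  by (simp add: enc_nat_def)

lemma enc_nat_pos: "0 < m \<Longrightarrow> enc_nat m = True # odd m # enc_nat (m div 2)"
  by (simp add: enc_nat_def bits_pos)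

lemma less_power_length_bits: "m < 2 ^ length (bits m)"
proof (induction m rule: bits.induct)
  case (1 n)
  then show ?case
    by (cases "n = 0") (auto simp: bits_pos)
qed

lemma length_enc_nat: "length (enc_nat m) = 2 * length (bits m) + 1"
  unfolding enc_nat_def by (induction "bits m" arbitrary: m) (simp_all add: sum_list_triv comp_def length_concat)

lemma enc_nat_nth_even: "i \<le> length (bits m) \<Longrightarrow> enc_nat m ! (2 * i) \<longleftrightarrow> i < length (bits m)"
proof (induction m arbitrary: i rule: bits.induct)
  case (1 n)
  then show ?case
    by (cases "n = 0"; cases i) (auto simp: bits_pos enc_nat_pos enc_nat_0)
qed

lemma bit_at_drop: "drop s w = v @ u \<Longrightarrow> i < length v \<Longrightarrow> bit_at w (s + i) \<longleftrightarrow> v ! i"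
proof -
  assume *: "drop s w = v @ u" "i < length v"
  then have "length v \<le> length w - s"
    by (metis append_is_Nil_conv le_add1 length_append length_drop)
  then have "s + i < length w" using *(2) by simp
  moreover have "w ! (s + i) = v ! i"
    using * by (metis \<open>s + i < length w\<close> add_leE nth_append nth_drop order_less_imp_le)
  ultimately show ?thesis by (simp add: bit_at_def)
qed

lemma length_le_if_drop:
  assumes "drop s w = v @ u" "v \<noteq> []"
  shows "s + length v \<le> length w"
proof -
  have "length w - s = length v + length u"
    using arg_cong[OF assms(1), of length] by simp
  moreover have "0 < length v" using assms(2) by simp
  ultimately show ?thesis by linarith
qed

lemma drop_Suc_if: "drop s w = x # v \<Longrightarrow> drop (Suc s) w = v"
  by (metis drop_Suc list.sel(3) tl_drop)

lemma nat_end_eq: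
  assumes w: "drop s w = enc_nat m @ u"
  shows "nat_end w s = s + length (enc_nat m)"
proof -
  have "s + length (enc_nat m) \<le> length w"
    using w by (rule length_le_if_drop) (simp add: enc_nat_def)
  then have len: "length (bits m) < length w"
    by (simp add: length_enc_nat)
  have "least_below (length w) (\<lambda>i. \<not> bit_at w (s + 2 * i)) = length (bits m)"
    by (rule least_below_eqI) (use len bit_at_drop[OF w] in \<open>auto simp: length_enc_nat enc_nat_nth_even\<close>)
  then show ?thesis
    by (simp add: nat_end_def length_enc_nat)
qed

lemma nat_end_le: "drop s w = enc_nat m @ u \<Longrightarrow> nat_end w s \<le> length w"
  using nat_end_eq[of s w m u] length_le_if_drop[of s w "enc_nat m" u] by (simp add: enc_nat_def)

lemma drop_nat_end: "drop s w = enc_nat m @ u \<Longrightarrow> drop (nat_end w s) w = u"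
  using nat_end_eq[of s w m u] by (metis add.commute append_eq_conv_conj drop_drop)

lemma residue_at_eq: "drop s w = enc_nat m @ u \<Longrightarrow> residue_at w p s = m mod p"
proof (induction m arbitrary: s rule: bits.induct)
  case (1 n)
  show ?case
  proof (cases "n = 0")
    case True
    then have "\<not> bit_at w s"
      using bit_at_drop[OF 1(2), of 0] by (simp add: enc_nat_0)
    then show ?thesis using True by (simp add: residue_at.simps)
  next
    case False
    then have e: "enc_nat n = True # odd n # enc_nat (n div 2)"
      by (simp add: enc_nat_pos)
    then have "bit_at w s" "bit_at w (Suc s) \<longleftrightarrow> odd n" "s + 2 \<le> length w"
      using bit_at_drop[OF 1(2), of 0] bit_at_drop[OF 1(2), of 1] length_le_if_drop[OF 1(2)]
      by auto
    moreover have "residue_at w p (s + 2) = n div 2 mod p"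
      using 1(1)[OF False, of "s + 2"] drop_Suc_if[OF drop_Suc_if[OF 1(2)[unfolded e append_Cons]]] by simp
    ultimately have "residue_at w p s = (of_bool (odd n) + 2 * (n div 2 mod p)) mod p"
      by (simp add: residue_at.simps[of w p s])
    also have "\<dots> = (of_bool (odd n) + 2 * (n div 2)) mod p"
      by (metis mod_add_right_eq mod_mult_right_eq)
    also have "of_bool (odd n) + 2 * (n div 2) = n"
      by (cases "even n") auto
    finally show ?thesis .
  qed
qed

lemma bit_at_enc_nat: "drop s w = enc_nat m @ u \<Longrightarrow> bit_at w s \<longleftrightarrow> m \<noteq> 0"
  using bit_at_drop[of s w "enc_nat m" u 0] by (cases "m = 0") (auto simp: enc_nat_0 enc_nat_pos)

text \<open>The dimension is skipped at the start; for each entry, \<open>+ 1\<close> skips the sign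
  bit and the two calls of \<open>nat_end\<close> skip numerator and denominator.\<close>

primrec entry_start :: "bool list \<Rightarrow> nat \<Rightarrow> nat" where
  "entry_start w 0 = nat_end w 0"
| "entry_start w (Suc k) = nat_end w (nat_end w (entry_start w k + 1))"

lemma enc_rat_eq:
  "quotient_of r = (a, b) \<Longrightarrow> enc_rat r = (a < 0) # enc_nat (nat \<bar>a\<bar>) @ enc_nat (nat b)"
  by (simp add: enc_rat_def enc_int_def)

locale encoded_list =
  fixes w :: "bool list" and n :: nat and xs :: "rat list"
  assumes w: "w = enc_nat n @ concat (map enc_rat xs)"
begin

lemma drop_entry_start:
  "k \<le> length xs \<Longrightarrow> drop (entry_start w k) w = concat (map enc_rat (drop k xs))
    \<and> entry_start w k \<le> length w"
proof (induction k)
  case 0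
  then show ?case using drop_nat_end[of 0 w n] nat_end_le[of 0 w n] w by simp
next
  case (Suc k)
  obtain a b where ab: "quotient_of (xs ! k) = (a, b)" by fastforce
  have "drop (entry_start w k) w = enc_rat (xs ! k) @ concat (map enc_rat (drop (Suc k) xs))"
    using Suc by (simp flip: Cons_nth_drop_Suc)
  then have "drop (entry_start w k + 1) w
    = enc_nat (nat \<bar>a\<bar>) @ (enc_nat (nat b) @ concat (map enc_rat (drop (Suc k) xs)))"
    using drop_Suc_if by (simp add: enc_rat_eq[OF ab])
  from drop_nat_end[OF drop_nat_end[OF this]] nat_end_le[OF drop_nat_end[OF this]] show ?case
    by simp
qed

lemma entry:
  assumes k: "k < length xs" and ab: "quotient_of (xs ! k) = (a, b)"
  defines "s \<equiv> entry_start w k"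
  shows "bit_at w s \<longleftrightarrow> a < 0" "bit_at w (s + 1) \<longleftrightarrow> a \<noteq> 0"
    "residue_at w p (s + 1) = nat \<bar>a\<bar> mod p" "residue_at w p (nat_end w (s + 1)) = nat b mod p"
    "\<bar>a\<bar> \<le> 2 ^ length w" "b \<le> 2 ^ length w"
    "s + 1 \<le> length w" "nat_end w (s + 1) \<le> length w"
proof -
  have *: "drop s w = enc_rat (xs ! k) @ concat (map enc_rat (drop (Suc k) xs))"
    unfolding s_def using k drop_entry_start[of k] by (simp flip: Cons_nth_drop_Suc)
  show "bit_at w s \<longleftrightarrow> a < 0"
    using bit_at_drop[OF *, of 0] by (simp add: enc_rat_eq[OF ab])
  have num: "drop (s + 1) w = enc_nat (nat \<bar>a\<bar>) @ (enc_nat (nat b) @ concat (map enc_rat (drop (Suc k) xs)))"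
    using * drop_Suc_if by (simp add: enc_rat_eq[OF ab])
  note den = drop_nat_end[OF num]
  show "bit_at w (s + 1) \<longleftrightarrow> a \<noteq> 0"
    using bit_at_enc_nat[OF num] by simp
  show "residue_at w p (s + 1) = nat \<bar>a\<bar> mod p" "residue_at w p (nat_end w (s + 1)) = nat b mod p"
    using residue_at_eq[OF num] residue_at_eq[OF den] by auto
  have le: "int m \<le> 2 ^ length w" if "drop s w = enc_nat m @ u" for s m u
  proof -
    have "length (bits m) \<le> length w"
      using length_le_if_drop[OF that] length_enc_nat[of m] by (auto simp: enc_nat_def)
    then have "(2::nat) ^ length (bits m) \<le> 2 ^ length w"
      by (intro power_increasing) auto
    then have "m \<le> 2 ^ length w"
      using less_power_length_bits[of m] by linarith
    then show ?thesis by (metis of_nat_le_iff of_nat_numeral of_nat_power)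
  qed
  show "\<bar>a\<bar> \<le> 2 ^ length w" "b \<le> 2 ^ length w"
    using le[OF num] le[OF den] by linarith+
  show "s + 1 \<le> length w" "nat_end w (s + 1) \<le> length w"
    using length_le_if_drop[OF num] nat_end_le[OF num] by (simp_all add: enc_nat_def)
qed

lemma length_entries_le: "length (concat (map enc_rat ys)) \<ge> length ys"
  by (induction ys) (auto simp: enc_rat_def enc_int_def split: prod.splits)

lemma length_xs_le: "length xs < length w"
  using length_entries_le[of xs] by (simp add: w length_enc_nat)

lemma entry_start_le: "k \<le> length xs \<Longrightarrow> entry_start w k \<le> length w"
  using drop_entry_start by blast

text \<open>Every rational takes at least one bit, so the end of the word is reached only with the
  last entry. The program recovers the dimension from this instead of decoding the binary number at
  the front.\<close>

lemma entry_start_eq_length_iff: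
  assumes "k \<le> length xs"
  shows "entry_start w k = length w \<longleftrightarrow> k = length xs"
proof -
  have "entry_start w k = length w \<longleftrightarrow> concat (map enc_rat (drop k xs)) = []"
    using drop_entry_start[OF assms] by (metis drop_eq_Nil le_antisym order_refl)
  also have "\<dots> \<longleftrightarrow> length (drop k xs) = 0"
    using length_entries_le[of "drop k xs"] by (metis le_zero_eq length_0_conv list.map(1) concat.simps(1))
  finally show ?thesis using assms by auto
qed

end

section \<open>Infinite regularity radius\<close>

lemma invertible_mat_iff_det:
  fixes M :: "'a :: field mat"
  assumes M: "M \<in> carrier_mat n n"
  shows "invertible_mat M \<longleftrightarrow> det M \<noteq> 0"
proof
  assume "invertible_mat M"
  then obtain B where B: "M * B = 1\<^sub>m n" "B * M = 1\<^sub>m (dim_row B)"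
    using M by (auto simp: invertible_mat_def inverts_mat_def)
  have "B \<in> carrier_mat n n"
    using arg_cong[OF B(1), of dim_col] arg_cong[OF B(2), of dim_col] M by auto
  then have "det M * det B = 1"
    using det_mult[OF M, of B] B(1) by simp
  then show "det M \<noteq> 0" by auto
next
  assume d: "det M \<noteq> 0"
  define B where "B = inverse (det M) \<cdot>\<^sub>m adj_mat M"
  have B: "B \<in> carrier_mat n n"
    using adj_mat(1)[OF M] by (simp add: B_def)
  have "M * B = 1\<^sub>m n"
    unfolding B_def using adj_mat[OF M] M d by (subst mult_smult_distrib) auto
  then show "invertible_mat M"
    using mat_mult_left_right_inverse[OF M B] M B
    by (auto simp: invertible_mat_def inverts_mat_def)
qed

text \<open>As delta is unbounded, only the support of Delta matters: the intervals for all delta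
  together consist of exactly the matrices \<open>A + X\<close> with X in this set, for the pattern
  of nonzero entries of Delta.\<close>

definition completions :: "nat \<Rightarrow> (nat \<Rightarrow> nat \<Rightarrow> bool) \<Rightarrow> real mat set" where
  "completions n P = {X \<in> carrier_mat n n. \<forall>i<n. \<forall>j<n. X $$ (i, j) \<noteq> 0 \<longrightarrow> P i j}"

lemma regularity_radius_eq_infinity_iff:
  assumes A: "A \<in> carrier_mat n n" and D: "D \<in> carrier_mat n n" and nonneg: "0\<^sub>m n n \<le> D"
  shows "regularity_radius A D = \<infinity> \<longleftrightarrow>
    (\<forall>X \<in> completions n (\<lambda>i j. D $$ (i, j) \<noteq> 0). det (A + X) \<noteq> 0)"
proof -
  have pos: "0 \<le> D $$ (i, j)" if "i < n" "j < n" for i j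
    using nonneg D that by (auto simp: less_eq_mat_def)
  have "(\<exists>\<delta>. singular_radius A D \<delta>) \<longleftrightarrow>
    (\<exists>X \<in> completions n (\<lambda>i j. D $$ (i, j) \<noteq> 0). det (A + X) = 0)"
  proof
    assume "\<exists>\<delta>. singular_radius A D \<delta>"
    then obtain \<delta> M where M: "M \<in> interval_mat (A - \<delta> \<cdot>\<^sub>m D) (A + \<delta> \<cdot>\<^sub>m D)" "singular_mat M"
      unfolding singular_radius_def singular_interval_def by blast
    have Mc: "M \<in> carrier_mat n n"
    proof (rule carrier_matI)
      have "A - \<delta> \<cdot>\<^sub>m D \<le> M"
        using M(1) by (simp add: interval_mat_def)
      then have "dim_row (A - \<delta> \<cdot>\<^sub>m D) = dim_row M" "dim_col (A - \<delta> \<cdot>\<^sub>m D) = dim_col M"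
        unfolding less_eq_mat_def by blast+
      then show "dim_row M = n" "dim_col M = n"
        using D by simp_all
    qed
    have "M - A \<in> completions n (\<lambda>i j. D $$ (i, j) \<noteq> 0)"
      unfolding completions_def
    proof (intro CollectI conjI allI impI notI)
      fix i j assume ij: "i < n" "j < n" "(M - A) $$ (i, j) \<noteq> 0" "D $$ (i, j) = 0"
      have "\<forall>i<n. \<forall>j<n. A $$ (i, j) - \<delta> * D $$ (i, j) \<le> M $$ (i, j)"
        "\<forall>i<n. \<forall>j<n. M $$ (i, j) \<le> A $$ (i, j) + \<delta> * D $$ (i, j)"
        using M(1) A D Mc by (simp_all add: interval_mat_def less_eq_mat_def)
      then have "A $$ (i, j) - \<delta> * D $$ (i, j) \<le> M $$ (i, j)" "M $$ (i, j) \<le> A $$ (i, j) + \<delta> * D $$ (i, j)"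
        using ij by blast+
      with ij A Mc show False by simp
    qed (use Mc A in auto)
    moreover have "A + (M - A) = M"
      using A Mc by (intro eq_matI) auto
    moreover have "det M = 0"
      using M(2) Mc invertible_mat_iff_det[OF Mc] by (auto simp: singular_mat_def)
    ultimately show "\<exists>X \<in> completions n (\<lambda>i j. D $$ (i, j) \<noteq> 0). det (A + X) = 0"
      by metis
  next
    assume "\<exists>X \<in> completions n (\<lambda>i j. D $$ (i, j) \<noteq> 0). det (A + X) = 0"
    then obtain X where X: "X \<in> carrier_mat n n" "det (A + X) = 0"
      "\<And>i j. i < n \<Longrightarrow> j < n \<Longrightarrow> X $$ (i, j) \<noteq> 0 \<Longrightarrow> D $$ (i, j) \<noteq> 0"
      by (auto simp: completions_def)
    \<comment> \<open>The sum dominates each single ratio. Where \<open>D\<close> vanishes, so does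
      \<open>X\<close>, and the quotient is 0 by the convention on division by zero.\<close>
    define \<delta> where "\<delta> = (\<Sum>i<n. \<Sum>j<n. \<bar>X $$ (i, j)\<bar> / D $$ (i, j))"
    have nn: "0 \<le> \<bar>X $$ (i, j)\<bar> / D $$ (i, j)" if "i < n" "j < n" for i j
      using pos[OF that] by simp
    have \<delta>: "\<bar>X $$ (i, j)\<bar> \<le> \<delta> * D $$ (i, j)" if ij: "i < n" "j < n" for i j
    proof (cases "D $$ (i, j) = 0")
      case True
      then show ?thesis using X(3)[OF ij] by auto
    next
      case False
      have "\<bar>X $$ (i, j)\<bar> / D $$ (i, j) \<le> (\<Sum>j<n. \<bar>X $$ (i, j)\<bar> / D $$ (i, j))"
        using ij nn by (intro member_le_sum) auto
      also have "\<dots> \<le> \<delta>"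
        unfolding \<delta>_def using ij nn
        by (intro member_le_sum[of i "{..<n}" "\<lambda>i. \<Sum>j<n. \<bar>X $$ (i, j)\<bar> / D $$ (i, j)"]) (auto intro: sum_nonneg)
      finally show ?thesis
        using False pos[OF ij] by (simp add: divide_le_eq)
    qed
    have "0 \<le> \<delta>"
      unfolding \<delta>_def using nn by (intro sum_nonneg) auto
    moreover have "A + X \<in> interval_mat (A - \<delta> \<cdot>\<^sub>m D) (A + \<delta> \<cdot>\<^sub>m D)"
      using A D X(1) \<delta>[unfolded abs_le_iff]
      by (auto simp: interval_mat_def less_eq_mat_def minus_le_iff)
    moreover have "singular_mat (A + X)"
      using X A invertible_mat_iff_det[of "A + X" n] by (auto simp: singular_mat_def)
    ultimately show "\<exists>\<delta>. singular_radius A D \<delta>"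
      by (auto simp: singular_radius_def singular_interval_def)
  qed
  then show ?thesis
    by (auto simp: regularity_radius_def)
qed

section \<open>The acyclicity criterion\<close>

text \<open>On n vertices a walk with n edges repeats a vertex, so there is one exactly if there is
  a cycle. Walks of fixed length are preferred to cycles because they can be tabulated by increasing
  length.\<close>

fun walk :: "nat \<Rightarrow> (nat \<Rightarrow> nat \<Rightarrow> bool) \<Rightarrow> nat \<Rightarrow> nat \<Rightarrow> bool" where
  "walk n E 0 i \<longleftrightarrow> True"
| "walk n E (Suc t) i \<longleftrightarrow> (\<exists>i'<n. E i i' \<and> walk n E t i')"

text \<open>For nonsingular A, \<open>cofactor A i' j\<close> is det A times the entry (j, i') of
  the inverse. The edges are thus the nonzero pattern of the product of the 0-1 matrices that mark
  the supports of Delta and of the inverse of A.\<close>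

definition pivot_edge :: "'a :: comm_ring_1 mat \<Rightarrow> (nat \<Rightarrow> nat \<Rightarrow> bool) \<Rightarrow> nat \<Rightarrow> nat \<Rightarrow> bool" where
  "pivot_edge A P i i' \<longleftrightarrow> (\<exists>j<dim_col A. P i j \<and> cofactor A i' j \<noteq> 0)"

lemma mult_mat_vec_eq_sum:
  "A \<in> carrier_mat n n \<Longrightarrow> v \<in> carrier_vec n \<Longrightarrow> i < n \<Longrightarrow>
    (A *\<^sub>v v) $ i = (\<Sum>j<n. A $$ (i, j) * v $ j)"
  by (auto simp: scalar_prod_def lessThan_atLeast0 intro!: sum.cong)

lemma adj_mat_vec:
  assumes A: "A \<in> carrier_mat n n" and v: "v \<in> carrier_vec n"
  shows "adj_mat A *\<^sub>v (A *\<^sub>v v) = det A \<cdot>\<^sub>v v" "A *\<^sub>v (adj_mat A *\<^sub>v v) = det A \<cdot>\<^sub>v v"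
proof -
  have "(det A \<cdot>\<^sub>m 1\<^sub>m n) *\<^sub>v v = det A \<cdot>\<^sub>v v"
    using v by (intro eq_vecI) (auto simp: row_smult)
  then show "adj_mat A *\<^sub>v (A *\<^sub>v v) = det A \<cdot>\<^sub>v v" "A *\<^sub>v (adj_mat A *\<^sub>v v) = det A \<cdot>\<^sub>v v"
    using adj_mat[OF A] v A by (metis assoc_mult_mat_vec)+
qed

lemma adj_mat_vec_index:
  assumes A: "A \<in> carrier_mat n n" and v: "v \<in> carrier_vec n" and "j < n"
  shows "(adj_mat A *\<^sub>v v) $ j = (\<Sum>i<n. cofactor A i j * v $ i)"
  unfolding mult_mat_vec_eq_sum[OF adj_mat(1)[OF A] v \<open>j < n\<close>]
  using A \<open>j < n\<close> by (auto simp: adj_mat_def intro!: sum.cong)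

text \<open>For a kernel vector u and v = A u there are two relations: v = - X u leads from a
  nonzero v_i to some j with X_ij and u_j nonzero, and det A u = adj(A) v leads from u_j to some
  nonzero v_i' with nonzero cofactor. Without long walks v must be 0, and then u = 0.\<close>

lemma det_completion_neq_0:
  assumes A: "A \<in> carrier_mat n n" and "det A \<noteq> 0" and X: "X \<in> completions n P"
    and acyclic: "\<And>i. i < n \<Longrightarrow> \<not> walk n (pivot_edge A P) n i"
  shows "det (A + X) \<noteq> 0"
proof
  assume "det (A + X) = 0"
  moreover have Xc: "X \<in> carrier_mat n n"
    using X by (simp add: completions_def)
  ultimately obtain u where u: "u \<in> carrier_vec n" "u \<noteq> 0\<^sub>v n" "(A + X) *\<^sub>v u = 0\<^sub>v n"
    using det_0_iff_vec_prod_zero[of "A + X" n] A by auto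
  define v where "v = A *\<^sub>v u"
  have v: "v \<in> carrier_vec n" using A u by (simp add: v_def)
  have vX: "v $ i + (\<Sum>j<n. X $$ (i, j) * u $ j) = 0" if "i < n" for i
  proof -
    have "v + X *\<^sub>v u = 0\<^sub>v n"
      using u(3) add_mult_distrib_mat_vec[OF A Xc u(1)] by (simp add: v_def)
    then have "(v + X *\<^sub>v u) $ i = 0"
      using that by simp
    then show ?thesis
      using mult_mat_vec_eq_sum[OF Xc u(1) that] that Xc v by simp
  qed
  have uv: "det A * u $ j = (\<Sum>i<n. cofactor A i j * v $ i)" if "j < n" for j
    using adj_mat_vec(1)[OF A u(1)] adj_mat_vec_index[OF A v that] u(1) that
    by (simp add: v_def)
  have step: "\<exists>i'<n. pivot_edge A P i i' \<and> v $ i' \<noteq> 0" if i: "i < n" "v $ i \<noteq> 0" for i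
  proof -
    have "(\<Sum>j<n. X $$ (i, j) * u $ j) \<noteq> 0"
      using vX[OF i(1)] i(2) by auto
    then obtain j where j: "j < n" "X $$ (i, j) \<noteq> 0" "u $ j \<noteq> 0"
      by (auto elim!: sum.not_neutral_contains_not_neutral)
    then have "(\<Sum>i<n. cofactor A i j * v $ i) \<noteq> 0"
      using uv[OF j(1)] \<open>det A \<noteq> 0\<close> by (metis mult_eq_0_iff)
    then obtain i' where "i' < n" "cofactor A i' j \<noteq> 0" "v $ i' \<noteq> 0"
      by (auto elim!: sum.not_neutral_contains_not_neutral)
    moreover have "P i j"
      using X i j by (auto simp: completions_def)
    ultimately show ?thesis
      using j(1) A by (auto simp: pivot_edge_def)
  qed
  have "walk n (pivot_edge A P) t i" if "i < n" "v $ i \<noteq> 0" for t i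
    using that
  proof (induction t arbitrary: i)
    case (Suc t)
    then show ?case using step[of i] by auto
  qed simp
  then have "v $ i = 0" if "i < n" for i
    using acyclic that by blast
  then have "u $ j = 0" if "j < n" for j
    using uv[OF that] \<open>det A \<noteq> 0\<close> by simp
  then have "u = 0\<^sub>v n"
    using u(1) by (intro eq_vecI) auto
  with u(2) show False ..
qed

text \<open>n strict inclusions in a row would remove at least n elements and leave
  \<open>S n\<close> empty.\<close>

lemma decreasing_sets_stabilise:
  fixes S :: "nat \<Rightarrow> 'a set"
  assumes "\<And>t. finite (S t)" "\<And>t. S (Suc t) \<subseteq> S t" "card (S 0) \<le> n" "S n \<noteq> {}"
  obtains t where "t < n" "S (Suc t) = S t"
proof (rule ccontr)
  assume "\<not> thesis"
  then have neq: "t < n \<Longrightarrow> S (Suc t) \<noteq> S t" for t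
    using that by blast
  have less: "card (S (Suc t)) < card (S t)" if "t < n" for t
    using assms(1)[of t] assms(2)[of t] neq[OF that] by (intro psubset_card_mono psubsetI)
  have "t \<le> n \<Longrightarrow> card (S t) + t \<le> n" for t
  proof (induction t)
    case (Suc t)
    then show ?case using less[of t] by simp
  qed (use assms(3) in simp)
  from this[of n] have "card (S n) = 0" by simp
  then show False using assms(1,4) by simp
qed

lemma walk_antimono: "walk n E t i \<Longrightarrow> t' \<le> t \<Longrightarrow> walk n E t' i"
proof (induction t' arbitrary: t i)
  case (Suc t')
  then obtain s where "t = Suc s"
    by (cases t) auto
  with Suc show ?case by auto
qed simp

lemma exists_nonroot:
  fixes q :: "'b \<Rightarrow> real poly"
  assumes "finite S" "\<And>i. i \<in> S \<Longrightarrow> q i \<noteq> 0"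
  obtains \<tau> where "\<tau> \<noteq> 0" "\<And>i. i \<in> S \<Longrightarrow> poly (q i) \<tau> \<noteq> 0"
proof -
  \<comment> \<open>The extra factor \<open>monom 1 1\<close> is the polynomial x; it keeps 0 from
    being chosen.\<close>
  have "finite {x. poly (monom 1 1 * (\<Prod>i\<in>S. q i)) x = 0}"
    using assms by (intro poly_roots_finite) auto
  then obtain \<tau> where "poly (monom 1 1 * (\<Prod>i\<in>S. q i)) \<tau> \<noteq> 0"
    using ex_new_if_finite[OF infinite_UNIV_char_0] by blast
  then show thesis
    using assms(1) by (intro that[of \<tau>]) (auto simp: poly_monom poly_prod)
qed

text \<open>Take v supported on S and u = adj(A) v, so that A u = det A v. Row i of X has to send u
  to - det A v_i. For i outside S the zero row does so; for i in S one entry, in column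
  \<open>f i\<close>, is enough provided that u does not vanish there.\<close>

lemma ex_singular_completion:
  fixes A :: "real mat"
  assumes A: "A \<in> carrier_mat n n" and d: "det A \<noteq> 0"
    and S: "S \<subseteq> {..<n}" "S \<noteq> {}" "\<And>i. i \<in> S \<Longrightarrow> \<exists>i'\<in>S. pivot_edge A P i i'"
  shows "\<exists>X \<in> completions n P. det (A + X) = 0"
proof -
  have fin: "finite S" using S(1) finite_subset by blast
  obtain f where f: "\<And>i. i \<in> S \<Longrightarrow> f i < n \<and> P i (f i) \<and> (\<exists>i'\<in>S. cofactor A i' (f i) \<noteq> 0)"
    using S(3) A unfolding pivot_edge_def by (metis carrier_matD(2))
  \<comment> \<open>With v_i = \<tau>^i on S, the coordinate \<open>f i\<close> of u is this
    polynomial at \<tau>. Distinct rows contribute distinct powers, so one nonzero cofactor makes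
    the polynomial nonzero.\<close>
  define q where "q i = (\<Sum>i'\<in>S. monom (cofactor A i' (f i)) i')" for i
  have "q i \<noteq> 0" if "i \<in> S" for i
  proof -
    from f[OF that] obtain i' where i': "i' \<in> S" "cofactor A i' (f i) \<noteq> 0" by blast
    have "coeff (q i) i' = cofactor A i' (f i)"
      using i' fin by (simp add: q_def coeff_sum)
    with i' show ?thesis by auto
  qed
  then obtain \<tau> where \<tau>: "\<tau> \<noteq> 0" "\<And>i. i \<in> S \<Longrightarrow> poly (q i) \<tau> \<noteq> 0"
    using exists_nonroot[OF fin] by blast
  define v where "v = vec n (\<lambda>i. if i \<in> S then \<tau> ^ i else 0)"
  have v: "v \<in> carrier_vec n" by (simp add: v_def)
  define u where "u = adj_mat A *\<^sub>v v"
  have u: "u \<in> carrier_vec n" using adj_mat(1)[OF A] v by (simp add: u_def)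
  have u_index: "u $ f i = poly (q i) \<tau>" if "i \<in> S" for i
  proof -
    have "u $ f i = (\<Sum>i'<n. cofactor A i' (f i) * v $ i')"
      unfolding u_def using f[OF that] by (intro adj_mat_vec_index[OF A v]) auto
    also have "\<dots> = (\<Sum>i'\<in>S. cofactor A i' (f i) * \<tau> ^ i')"
      using S(1) by (intro sum.mono_neutral_cong_right) (auto simp: v_def)
    finally show ?thesis by (simp add: q_def poly_sum poly_monom)
  qed
  \<comment> \<open>The denominator is \<open>u $ f i\<close>, so the product with u in row i is
    exactly - det A \<tau>^i.\<close>
  define X where "X = mat n n (\<lambda>(i, j). if i \<in> S \<and> j = f i then - (det A * \<tau> ^ i) / poly (q i) \<tau> else 0)"
  have X: "X \<in> carrier_mat n n" by (simp add: X_def)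
  have "X \<in> completions n P"
    using f by (auto simp: completions_def X_def)
  moreover have "(A + X) *\<^sub>v u = 0\<^sub>v n"
  proof (rule eq_vecI)
    fix i assume "i < dim_vec (0\<^sub>v n)"
    then have i: "i < n" by simp
    have "(X *\<^sub>v u) $ i = (\<Sum>j<n. X $$ (i, j) * u $ j)"
      by (rule mult_mat_vec_eq_sum[OF X u i])
    also have "\<dots> = - (det A * v $ i)"
    proof (cases "i \<in> S")
      case True
      then have "(\<Sum>j<n. X $$ (i, j) * u $ j) = (\<Sum>j<n. if j = f i then - (det A * \<tau> ^ i) / poly (q i) \<tau> * u $ j else 0)"
        using i by (intro sum.cong) (auto simp: X_def)
      also have "\<dots> = - (det A * \<tau> ^ i) / poly (q i) \<tau> * u $ f i"
        using f[OF True] by simp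
      finally show ?thesis
        using \<tau>(2)[OF True] True i by (simp add: u_index v_def)
    next
      case False
      then show ?thesis using i by (simp add: X_def v_def)
    qed
    finally have "(X *\<^sub>v u) $ i = - (det A * v $ i)" .
    moreover have "(A *\<^sub>v u) $ i = det A * v $ i"
      using adj_mat_vec(2)[OF A v] i v by (simp add: u_def)
    ultimately show "((A + X) *\<^sub>v u) $ i = 0\<^sub>v n $ i"
      using i A X u by (simp add: add_mult_distrib_mat_vec[OF A X u] del: index_mult_mat_vec)
  qed (use A X in auto)
  moreover have "u \<noteq> 0\<^sub>v n"
  proof
    assume "u = 0\<^sub>v n"
    moreover have "A *\<^sub>v 0\<^sub>v n = 0\<^sub>v n"
      using A by (intro eq_vecI) auto
    ultimately have "det A \<cdot>\<^sub>v v = 0\<^sub>v n"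
      using adj_mat_vec(2)[OF A v] by (simp add: u_def[symmetric])
    moreover obtain i where "i \<in> S" using S(2) by blast
    ultimately have "(det A \<cdot>\<^sub>v v) $ i = 0" "i < n" using S(1) by auto
    then show False using d \<tau>(1) \<open>i \<in> S\<close> by (simp add: v_def)
  qed
  ultimately show ?thesis
    using det_0_iff_vec_prod_zero[of "A + X" n] A X u by auto
qed

lemma regularity_radius_eq_infinity_iff_no_walk:
  assumes A: "A \<in> carrier_mat n n" and D: "D \<in> carrier_mat n n" and nonneg: "0\<^sub>m n n \<le> D"
  defines "P \<equiv> \<lambda>i j. D $$ (i, j) \<noteq> 0"
  shows "regularity_radius A D = \<infinity> \<longleftrightarrow>
    det A \<noteq> 0 \<and> (\<forall>i<n. \<not> walk n (pivot_edge A P) n i)"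
proof
  assume "regularity_radius A D = \<infinity>"
  then have regular: "det (A + X) \<noteq> 0" if "X \<in> completions n P" for X
    using that regularity_radius_eq_infinity_iff[OF A D nonneg] unfolding P_def by blast
  have "0\<^sub>m n n \<in> completions n P"
    by (simp add: completions_def)
  from regular[OF this] have d: "det A \<noteq> 0"
    using A by simp
  have "\<not> walk n (pivot_edge A P) n i" if "i < n" for i
  proof
    assume i: "walk n (pivot_edge A P) n i"
    \<comment> \<open>The rows with a walk of length t shrink as t grows, and row i survives up to
      n. Where the sequence stabilises, every row of \<open>S t\<close> has a walk of length t + 1
      and hence a successor in \<open>S t\<close>.\<close>
    define S where "S t = {i. i < n \<and> walk n (pivot_edge A P) t i}" for t
    obtain t where t: "t < n" "S (Suc t) = S t"
    proof (rule decreasing_sets_stabilise[of S n])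
      show "S n \<noteq> {}" using i \<open>i < n\<close> by (auto simp: S_def)
        show "S (Suc t) \<subseteq> S t" for t
        using walk_antimono[of n _ "Suc t" _ t] by (auto simp: S_def simp del: walk.simps)
      show "card (S 0) \<le> n"
        using card_mono[of "{..<n}" "S 0"] by (auto simp: S_def)
    qed (simp_all add: S_def)
    have "i \<in> S t"
      using walk_antimono[OF i, of t] t(1) \<open>i < n\<close> by (simp add: S_def)
    have "\<exists>X \<in> completions n P. det (A + X) = 0"
    proof (rule ex_singular_completion[OF A d])
      show "\<exists>i'\<in>S t. pivot_edge A P i i'" if "i \<in> S t" for i
      proof -
        have "i \<in> S (Suc t)" using that t(2) by simp
        then show ?thesis by (auto simp: S_def)
      qed
    qed (use \<open>i \<in> S t\<close> in \<open>auto simp: S_def\<close>)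
    then show False using regular by blast
  qed
  with d show "det A \<noteq> 0 \<and> (\<forall>i<n. \<not> walk n (pivot_edge A P) n i)" by blast
next
  assume "det A \<noteq> 0 \<and> (\<forall>i<n. \<not> walk n (pivot_edge A P) n i)"
  then show "regularity_radius A D = \<infinity>"
    unfolding regularity_radius_eq_infinity_iff[OF A D nonneg]
    using det_completion_neq_0[OF A] unfolding P_def by blast
qed

section \<open>Passage to rational cofactors and to residues of entries\<close>

lemma walk_cong:
  "(\<And>i i'. i < n \<Longrightarrow> i' < n \<Longrightarrow> E i i' \<longleftrightarrow> E' i i') \<Longrightarrow> i < n \<Longrightarrow> walk n E t i \<longleftrightarrow> walk n E' t i"
  by (induction t arbitrary: i) auto

lemma cofactor_map_of_rat:
  assumes "A \<in> carrier_mat n n" "i < n" "j < n"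
  shows "cofactor (map_mat of_rat A) i j = (of_rat (cofactor A i j) :: real)"
proof -
  have "mat_delete (map_mat of_rat A) i j = (map_mat of_rat (mat_delete A i j) :: real mat)"
    using assms by (intro eq_matI) (auto simp: mat_delete_def)
  then show ?thesis
    by (simp add: cofactor_def of_rat_mult of_rat_power of_rat_minus)
qed

definition replace_row :: "'a :: comm_ring_1 mat \<Rightarrow> nat \<Rightarrow> nat \<Rightarrow> 'a mat" where
  "replace_row A i j = mat (dim_row A) (dim_col A) (\<lambda>(k, l). if k = i then of_bool (l = j) else A $$ (k, l))"

text \<open>Expansion along the replaced row has a single nonzero term, whose minor does not contain
  that row and is therefore a minor of A.\<close>

lemma det_replace_row:
  assumes A: "A \<in> carrier_mat n n" and ij: "i < n" "j < n"
  shows "det (replace_row A i j) = cofactor A i j"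
proof -
  have R: "replace_row A i j \<in> carrier_mat n n"
    using A by (simp add: replace_row_def)
  have "det (replace_row A i j) = (\<Sum>l<n. replace_row A i j $$ (i, l) * cofactor (replace_row A i j) i l)"
    by (rule laplace_expansion_row[OF R ij(1)])
  also have "\<dots> = (\<Sum>l<n. if l = j then cofactor (replace_row A i j) i j else 0)"
    using A ij by (intro sum.cong) (auto simp: replace_row_def)
  also have "\<dots> = cofactor (replace_row A i j) i j"
    using ij by simp
  also have "mat_delete (replace_row A i j) i j = mat_delete A i j"
    using A ij by (intro eq_matI) (auto simp: mat_delete_def replace_row_def)
  then have "cofactor (replace_row A i j) i j = cofactor A i j"
    by (simp add: cofactor_def)
  finally show ?thesis .
qed

lemma replace_row_outside: "A \<in> carrier_mat n n \<Longrightarrow> replace_row A n j = A"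
  by (intro eq_matI) (auto simp: replace_row_def)

lemma concat_upt:
  "length (concat (map (\<lambda>i. map (f i) [0..<n]) [0..<m])) = m * n"
  "i < m \<Longrightarrow> j < n \<Longrightarrow> concat (map (\<lambda>i. map (f i) [0..<n]) [0..<m]) ! (i * n + j) = f i j"
proof (induction m)
  case (Suc m)
  case 1
  then show ?case using Suc by simp
next
  case (Suc m)
  case 2
  show ?case
  proof (cases "i = m")
    case True
    then show ?thesis using 2 Suc by (simp add: nth_append)
  next
    case False
    then have "i < m" using 2 by simp
    then have "Suc i * n \<le> m * n" by (intro mult_le_mono1) simp
    then have "i * n + j < m * n" using 2(2) by simp
    then show ?thesis using 2 Suc \<open>i < m\<close> by (simp add: nth_append)
  qed
qed simp_all

text \<open>The residue of the signed fraction a/b, found by search: b x = a for a nonnegative and b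
  x + a = 0 for a negative fraction, modulo \<open>p\<close>. This avoids both modular inverses and
  negative numbers. The arguments are meant to be reduced already.\<close>

definition quotient_mod :: "nat \<Rightarrow> bool \<Rightarrow> nat \<Rightarrow> nat \<Rightarrow> nat" where
  "quotient_mod p neg a b =
     least_below p (\<lambda>x. (b * x + (if neg then a else 0)) mod p = (if neg then 0 else a))"

lemma quotient_mod_correct:
  fixes a b :: int
  assumes p: "prime p" and b: "0 < b" "\<not> int p dvd b"
  defines "x \<equiv> quotient_mod p (a < 0) (nat \<bar>a\<bar> mod p) (nat b mod p)"
  shows "x < p" "[b * int x = a] (mod int p)"
proof -
  let ?P = "\<lambda>x. ((nat b mod p) * x + (if a < 0 then nat \<bar>a\<bar> mod p else 0)) mod p
    = (if a < 0 then 0 else nat \<bar>a\<bar> mod p)"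
  have P: "?P x \<longleftrightarrow> [b * int x = a] (mod int p)" for x
  proof -
    have "?P x \<longleftrightarrow> (nat b * x + (if a < 0 then nat \<bar>a\<bar> else 0)) mod p
      = (if a < 0 then 0 else nat \<bar>a\<bar>) mod p"
    proof -
      have m: "((nat b mod p) * x + c mod p) mod p = (nat b * x + c) mod p" for c
        by (intro mod_add_cong) (simp_all only: mod_mult_left_eq mod_mod_trivial)
      show ?thesis
      proof (cases "a < 0")
        case True
        then show ?thesis by (simp only: if_True m mod_0)
      next
        case False
        then show ?thesis by (simp only: if_False m[of 0, unfolded mod_0])
      qed
    qed
    also have "\<dots> \<longleftrightarrow> [int (nat b * x + (if a < 0 then nat \<bar>a\<bar> else 0)) = int (if a < 0 then 0 else nat \<bar>a\<bar>)] (mod int p)"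
      unfolding cong_int_iff by (simp add: cong_def)
    also have "\<dots> \<longleftrightarrow> [b * int x = a] (mod int p)"
      using b(1) by (auto simp: cong_iff_dvd_diff)
    finally show ?thesis .
  qed
  \<comment> \<open>The inverse y of b yields the solution (y a) mod p below p, so the search cannot
    run into its default.\<close>
  have "coprime b (int p)"
    using p b(2) prime_imp_coprime[of "int p" b] by (simp add: coprime_commute)
  then obtain y where "[b * y = 1] (mod int p)"
    using cong_solve_coprime_int by blast
  then have "[b * (y * a) = 1 * a] (mod int p)"
    unfolding mult.assoc[symmetric] by (intro cong_mult cong_refl)
  moreover have "[b * ((y * a) mod int p) = b * (y * a)] (mod int p)"
    by (intro cong_mult cong_refl) simp
  ultimately have "[b * int (nat ((y * a) mod int p)) = a] (mod int p)"
    using p prime_gt_0_nat[OF p] by (simp add: cong_def)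
  moreover have "nat ((y * a) mod int p) < p"
    using prime_gt_0_nat[OF p] by (simp add: nat_less_iff)
  ultimately have "least_below p ?P < p"
    using P by (intro least_below_less[of "nat ((y * a) mod int p)"]) auto
  then show "x < p" "[b * int x = a] (mod int p)"
    using least_below_prop[of p ?P] P unfolding x_def quotient_mod_def by blast+
qed

section \<open>The criterion expressed through the input word\<close>

locale radius_instance =
  fixes A D :: "rat mat" and n :: nat
  assumes A: "A \<in> carrier_mat n n" and D: "D \<in> carrier_mat n n" and nonneg: "0\<^sub>m n n \<le> D"
begin

definition w :: "bool list" where "w = enc_mat_pair (A, D)"
definition xs :: "rat list" where "xs = concat (mat_to_list A) @ concat (mat_to_list D)"

sublocale encoded_list w n xs
  using A by unfold_locales (simp add: w_def xs_def enc_mat_pair_def enc_entries_def)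

lemma mat_to_list_eq: "B \<in> carrier_mat n n \<Longrightarrow> mat_to_list B = map (\<lambda>i. map (\<lambda>j. B $$ (i, j)) [0..<n]) [0..<n]"
  by (simp add: mat_to_list_def)

lemma length_xs: "length xs = 2 * n * n"
  using A D by (simp add: xs_def mat_to_list_eq concat_upt)

lemma index_less: "i < n \<Longrightarrow> j < n \<Longrightarrow> i * n + j < n * n"
proof -
  assume "i < n" "j < n"
  then have "Suc i * n \<le> n * n" by (intro mult_le_mono1) simp
  then show ?thesis using \<open>j < n\<close> by simp
qed

lemma xs_A: "i < n \<Longrightarrow> j < n \<Longrightarrow> xs ! (i * n + j) = A $$ (i, j)"
  using A index_less[of i j] by (simp add: xs_def mat_to_list_eq nth_append concat_upt)

lemma xs_D: "i < n \<Longrightarrow> j < n \<Longrightarrow> xs ! (n * n + i * n + j) = D $$ (i, j)"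
  using A D index_less[of i j] by (simp add: xs_def mat_to_list_eq nth_append concat_upt add.assoc)

lemma n_le: "n \<le> length w"
proof -
  have "n \<le> 2 * n * n" by (cases n) auto
  then show ?thesis using length_xs_le length_xs by linarith
qed

definition den_residue :: "nat \<Rightarrow> nat \<Rightarrow> nat" where
  "den_residue p k = residue_at w p (nat_end w (entry_start w k + 1))"

definition entry_residue :: "nat \<Rightarrow> nat \<Rightarrow> nat" where
  "entry_residue p k = quotient_mod p (bit_at w (entry_start w k)) (residue_at w p (entry_start w k + 1)) (den_residue p k)"

definition row_residue :: "nat \<Rightarrow> nat \<Rightarrow> nat \<Rightarrow> nat \<Rightarrow> nat \<Rightarrow> nat" where
  "row_residue p i0 j0 i j = (if i = i0 then of_bool (j = j0) else entry_residue p (i * n + j))"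

text \<open>Only the first \<open>n * n\<close> entries, those of A, are inspected: Delta enters
  through its support alone and is never reduced.\<close>

definition good_prime :: "nat \<Rightarrow> bool" where
  "good_prime p \<longleftrightarrow> prime p \<and> (\<forall>k<n * n. den_residue p k \<noteq> 0)"

definition full_rank :: "nat \<Rightarrow> nat \<Rightarrow> nat \<Rightarrow> bool" where
  "full_rank p i0 j0 \<longleftrightarrow> (\<forall>t<n. \<exists>r<n - t. chio p n (row_residue p i0 j0) t r 0 \<noteq> 0)"

text \<open>The modulus is written \<open>Suc q\<close>, so that every value of a loop variable
  \<open>q\<close> gives a positive modulus.\<close>

definition nonsingular :: "nat \<Rightarrow> nat \<Rightarrow> bool" where
  "nonsingular i0 j0 \<longleftrightarrow> (\<exists>q<(length w + 2) ^ 12. good_prime (Suc q) \<and> full_rank (Suc q) i0 j0)"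

lemma entry_A:
  fixes i j
  assumes ij: "i < n" "j < n"
  defines "a \<equiv> fst (quotient_of (A $$ (i, j)))" and "b \<equiv> snd (quotient_of (A $$ (i, j)))"
  shows "\<bar>a\<bar> \<le> 2 ^ length w" "b \<le> 2 ^ length w"
    "entry_residue p (i * n + j) = quotient_mod p (a < 0) (nat \<bar>a\<bar> mod p) (nat b mod p)"
    "den_residue p (i * n + j) = nat b mod p"
proof -
  have k: "i * n + j < length xs"
    using index_less[OF ij] by (simp add: length_xs)
  have "quotient_of (xs ! (i * n + j)) = (a, b)"
    by (simp add: xs_A[OF ij] a_def b_def)
  note e = entry[OF k this]
  show "\<bar>a\<bar> \<le> 2 ^ length w" "b \<le> 2 ^ length w"
    by (rule e)+
  show "entry_residue p (i * n + j) = quotient_mod p (a < 0) (nat \<bar>a\<bar> mod p) (nat b mod p)"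
    "den_residue p (i * n + j) = nat b mod p"
    by (simp_all only: entry_residue_def den_residue_def e)
qed

lemma index_cases:
  assumes "k < n * n"
  obtains i j where "i < n" "j < n" "k = i * n + j"
proof (rule that[of "k div n" "k mod n"])
  have "0 < n" using assms by (cases n) auto
  then show "k mod n < n" by simp
  show "k div n < n" using assms by (simp add: less_mult_imp_div_less)
  show "k = k div n * n + k mod n" by simp
qed

lemma nonsingular_iff: "nonsingular i0 j0 \<longleftrightarrow> det (replace_row A i0 j0) \<noteq> 0"
proof -
  define den where "den i j = snd (quotient_of (A $$ (i, j)))" for i j
  \<comment> \<open>In the replaced row the entry 1 becomes den/den and the entry 0 becomes 0/den.
    The denominators are then those of A for every \<open>i0\<close> and \<open>j0\<close>, as
    \<open>good_prime\<close> presupposes.\<close>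
  define num where "num i j = (if i = i0 then of_bool (j = j0) * den i j else fst (quotient_of (A $$ (i, j))))" for i j
  have pos: "0 < den i j" for i j
    unfolding den_def by (rule quotient_of_denom_pos')
  interpret rational_matrix n num den
    using pos by unfold_locales
  have rat: "ratmat = replace_row A i0 j0"
  proof (rule eq_matI)
    fix i j assume "i < dim_row (replace_row A i0 j0)" "j < dim_col (replace_row A i0 j0)"
    then have "i < n" "j < n" using A by (auto simp: replace_row_def)
    then show "ratmat $$ (i, j) = replace_row A i0 j0 $$ (i, j)"
      using A pos[of i j] quotient_of_div[of "A $$ (i, j)" "fst (quotient_of (A $$ (i, j)))"  "den i j"]
      by (auto simp: ratmat_def replace_row_def num_def den_def)
  qed (use A in \<open>auto simp: ratmat_def replace_row_def\<close>)
  have bounds: "\<bar>num i j\<bar> \<le> 2 ^ length w" "den i j \<le> 2 ^ length w" if ij: "i < n" "j < n" for i j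
    using entry_A(1,2)[OF ij] pos[of i j] by (auto simp: num_def den_def)
  have den: "den_residue p (i * n + j) = nat (den i j) mod p" if "i < n" "j < n" for p i j
    by (simp add: den_def entry_A(4)[OF that])
  have dvd: "den_residue p (i * n + j) = 0 \<longleftrightarrow> int p dvd den i j" if "i < n" "j < n" for p i j
    using pos[of i j] by (simp add: den[OF that] mod_eq_0_iff_dvd int_dvd_int_iff[symmetric])
  have good: "good_prime p \<longleftrightarrow> prime p \<and> (\<forall>i<n. \<forall>j<n. \<not> int p dvd den i j)" for p
  proof
    assume "good_prime p"
    then show "prime p \<and> (\<forall>i<n. \<forall>j<n. \<not> int p dvd den i j)"
      unfolding good_prime_def using index_less dvd by blast
  next
    assume *: "prime p \<and> (\<forall>i<n. \<forall>j<n. \<not> int p dvd den i j)"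
    have "den_residue p k \<noteq> 0" if "k < n * n" for k
      using that by (rule index_cases) (use * dvd in blast)
    with * show "good_prime p"
      unfolding good_prime_def by blast
  qed
  have rank: "full_rank p i0 j0 \<longleftrightarrow> \<not> int p dvd det intmat" if gp: "good_prime p" for p
  proof -
    have p: "prime p" and ndvd: "\<And>i j. i < n \<Longrightarrow> j < n \<Longrightarrow> \<not> int p dvd den i j"
      using gp good by auto
    have v: "row_residue p i0 j0 i j < p \<and> [den i j * int (row_residue p i0 j0 i j) = num i j] (mod int p)"
      if ij: "i < n" "j < n" for i j
    proof (cases "i = i0")
      case True
      then show ?thesis using prime_gt_1_nat[OF p] by (simp add: row_residue_def num_def)
    next
      case False
      have "0 < den i j" "\<not> int p dvd den i j"
        using pos[of i j] ndvd[OF ij] by auto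
      from quotient_mod_correct[OF p this, of "fst (quotient_of (A $$ (i, j)))"] show ?thesis
        using False entry_A(3)[OF ij, of p] by (simp add: row_residue_def num_def den_def)
    qed
    have "full_rank p i0 j0 \<longleftrightarrow> \<not> int p dvd det (mat n n (\<lambda>(i, j). int (row_residue p i0 j0 i j)))"
      unfolding full_rank_def using chio_correct[OF p, of n "row_residue p i0 j0"] v by blast
    also have "\<dots> \<longleftrightarrow> \<not> int p dvd det intmat"
      using prime_dvd_det_residues_iff[OF p ndvd, of "\<lambda>i j. int (row_residue p i0 j0 i j)"] v by blast
    finally show ?thesis .
  qed
  show ?thesis
  proof
    assume "nonsingular i0 j0"
    then obtain p where "good_prime p" "full_rank p i0 j0"
      by (auto simp: nonsingular_def)
    then have "det intmat \<noteq> 0" using rank by auto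
    then show "det (replace_row A i0 j0) \<noteq> 0"
      using det_intmat_eq_0_iff rat by simp
  next
    assume "det (replace_row A i0 j0) \<noteq> 0"
    then obtain p where p: "prime p" "p < (length w + 2) ^ 12" "\<forall>i<n. \<forall>j<n. \<not> int p dvd den i j"
      "\<not> int p dvd det intmat"
      using ex_small_prime[of "length w"] n_le bounds unfolding rat by blast
    obtain q where q: "p = Suc q" using prime_gt_0_nat[OF p(1)] by (cases p) auto
    have "good_prime p" "full_rank p i0 j0"
      using p good[of p] rank[of p] by auto
    then show "nonsingular i0 j0"
      unfolding nonsingular_def using p(2) q by (intro exI[of _ q]) simp
  qed
qed

definition edge :: "nat \<Rightarrow> nat \<Rightarrow> bool" where
  "edge i i' \<longleftrightarrow> (\<exists>j<n. bit_at w (entry_start w (n * n + i * n + j) + 1) \<and> nonsingular i' j)"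

text \<open>The bit after the sign is the first continuation flag of the numerator; since 0 has no
  bits, it is set exactly for a nonzero entry.\<close>

lemma bit_at_D:
  assumes "i < n" "j < n"
  shows "bit_at w (entry_start w (n * n + i * n + j) + 1) \<longleftrightarrow> D $$ (i, j) \<noteq> 0"
proof -
  obtain a b where ab: "quotient_of (D $$ (i, j)) = (a, b)" by fastforce
  have k: "n * n + i * n + j < length xs"
    using index_less[OF assms] by (simp add: length_xs)
  have "bit_at w (entry_start w (n * n + i * n + j) + 1) \<longleftrightarrow> a \<noteq> 0"
    by (rule entry(2)[OF k, of a b]) (simp add: xs_D[OF assms] ab)
  also have "\<dots> \<longleftrightarrow> D $$ (i, j) \<noteq> 0"
    using quotient_of_div[OF ab] quotient_of_denom_pos[OF ab] by simp
  finally show ?thesis .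
qed

theorem regularity_radius_iff:
  "regularity_radius (map_mat of_rat A) (map_mat of_rat D) = \<infinity> \<longleftrightarrow>
    nonsingular n 0 \<and> (\<forall>i<n. \<not> walk n edge n i)"
proof -
  let ?A = "map_mat of_rat A :: real mat" and ?D = "map_mat of_rat D :: real mat"
  have "0\<^sub>m n n \<le> ?D"
    using nonneg D by (auto simp: less_eq_mat_def)
  then have "regularity_radius ?A ?D = \<infinity> \<longleftrightarrow>
    det ?A \<noteq> 0 \<and> (\<forall>i<n. \<not> walk n (pivot_edge ?A (\<lambda>i j. ?D $$ (i, j) \<noteq> 0)) n i)"
    using A D by (intro regularity_radius_eq_infinity_iff_no_walk) auto
  moreover have "det ?A \<noteq> 0 \<longleftrightarrow> nonsingular n 0"
    by (simp add: nonsingular_iff replace_row_outside[OF A])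
  moreover have "pivot_edge ?A (\<lambda>i j. ?D $$ (i, j) \<noteq> 0) i i' \<longleftrightarrow> edge i i'" if "i < n" "i' < n" for i i'
  proof -
    have "bit_at w (entry_start w (n * n + i * n + j) + 1) \<longleftrightarrow> ?D $$ (i, j) \<noteq> 0" if "j < n" for j
      using \<open>i < n\<close> that D by (subst bit_at_D) auto
    moreover have "nonsingular i' j \<longleftrightarrow> cofactor ?A i' j \<noteq> 0" if "j < n" for j
      using \<open>i' < n\<close> that A
      by (simp add: nonsingular_iff det_replace_row[OF A] cofactor_map_of_rat[OF A])
    moreover have "dim_col ?A = n" using A by simp
    ultimately show ?thesis
      unfolding pivot_edge_def edge_def by auto
  qed
  then have "walk n (pivot_edge ?A (\<lambda>i j. ?D $$ (i, j) \<noteq> 0)) n i \<longleftrightarrow> walk n edge n i" if "i < n" for i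
    using that by (rule walk_cong)
  ultimately show ?thesis by auto
qed

end

section \<open>Structured programs for multi-tape Turing machines\<close>

text \<open>The symbol in \<open>Cond\<close> lets the body run, the symbol in \<open>While\<close>
  ends the loop. In \<open>Op\<close>, \<open>None\<close> keeps the scanned symbol; as otherwise
  only bits are written, three tape symbols suffice.\<close>

datatype com =
    Op nat "bool option" direction
  | Seq com com
  | Cond nat nat com
  | While nat nat com

type_synonym tapes = "nat \<Rightarrow> tape"

definition op_tape :: "bool option \<Rightarrow> direction \<Rightarrow> tape \<Rightarrow> tape" where
  "op_tape a d tp = act_tape (case a of None \<Rightarrow> read_tape tp | Some b \<Rightarrow> bit_symbol b, d) tp"

text \<open>The time is the exact number of machine steps of the compiled code: a test costs one
  step, and each iteration of a loop one more for the jump back.\<close>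

inductive runs :: "com \<Rightarrow> tapes \<Rightarrow> nat \<Rightarrow> tapes \<Rightarrow> bool" where
  runs_Op: "runs (Op k a d) T 1 (T(k := op_tape a d (T k)))"
| runs_Seq: "runs c T t T' \<Longrightarrow> runs c' T' t' T'' \<Longrightarrow> runs (Seq c c') T (t + t') T''"
| runs_Cond_true: "read_tape (T k) = s \<Longrightarrow> runs c T t T' \<Longrightarrow> runs (Cond k s c) T (Suc t) T'"
| runs_Cond_false: "read_tape (T k) \<noteq> s \<Longrightarrow> runs (Cond k s c) T 1 T"
| runs_While_stop: "read_tape (T k) = s \<Longrightarrow> runs (While k s c) T 1 T"
| runs_While_step: "read_tape (T k) \<noteq> s \<Longrightarrow> runs c T t T' \<Longrightarrow> runs (While k s c) T' t' T''
    \<Longrightarrow> runs (While k s c) T (Suc (t + Suc t')) T''"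

datatype instr = Act nat "bool option" direction nat | Test nat nat nat nat

fun code_size :: "com \<Rightarrow> nat" where
  "code_size (Op k a d) = 1"
| "code_size (Seq c c') = code_size c + code_size c'"
| "code_size (Cond k s c) = Suc (code_size c)"
| "code_size (While k s c) = Suc (code_size c + 1)"

text \<open>\<open>i\<close> is the state of the first instruction, and control leaves at
  \<open>i + code_size c\<close>. The jump back of a loop is an action that leaves its tape as it
  is.\<close>

fun code :: "com \<Rightarrow> nat \<Rightarrow> instr list" where
  "code (Op k a d) i = [Act k a d (Suc i)]"
| "code (Seq c c') i = code c i @ code c' (i + code_size c)"
| "code (Cond k s c) i = Test k s (Suc i) (Suc (i + code_size c)) # code c (Suc i)"
| "code (While k s c) i =
     Test k s (Suc (Suc (i + code_size c))) (Suc i) # code c (Suc i) @ [Act 0 None Stay i]"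

lemma length_code [simp]: "length (code c i) = code_size c"
  by (induction c arbitrary: i) auto

fun tape_bound :: "com \<Rightarrow> nat" where
  "tape_bound (Op k a d) = Suc k"
| "tape_bound (Seq c c') = max (tape_bound c) (tape_bound c')"
| "tape_bound (Cond k s c) = max (Suc k) (tape_bound c)"
| "tape_bound (While k s c) = max (Suc k) (tape_bound c)"

fun instr_targets :: "instr \<Rightarrow> nat set" where
  "instr_targets (Act k a d j) = {j}"
| "instr_targets (Test k s j j') = {j, j'}"

lemma code_targets: "x \<in> set (code c i) \<Longrightarrow> instr_targets x \<subseteq> {..i + code_size c}"
  by (induction c arbitrary: i) fastforce+

fun instr_step :: "nat \<Rightarrow> instr \<Rightarrow> nat list \<Rightarrow> nat \<times> (nat \<times> direction) list" where
  "instr_step K (Act k a d j) ss =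
     (j, map (\<lambda>m. if m = k then (case a of None \<Rightarrow> ss ! m | Some b \<Rightarrow> bit_symbol b, d)
                   else (ss ! m, Stay)) [0..<K])"
| "instr_step K (Test k s j j') ss =
     (if ss ! k = s then j else j', map (\<lambda>m. (ss ! m, Stay)) [0..<K])"

definition flow_tm :: "nat \<Rightarrow> instr list \<Rightarrow> turing_machine" where
  "flow_tm K prg = \<lparr>num_tapes = K, num_states = length prg, num_symbols = 3,
     transition = (\<lambda>q ss. instr_step K (prg ! q) ss)\<rparr>"

lemma bit_symbol_less: "bit_symbol b < 3"
  by (cases b) auto

lemma wf_flow_tm:
  assumes "1 \<le> K" and "3 \<le> length prg"
    and "\<And>x. x \<in> set prg \<Longrightarrow> instr_targets x \<subseteq> {..<length prg}"
  shows "wf_tm (flow_tm K prg)"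
  unfolding wf_tm_def
proof (intro conjI allI impI)
  fix q ss
  assume q: "q < num_states (flow_tm K prg)" and len: "length ss = num_tapes (flow_tm K prg)"
    and sub: "set ss \<subseteq> {..<num_symbols (flow_tm K prg)}"
  have *: "ss ! m < 3" if "m < K" for m
    using sub len that by (auto simp: flow_tm_def subset_iff)
  have "instr_targets (prg ! q) \<subseteq> {..<length prg}"
    using assms(3)[of "prg ! q"] q by (simp add: flow_tm_def)
  then show "case transition (flow_tm K prg) q ss of (q', acts) \<Rightarrow>
       q' < num_states (flow_tm K prg) \<and> length acts = num_tapes (flow_tm K prg) \<and>
       (\<forall>(s, d) \<in> set acts. s < num_symbols (flow_tm K prg))"
    by (cases "prg ! q") (auto simp: flow_tm_def * bit_symbol_less split: option.splits)
qed (use assms in \<open>auto simp: flow_tm_def\<close>)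

lemma act_tape_same: "act_tape (read_tape tp, Stay) tp = tp"
  by (cases tp) auto

lemma map2_eq_upt:
  "map2 f (map g [0..<K]) (map h [0..<K]) = map (\<lambda>m. f (g m) (h m)) [0..<K]"
  by (rule nth_equalityI) auto

lemma step_Act:
  assumes "q \<noteq> 1" "q \<noteq> 2" "prg ! q = Act k a d j"
  shows "tm_step (flow_tm K prg) (q, map T [0..<K])
    = (j, map (T(k := op_tape a d (T k))) [0..<K])"
proof -
  have "map2 act_tape
     (map (\<lambda>m. if m = k then (case a of None \<Rightarrow> map read_tape (map T [0..<K]) ! m | Some b \<Rightarrow> bit_symbol b, d)
                   else (map read_tape (map T [0..<K]) ! m, Stay)) [0..<K]) (map T [0..<K])
    = map (T(k := op_tape a d (T k))) [0..<K]"
    unfolding map2_eq_upt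
    by (rule map_cong) (auto simp: op_tape_def act_tape_same split: option.splits)
  with assms show ?thesis
    by (simp add: flow_tm_def del: map_map)
qed

lemma step_Test:
  assumes "q \<noteq> 1" "q \<noteq> 2" "prg ! q = Test k s j j'" "k < K"
  shows "tm_step (flow_tm K prg) (q, map T [0..<K])
    = (if read_tape (T k) = s then j else j', map T [0..<K])"
proof -
  have "map2 act_tape (map (\<lambda>m. (map read_tape (map T [0..<K]) ! m, Stay)) [0..<K]) (map T [0..<K])
    = map T [0..<K]"
    unfolding map2_eq_upt
    by (rule map_cong) (auto simp: act_tape_same)
  with assms show ?thesis
    by (simp add: flow_tm_def del: map_map)
qed

text \<open>Requiring \<open>3 \<le> i\<close> keeps the code clear of the halting states 1 and 2,
  in which a step would do nothing.\<close>

definition code_at :: "instr list \<Rightarrow> nat \<Rightarrow> com \<Rightarrow> bool" where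
  "code_at prg i c \<longleftrightarrow> 3 \<le> i \<and> (\<forall>j < code_size c. prg ! (i + j) = code c i ! j)"

lemma code_at_Seq:
  assumes "code_at prg i (Seq c c')"
  shows "code_at prg i c" "code_at prg (i + code_size c) c'"
proof -
  have 1: "3 \<le> i" and
    2: "\<And>j. j < code_size c + code_size c' \<Longrightarrow>
      prg ! (i + j) = (code c i @ code c' (i + code_size c)) ! j"
    using assms by (auto simp: code_at_def)
  show "code_at prg i c"
    using 1 2 by (auto simp: code_at_def nth_append)
  show "code_at prg (i + code_size c) c'"
    using 1 2[of "code_size c + _"] by (auto simp: code_at_def nth_append ac_simps)
qed

lemma code_at_Cond:
  assumes "code_at prg i (Cond k s c)"
  shows "prg ! i = Test k s (Suc i) (Suc (i + code_size c))" "code_at prg (Suc i) c"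
proof -
  have 1: "3 \<le> i" and
    2: "\<And>j. j < Suc (code_size c) \<Longrightarrow>
      prg ! (i + j) = (Test k s (Suc i) (Suc (i + code_size c)) # code c (Suc i)) ! j"
    using assms by (auto simp: code_at_def)
  show "prg ! i = Test k s (Suc i) (Suc (i + code_size c))"
    using 2[of 0] by simp
  show "code_at prg (Suc i) c"
    using 1 2[of "Suc _"] by (auto simp: code_at_def)
qed

lemma code_at_While:
  assumes "code_at prg i (While k s c)"
  shows "prg ! i = Test k s (Suc (Suc (i + code_size c))) (Suc i)" "code_at prg (Suc i) c"
    "prg ! (Suc i + code_size c) = Act 0 None Stay i"
proof -
  have 1: "3 \<le> i" and
    2: "\<And>j. j < Suc (Suc (code_size c)) \<Longrightarrow>
      prg ! (i + j) = (Test k s (Suc (Suc (i + code_size c))) (Suc i) # code c (Suc i)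
        @ [Act 0 None Stay i]) ! j"
    using assms by (auto simp: code_at_def)
  show "prg ! i = Test k s (Suc (Suc (i + code_size c))) (Suc i)"
    using 2[of 0] by simp
  show "code_at prg (Suc i) c"
    using 1 2[of "Suc _"] by (auto simp: code_at_def nth_append)
  show "prg ! (Suc i + code_size c) = Act 0 None Stay i"
    using 2[of "Suc (code_size c)"] by (auto simp: nth_append)
qed

lemma op_tape_None_Stay: "op_tape None Stay tp = tp"
  by (simp add: op_tape_def act_tape_same)

lemma funpow_chain:
  assumes "f a = b" "(f ^^ t) b = c" "f c = d" "(f ^^ t') d = e"
  shows "(f ^^ Suc (t + Suc t')) a = e"
proof -
  have "Suc (t + Suc t') = t' + (1 + (t + 1))"
    by simp
  moreover have "f ^^ 1 = f"
    by simp
  ultimately show ?thesis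
    using assms by (simp only: funpow_add o_apply)
qed

lemma runs_simulation:
  assumes "runs c T t T'" "code_at prg i c" "tape_bound c \<le> K"
  shows "(tm_step (flow_tm K prg) ^^ t) (i, map T [0..<K]) = (i + code_size c, map T' [0..<K])"
  using assms
proof (induction arbitrary: i rule: runs.induct)
  case (runs_Op k a d T)
  then show ?case
    by (simp add: code_at_def step_Act del: tm_step.simps)
next
  case (runs_Seq c T t T' c' t' T'')
  then show ?case
    using code_at_Seq[OF runs_Seq.prems(1)]
    by (simp add: funpow_add add.commute[of t] add.assoc del: tm_step.simps)
next
  case (runs_Cond_true T k s c t T')
  note at = code_at_Cond[OF runs_Cond_true.prems(1)]
  have "i \<noteq> 1" "i \<noteq> 2" using runs_Cond_true.prems(1) by (auto simp: code_at_def)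
  then show ?case
    using runs_Cond_true at step_Test[OF _ _ at(1), where T = T and K = K]
    by (simp del: funpow.simps tm_step.simps add: funpow_Suc_right)
next
  case (runs_Cond_false T k s c)
  note at = code_at_Cond[OF runs_Cond_false.prems(1)]
  have "i \<noteq> 1" "i \<noteq> 2" using runs_Cond_false.prems(1) by (auto simp: code_at_def)
  then show ?case
    using runs_Cond_false at step_Test[OF _ _ at(1), where T = T and K = K] by (simp del: tm_step.simps)
next
  case (runs_While_stop T k s c)
  note at = code_at_While[OF runs_While_stop.prems(1)]
  have "i \<noteq> 1" "i \<noteq> 2" using runs_While_stop.prems(1) by (auto simp: code_at_def)
  then show ?case
    using runs_While_stop at step_Test[OF _ _ at(1), where T = T and K = K] by (simp del: tm_step.simps)
next
  case (runs_While_step T k s c t T' t' T'')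
  note at = code_at_While[OF runs_While_step.prems(1)]
  have i: "i \<noteq> 1" "i \<noteq> 2" "3 \<le> i" using runs_While_step.prems(1) by (auto simp: code_at_def)
  let ?f = "tm_step (flow_tm K prg)"
  have "?f (i, map T [0..<K]) = (Suc i, map T [0..<K])"
    using step_Test[OF i(1,2) at(1), where T = T and K = K] runs_While_step by (simp del: tm_step.simps)
  moreover have "(?f ^^ t) (Suc i, map T [0..<K]) = (Suc i + code_size c, map T' [0..<K])"
    using runs_While_step.IH(1)[OF at(2)] runs_While_step.prems by simp
  moreover have "?f (Suc i + code_size c, map T' [0..<K]) = (i, map T' [0..<K])"
    using step_Act[OF _ _ at(3), where T = T' and K = K] i
    by (simp add: op_tape_None_Stay del: tm_step.simps)
  moreover have "(?f ^^ t') (i, map T' [0..<K]) = (i + code_size (While k s c), map T'' [0..<K])"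
    using runs_While_step.IH(2) runs_While_step.prems by blast
  ultimately show ?case
    by (rule funpow_chain)
qed

text \<open>Instruction 0 jumps over the halting states 1 and 2, whose entries are fillers that are
  never executed. The last test rejects on symbol 1; on the tape of a register this symbol under the
  head means the value 0.\<close>

definition com_tm :: "com \<Rightarrow> nat \<Rightarrow> turing_machine" where
  "com_tm c k = flow_tm (max (Suc k) (tape_bound c))
     (Act 0 None Stay 3 # Act 0 None Stay 0 # Act 0 None Stay 0 # code c 3 @ [Test k 1 2 1])"

lemma wf_com_tm: "wf_tm (com_tm c k)"
  unfolding com_tm_def using code_targets[of _ c 3] by (intro wf_flow_tm) fastforce+

lemma tm_step_halted: "q = 1 \<or> q = 2 \<Longrightarrow> (tm_step M ^^ t) (q, ts) = (q, ts)"
  by (induction t) auto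

lemma runs_com_tm:
  assumes "runs c T t T'" and "t + 2 \<le> t'"
    and "T 0 = input_tape w"
    and "\<And>m. 0 < m \<Longrightarrow> m < max (Suc k) (tape_bound c) \<Longrightarrow> T m = blank_tape"
  shows "fst ((tm_step (com_tm c k) ^^ t') (init_config (com_tm c k) w))
    = (if read_tape (T' k) = 1 then 2 else 1)"
proof -
  define K where "K = max (Suc k) (tape_bound c)"
  define prg where "prg = Act 0 None Stay 3 # Act 0 None Stay 0 # Act 0 None Stay 0 # code c 3 @ [Test k 1 2 1]"
  have M: "com_tm c k = flow_tm K prg"
    by (simp add: com_tm_def K_def prg_def)
  have "K \<ge> 1" by (simp add: K_def)
  have init: "init_config (com_tm c k) w = (0, map T [0..<K])"
    unfolding M init_config_def flow_tm_def using assms(3,4) \<open>K \<ge> 1\<close>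
    by (auto simp: K_def[symmetric] intro!: nth_equalityI simp: nth_Cons split: nat.splits)
  let ?f = "tm_step (flow_tm K prg)"
  have 1: "?f (0, map T [0..<K]) = (3, map T [0..<K])"
    using step_Act[of 0 prg 0 None Stay 3 K T] by (simp add: prg_def op_tape_None_Stay)
  have at: "code_at prg 3 c"
    by (auto simp: code_at_def prg_def nth_append)
  have 2: "(?f ^^ t) (3, map T [0..<K]) = (3 + code_size c, map T' [0..<K])"
    by (rule runs_simulation[OF assms(1) at]) (simp add: K_def)
  have "prg ! (3 + code_size c) = Test k 1 2 1"
    by (simp add: prg_def nth_append)
  then have 3: "?f (3 + code_size c, map T' [0..<K])
    = (if read_tape (T' k) = 1 then 2 else 1, map T' [0..<K])"
    by (intro step_Test) (auto simp: K_def)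
  \<comment> \<open>The two extra steps are the initial jump and the final test; in the remaining
    \<open>u\<close> steps the machine has halted already.\<close>
  obtain u where u: "t' = u + Suc (Suc t)"
    using assms(2) by (metis add_2_eq_Suc' le_add_diff_inverse2)
  have "t' = Suc (t + Suc u)"
    by (simp add: u)
  then have "(?f ^^ t') (0, map T [0..<K])
    = (?f ^^ u) (if read_tape (T' k) = 1 then 2 else 1, map T' [0..<K])"
    using funpow_chain[OF 1 2 3 refl] by simp
  then show ?thesis
    unfolding init unfolding M by (auto simp: tm_step_halted)
qed

section \<open>A polynomial-time language over bit arrays\<close>

definition runs_within :: "com \<Rightarrow> tapes \<Rightarrow> nat \<Rightarrow> tapes \<Rightarrow> bool" where
  "runs_within c T b T' \<longleftrightarrow> (\<exists>t \<le> b. runs c T t T')"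

lemma runs_within_mono: "runs_within c T b T' \<Longrightarrow> b \<le> b' \<Longrightarrow> runs_within c T b' T'"
  unfolding runs_within_def by (meson order_trans)

lemma runs_within_Seq:
  "runs_within c T b T' \<Longrightarrow> runs_within c' T' b' T'' \<Longrightarrow> runs_within (Seq c c') T (b + b') T''"
  unfolding runs_within_def by (meson add_mono runs_Seq)

type_synonym arrays = "nat \<Rightarrow> nat \<Rightarrow> nat"

(* Tape 2i holds array i, tape 2i+1 holds register i in unary: its value is the position of the
   head, and only cell 0 is marked. *)
definition layout :: "(nat \<Rightarrow> nat) \<Rightarrow> arrays \<Rightarrow> (nat \<Rightarrow> nat) \<Rightarrow> tapes" where
  "layout s A H k =
     (if odd k then ((\<lambda>z. if z = 0 then 1 else 0), int (s (k div 2)))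
      else ((\<lambda>z. if z < 0 then 0 else A (k div 2) (nat z)), int (H (k div 2))))"

definition reg :: "nat \<Rightarrow> nat" where "reg i = Suc (2 * i)"
definition arr :: "nat \<Rightarrow> nat" where "arr i = 2 * i"

lemma layout_reg_apply: "layout s A H (reg r) = ((\<lambda>z. if z = 0 then 1 else 0), int (s r))"
  by (simp add: layout_def reg_def)

lemma layout_arr_apply:
  "layout s A H (arr k) = ((\<lambda>z. if z < 0 then 0 else A k (nat z)), int (H k))"
  by (simp add: layout_def arr_def cong: if_cong)

lemma tape_cases:
  obtains (reg) i where "k = reg i" | (arr) i where "k = arr i"
  unfolding reg_def arr_def by (cases "even k") (auto elim: evenE oddE)

lemma reg_arr_eq [simp]: "reg i = reg j \<longleftrightarrow> i = j" "arr i = arr j \<longleftrightarrow> i = j"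
    "reg i \<noteq> arr j" "arr j \<noteq> reg i"
  unfolding reg_def arr_def by presburger+

lemma read_reg: "read_tape (layout s A H (reg r)) = (if s r = 0 then 1 else 0)"
  by (simp add: layout_reg_apply)

lemma read_arr: "read_tape (layout s A H (arr k)) = A k (H k)"
  by (simp add: layout_arr_apply)

lemma layout_reg: "(layout s A H)(reg r := layout s' A H (reg r)) = layout (s(r := s' r)) A H"
proof
  fix k
  show "((layout s A H)(reg r := layout s' A H (reg r))) k = layout (s(r := s' r)) A H k"
    by (cases k rule: tape_cases) (simp_all add: layout_reg_apply layout_arr_apply)
qed

lemma layout_arr:
  "(layout s A H)(arr k := layout s A' H' (arr k)) = layout s (A(k := A' k)) (H(k := H' k))"
proof
  fix m
  show "((layout s A H)(arr k := layout s A' H' (arr k))) m = layout s (A(k := A' k)) (H(k := H' k)) m"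
    by (cases m rule: tape_cases) (auto simp: layout_reg_apply layout_arr_apply)
qed

definition Inc :: "nat \<Rightarrow> com" where "Inc r = Op (reg r) None Move_Right"
text \<open>Symbol 0 is under the head exactly if the value is positive, that is, if the head has
  left the marked cell. At value 0 nothing happens, which gives truncated subtraction.\<close>

definition Dec :: "nat \<Rightarrow> com" where "Dec r = Cond (reg r) 0 (Op (reg r) None Move_Left)"
definition Fwd :: "nat \<Rightarrow> com" where "Fwd k = Op (arr k) None Move_Right"
definition Bwd :: "nat \<Rightarrow> com" where "Bwd k = Op (arr k) None Move_Left"
definition Mark :: "nat \<Rightarrow> bool \<Rightarrow> com" where "Mark k b = Op (arr k) (Some b) Stay"
text \<open>The register itself is the loop counter and ends at 0, when its head is back on the
  mark. It is decremented before each execution of the body.\<close>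

definition Loop :: "nat \<Rightarrow> com \<Rightarrow> com" where
  "Loop r c = While (reg r) 1 (Seq (Op (reg r) None Move_Left) c)"

lemma runs_Op': "T' = T(k := op_tape a d (T k)) \<Longrightarrow> runs (Op k a d) T 1 T'"
  using runs_Op by simp

lemma op_right_reg: "op_tape None Move_Right (layout s A H (reg r)) = layout (s(r := Suc (s r))) A H (reg r)"
  by (simp add: layout_reg_apply layout_arr_apply op_tape_def fun_eq_iff)

lemma op_left_reg:
  "s r \<noteq> 0 \<Longrightarrow> op_tape None Move_Left (layout s A H (reg r)) = layout (s(r := s r - 1)) A H (reg r)"
  by (simp add: layout_reg_apply layout_arr_apply op_tape_def fun_eq_iff)

lemma op_right_arr: "op_tape None Move_Right (layout s A H (arr k)) = layout s A (H(k := Suc (H k))) (arr k)"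
  by (simp add: layout_reg_apply layout_arr_apply op_tape_def fun_eq_iff)

lemma op_left_arr:
  "H k \<noteq> 0 \<Longrightarrow> op_tape None Move_Left (layout s A H (arr k)) = layout s A (H(k := H k - 1)) (arr k)"
  by (simp add: layout_reg_apply layout_arr_apply op_tape_def fun_eq_iff)

lemma op_mark_arr:
  "op_tape (Some b) Stay (layout s A H (arr k))
    = layout s (A(k := (A k)(H k := bit_symbol b))) H (arr k)"
  by (auto simp: layout_arr_apply op_tape_def fun_eq_iff)

lemma runs_Inc: "runs_within (Inc r) (layout s A H) 1 (layout (s(r := Suc (s r))) A H)"
  unfolding runs_within_def Inc_def
  by (rule exI[of _ 1], simp, rule runs_Op'[unfolded One_nat_def]) (simp add: op_right_reg layout_reg)

lemma runs_Left:
  "s r \<noteq> 0 \<Longrightarrow> runs (Op (reg r) None Move_Left) (layout s A H) 1 (layout (s(r := s r - 1)) A H)"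
  by (rule runs_Op') (simp add: op_left_reg layout_reg)

lemma runs_Dec: "runs_within (Dec r) (layout s A H) 2 (layout (s(r := s r - 1)) A H)"
proof (cases "s r = 0")
  case True
  then have "s(r := s r - 1) = s" by auto
  then show ?thesis
    unfolding runs_within_def Dec_def
    using runs_Cond_false[of "layout s A H" "reg r" 0] True by (auto simp: read_reg intro!: exI[of _ 1])
next
  case False
  then show ?thesis
    unfolding runs_within_def Dec_def
    using runs_Cond_true[OF _ runs_Left[of s r A H], of "reg r" 0] by (intro exI[of _ "Suc 1"]) (simp add: read_reg)
qed

lemma runs_Fwd: "runs_within (Fwd k) (layout s A H) 1 (layout s A (H(k := Suc (H k))))"
  unfolding runs_within_def Fwd_def
  by (rule exI[of _ 1], simp, rule runs_Op'[unfolded One_nat_def]) (simp add: op_right_arr layout_arr)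

lemma runs_Bwd: "H k \<noteq> 0 \<Longrightarrow> runs_within (Bwd k) (layout s A H) 1 (layout s A (H(k := H k - 1)))"
  unfolding runs_within_def Bwd_def
  by (rule exI[of _ 1], simp, rule runs_Op'[unfolded One_nat_def]) (simp add: op_left_arr layout_arr)

lemma runs_Mark:
  "runs_within (Mark k b) (layout s A H) 1 (layout s (A(k := (A k)(H k := bit_symbol b))) H)"
  unfolding runs_within_def Mark_def
  by (rule exI[of _ 1], simp, rule runs_Op'[unfolded One_nat_def]) (simp add: op_mark_arr layout_arr)

lemma runs_Cond:
  assumes "read_tape (T k) = s \<Longrightarrow> runs_within c T b T'" "read_tape (T k) \<noteq> s \<Longrightarrow> T' = T"
  shows "runs_within (Cond k s c) T (Suc b) T'"
proof (cases "read_tape (T k) = s")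
  case True
  with assms(1) obtain t where "t \<le> b" "runs c T t T'" unfolding runs_within_def by auto
  with True show ?thesis
    unfolding runs_within_def by (intro exI[of _ "Suc t"]) (auto intro: runs_Cond_true)
next
  case False
  with assms(2) show ?thesis
    unfolding runs_within_def by (intro exI[of _ 1]) (auto intro: runs_Cond_false[unfolded One_nat_def])
qed

text \<open>\<open>S\<close>, \<open>A'\<close> and \<open>H'\<close> give the state after i
  iterations. The constant 3 per iteration covers the test, the decrement and the jump back, and the
  final 1 is the last test.\<close>

lemma runs_Loop:
  assumes "s r = n"
    and "\<And>i. i \<le> n \<Longrightarrow> S i r = n - i"
    and "S 0 = s" "A' 0 = A" "H' 0 = H"
    and "\<And>i. i < n \<Longrightarrow>
      runs_within c (layout ((S i)(r := n - Suc i)) (A' i) (H' i)) b (layout (S (Suc i)) (A' (Suc i)) (H' (Suc i)))"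
  shows "runs_within (Loop r c) (layout s A H) (n * (b + 3) + 1) (layout (S n) (A' n) (H' n))"
  using assms
proof (induction n arbitrary: s A H S A' H')
  case 0
  then show ?case
    unfolding runs_within_def Loop_def
    using runs_While_stop[of "layout s A H" "reg r" 1] by (auto simp: read_reg intro!: exI[of _ 1])
next
  case (Suc n)
  have "runs_within (Loop r c) (layout (S 1) (A' 1) (H' 1)) (n * (b + 3) + 1)
     (layout (S (Suc n)) (A' (Suc n)) (H' (Suc n)))"
  proof (rule Suc.IH[where S = "\<lambda>i. S (Suc i)" and A' = "\<lambda>i. A' (Suc i)" and H' = "\<lambda>i. H' (Suc i)"])
    show "S 1 r = n"
      using Suc.prems(2)[of 1] by simp
    show "S (Suc i) r = n - i" if "i \<le> n" for i
      using Suc.prems(2)[of "Suc i"] that by simp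
    show "runs_within c (layout ((S (Suc i))(r := n - Suc i)) (A' (Suc i)) (H' (Suc i))) b
        (layout (S (Suc (Suc i))) (A' (Suc (Suc i))) (H' (Suc (Suc i))))" if "i < n" for i
      using Suc.prems(6)[of "Suc i"] that unfolding diff_Suc_Suc by (simp del: fun_upd_apply)
  qed (use Suc.prems in simp_all)
  then obtain t' where t': "t' \<le> n * (b + 3) + 1"
    "runs (Loop r c) (layout (S 1) (A' 1) (H' 1)) t' (layout (S (Suc n)) (A' (Suc n)) (H' (Suc n)))"
    unfolding runs_within_def by auto
  have "runs_within c (layout (s(r := n)) A H) b (layout (S 1) (A' 1) (H' 1))"
    using Suc.prems(6)[of 0] unfolding Suc.prems(3-5) by (simp del: fun_upd_apply)
  then obtain t where t: "t \<le> b" "runs c (layout (s(r := n)) A H) t (layout (S 1) (A' 1) (H' 1))"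
    unfolding runs_within_def by auto
  have "runs (Seq (Op (reg r) None Move_Left) c) (layout s A H) (1 + t) (layout (S 1) (A' 1) (H' 1))"
    using runs_Left[of s r A H] t(2) Suc.prems(1) by (intro runs_Seq) auto
  then have "runs (Loop r c) (layout s A H) (Suc (1 + t + Suc t'))
    (layout (S (Suc n)) (A' (Suc n)) (H' (Suc n)))"
    using t'(2) Suc.prems(1) unfolding Loop_def by (intro runs_While_step) (auto simp: read_reg)
  moreover have "Suc (1 + t + Suc t') \<le> Suc n * (b + 3) + 1"
    using t(1) t'(1) by simp
  ultimately show ?case
    unfolding runs_within_def by blast
qed

lemma runs_Loop_regs:
  assumes "s r = n" "\<And>i. i \<le> n \<Longrightarrow> S i r = n - i" "S 0 = s"
    and "\<And>i. i < n \<Longrightarrow>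
      runs_within c (layout ((S i)(r := n - Suc i)) A H) b (layout (S (Suc i)) A H)"
  shows "runs_within (Loop r c) (layout s A H) (n * (b + 3) + 1) (layout (S n) A H)"
  by (rule runs_Loop[where A' = "\<lambda>_. A" and H' = "\<lambda>_. H"]) (use assms in simp_all)

section \<open>Polynomially bounded functions\<close>

text \<open>Monotonicity is what makes the class closed under composition. The base n + 2 is at
  least 2, so constant factors can be absorbed into the exponent.\<close>

definition poly_bounded :: "(nat \<Rightarrow> nat) \<Rightarrow> bool" where
  "poly_bounded f \<longleftrightarrow> mono f \<and> (\<exists>k. \<forall>n. f n \<le> (n + 2) ^ k)"

lemma poly_bounded_const: "poly_bounded (\<lambda>n. c)"
proof -
  have "c \<le> (n + 2) ^ c" for n
    using order_trans[OF less_imp_le[OF less_exp[of c]] power_mono[of 2 "n + 2" c]] by simp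
  moreover have "mono (\<lambda>n::nat. c)"
    by (simp add: mono_def)
  ultimately show ?thesis
    unfolding poly_bounded_def by blast
qed

lemma poly_bounded_id: "poly_bounded (\<lambda>n. n)"
  unfolding poly_bounded_def by (auto simp: mono_def intro!: exI[of _ 1])

lemma poly_bounded_mult:
  assumes "poly_bounded f" "poly_bounded g"
  shows "poly_bounded (\<lambda>n. f n * g n)"
proof -
  obtain k l where "\<And>n. f n \<le> (n + 2) ^ k" "\<And>n. g n \<le> (n + 2) ^ l"
    using assms unfolding poly_bounded_def by auto
  then have "f n * g n \<le> (n + 2) ^ (k + l)" for n
    unfolding power_add by (intro mult_mono) auto
  moreover have "mono (\<lambda>n. f n * g n)"
    using assms unfolding poly_bounded_def mono_def by (simp add: mult_le_mono)
  ultimately show ?thesis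
    unfolding poly_bounded_def by blast
qed

lemma poly_bounded_add:
  assumes "poly_bounded f" "poly_bounded g"
  shows "poly_bounded (\<lambda>n. f n + g n)"
proof -
  obtain k l where kl: "\<And>n. f n \<le> (n + 2) ^ k" "\<And>n. g n \<le> (n + 2) ^ l"
    using assms unfolding poly_bounded_def by auto
  have "f n + g n \<le> (n + 2) ^ (k + l + 1)" for n
  proof -
    have "f n \<le> (n + 2) ^ (k + l)" "g n \<le> (n + 2) ^ (k + l)"
      using kl[of n] power_increasing[of k "k + l" "n + 2"] power_increasing[of l "k + l" "n + 2"]
      by linarith+
    then have "f n + g n \<le> 2 * (n + 2) ^ (k + l)"
      by linarith
    also have "\<dots> \<le> (n + 2) * (n + 2) ^ (k + l)"
      by (intro mult_right_mono) auto
    finally show ?thesis by simp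
  qed
  moreover have "mono (\<lambda>n. f n + g n)"
    using assms unfolding poly_bounded_def mono_def by (simp add: add_le_mono)
  ultimately show ?thesis
    unfolding poly_bounded_def by blast
qed

lemma poly_bounded_comp:
  assumes "poly_bounded f" "poly_bounded g"
  shows "poly_bounded (\<lambda>n. f (g n))"
proof -
  obtain k l where kl: "\<And>n. f n \<le> (n + 2) ^ k" "\<And>n. g n \<le> (n + 2) ^ l"
    using assms unfolding poly_bounded_def by auto
  have "f (g n) \<le> (n + 2) ^ ((l + 2) * k)" for n
  proof -
    \<comment> \<open>The constant 2 is absorbed by g n + 2 \<le> 3 (n+2)^l and 3 \<le> (n+2)^2;
      hence the \<open>l + 2\<close> in the exponent.\<close>
    have "g n + 2 \<le> (n + 2) ^ l + 2 * (n + 2) ^ l"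
      using kl(2)[of n] by (intro add_mono) auto
    also have "\<dots> \<le> (n + 2) ^ l * (n + 2) ^ 2"
    proof -
      have "(2::nat) ^ 2 \<le> (n + 2) ^ 2" by (rule power_mono) auto
      then have "3 \<le> (n + 2) ^ 2" by simp
      then show ?thesis using mult_left_mono[of 3 "(n + 2) ^ 2" "(n + 2) ^ l"] by simp
    qed
    finally have "g n + 2 \<le> (n + 2) ^ (l + 2)"
      by (simp only: power_add)
    then have "(g n + 2) ^ k \<le> ((n + 2) ^ (l + 2)) ^ k"
      by (rule power_mono) simp
    then show ?thesis
      using kl(1)[of "g n"] unfolding power_mult by (rule order_trans[rotated])
  qed
  moreover have "mono (\<lambda>n. f (g n))"
    using assms unfolding poly_bounded_def mono_def by simp
  ultimately show ?thesis
    unfolding poly_bounded_def by blast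
qed

lemma poly_bounded_Suc: "poly_bounded f \<Longrightarrow> poly_bounded (\<lambda>n. Suc (f n))"
  using poly_bounded_add[OF poly_bounded_const[of 1]] by simp

lemmas poly_bounded_intros = poly_bounded_Suc
  poly_bounded_const poly_bounded_id poly_bounded_add poly_bounded_mult

section \<open>Expressions and their compilation\<close>

text \<open>\<open>Sum\<close> is the only iteration; products, quantifiers and bounded search are
  derived from it. \<open>Sym\<close> is the only access to arrays and yields a truth value, the
  comparison with a fixed symbol.\<close>

datatype exp =
    Cst nat
  | Var nat
  | Add exp exp
  | Sub exp exp
  | Sum nat exp exp
  | Sym nat nat exp

fun eval :: "arrays \<Rightarrow> (nat \<Rightarrow> nat) \<Rightarrow> exp \<Rightarrow> nat" where
  "eval A v (Cst n) = n"
| "eval A v (Var x) = v x"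
| "eval A v (Add e e') = eval A v e + eval A v e'"
| "eval A v (Sub e e') = eval A v e - eval A v e'"
| "eval A v (Sum x e e') = (\<Sum>i<eval A v e. eval A (v(x := i)) e')"
| "eval A v (Sym k a e) = (if A k (eval A v e) = a then 1 else 0)"

definition Nop :: com where "Nop = Op 0 None Stay"

lemma runs_Nop: "runs_within Nop T 1 T"
  unfolding runs_within_def Nop_def
  by (rule exI[of _ 1], simp, rule runs_Op'[unfolded One_nat_def]) (simp add: op_tape_None_Stay)

fun const_com :: "nat \<Rightarrow> nat \<Rightarrow> com" where
  "const_com 0 r = Nop"
| "const_com (Suc n) r = Seq (const_com n r) (Inc r)"

(* The value ends up in register r; all registers from r on are zero before, and all after
   register r are zero again afterwards. The variable x lives in register \<rho> x. *)
fun comp :: "(nat \<Rightarrow> nat) \<Rightarrow> exp \<Rightarrow> nat \<Rightarrow> com" where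
  "comp \<rho> (Cst n) r = const_com n r"
| "comp \<rho> (Var x) r =
     Seq (Loop (\<rho> x) (Seq (Inc r) (Inc (r + 1)))) (Loop (r + 1) (Inc (\<rho> x)))"
| "comp \<rho> (Add e e') r = Seq (comp \<rho> e r) (Seq (comp \<rho> e' (r + 1)) (Loop (r + 1) (Inc r)))"
| "comp \<rho> (Sub e e') r = Seq (comp \<rho> e r) (Seq (comp \<rho> e' (r + 1)) (Loop (r + 1) (Dec r)))"
| "comp \<rho> (Sum x e e') r =
     Seq (comp \<rho> e (r + 2))
      (Seq (Loop (r + 2) (Seq (comp (\<rho>(x := r + 1)) e' (r + 3)) (Seq (Loop (r + 3) (Inc r)) (Inc (r + 1)))))
           (Loop (r + 1) Nop))"
| "comp \<rho> (Sym k a e) r =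
     Seq (comp \<rho> e (r + 1))
      (Seq (Loop (r + 1) (Seq (Fwd k) (Inc (r + 2))))
       (Seq (Cond (arr k) a (Inc r)) (Loop (r + 2) (Bwd k))))"

lemma runs_const_com:
  "s r = 0 \<Longrightarrow> runs_within (const_com n r) (layout s A H) (n + 1) (layout (s(r := n)) A H)"
proof (induction n)
  case 0
  then have "s(r := 0) = s" by auto
  with runs_Nop show ?case by simp
next
  case (Suc n)
  then show ?case
    using runs_within_Seq[OF Suc.IH runs_Inc[of r]] by (simp del: fun_upd_apply add: fun_upd_same)
qed

abbreviation zeros :: "nat \<Rightarrow> nat" where "zeros \<equiv> \<lambda>_. 0"

text \<open>\<open>B\<close> bounds all variables, and inside a sum the bound grows by that of the
  range. The array contents do not enter, since \<open>Sym\<close> contributes 1 whatever is stored;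
  this is what the restriction to bits achieves.\<close>

fun eval_bound :: "exp \<Rightarrow> nat \<Rightarrow> nat" where
  "eval_bound (Cst n) B = n"
| "eval_bound (Var x) B = B"
| "eval_bound (Add e e') B = eval_bound e B + eval_bound e' B"
| "eval_bound (Sub e e') B = eval_bound e B"
| "eval_bound (Sum x e e') B = eval_bound e B * eval_bound e' (B + eval_bound e B)"
| "eval_bound (Sym k a e) B = 1"

text \<open>The arithmetic is left unevaluated so that it has the shape of the bounds produced by
  the rules for sequences and loops.\<close>

fun comp_bound :: "exp \<Rightarrow> nat \<Rightarrow> nat" where
  "comp_bound (Cst n) B = n + 1"
| "comp_bound (Var x) B = (B * (1 + 1 + 3) + 1) + (B * (1 + 3) + 1)"
| "comp_bound (Add e e') B =
     comp_bound e B + (comp_bound e' B + (eval_bound e' B * (1 + 3) + 1))"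
| "comp_bound (Sub e e') B =
     comp_bound e B + (comp_bound e' B + (eval_bound e' B * (2 + 3) + 1))"
| "comp_bound (Sum x e e') B =
     comp_bound e B + ((eval_bound e B *
       (comp_bound e' (B + eval_bound e B) + ((eval_bound e' (B + eval_bound e B) * (1 + 3) + 1) + 1) + 3) + 1)
     + (eval_bound e B * (1 + 3) + 1))"
| "comp_bound (Sym k a e) B =
     comp_bound e B + ((eval_bound e B * (1 + 1 + 3) + 1) + (2 + (eval_bound e B * (1 + 3) + 1)))"

lemma poly_bounded_eval_bound: "poly_bounded (eval_bound e)"
proof (induction e)
  case (Sum x e e')
  have "poly_bounded (\<lambda>B. eval_bound e' (B + eval_bound e B))"
    by (rule poly_bounded_comp[OF Sum(2)]) (intro poly_bounded_intros Sum(1))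
  with Sum(1) have "poly_bounded (\<lambda>B. eval_bound (Sum x e e') B)"
    unfolding eval_bound.simps by (intro poly_bounded_intros)
  then show ?case by simp
qed (auto intro!: poly_bounded_intros)

lemma poly_bounded_comp_bound: "poly_bounded (comp_bound e)"
proof (induction e)
  case (Sum x e e')
  have "poly_bounded (\<lambda>B. eval_bound e' (B + eval_bound e B))"
    "poly_bounded (\<lambda>B. comp_bound e' (B + eval_bound e B))"
    by (rule poly_bounded_comp[OF poly_bounded_eval_bound] poly_bounded_comp[OF Sum(2)],
        intro poly_bounded_intros poly_bounded_eval_bound)+
  then have "poly_bounded (\<lambda>B. comp_bound (Sum x e e') B)"
    unfolding comp_bound.simps by (intro poly_bounded_intros poly_bounded_eval_bound Sum(1))
  then show ?case by simp
qed (auto intro!: poly_bounded_intros poly_bounded_eval_bound)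

lemma eval_le_bound: "(\<And>y. v y \<le> B) \<Longrightarrow> eval A v e \<le> eval_bound e B"
proof (induction e arbitrary: v B)
  case (Sum x e e')
  have e: "eval A v e \<le> eval_bound e B"
    using Sum by blast
  have "eval A (v(x := i)) e' \<le> eval_bound e' (B + eval_bound e B)" if "i < eval A v e" for i
    using that e Sum.prems by (intro Sum.IH(2)) (auto intro: trans_le_add1)
  then have "(\<Sum>i<eval A v e. eval A (v(x := i)) e')
    \<le> (\<Sum>i<eval A v e. eval_bound e' (B + eval_bound e B))"
    by (intro sum_mono) auto
  also have "\<dots> \<le> eval_bound e B * eval_bound e' (B + eval_bound e B)"
    using e by simp
  finally show ?case by simp
qed (auto intro: add_mono le_trans[OF diff_le_self])

lemma runs_within_eq:
  "runs_within c (layout s A H) b (layout s' A' H') \<Longrightarrow> b \<le> b' \<Longrightarrow> (\<And>k. s' k = s'' k)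
    \<Longrightarrow> (\<And>k a. A' k a = A'' k a) \<Longrightarrow> (\<And>k. H' k = H'' k)
    \<Longrightarrow> runs_within c (layout s A H) b' (layout s'' A'' H'')"
  using runs_within_mono[of c "layout s A H" b "layout s' A' H'" b'] ext[of s' s''] ext[of H' H'']
    ext[of A' A'', OF ext[of "A' _" "A'' _"]] by simp

text \<open>A variable is read by moving its value into two registers and moving one copy back. For
  a sum, \<open>r\<close> accumulates, \<open>r + 1\<close> is the bound variable,
  \<open>r + 2\<close> counts the remaining rounds and \<open>r + 3\<close> receives the summand.
  For an array access, \<open>r + 2\<close> remembers how far the head must return, so that all
  array heads are at 0 between commands. Variables may share a register as long as they have the
  same value.\<close>

lemma runs_comp:
  assumes "\<And>y. \<rho> y < r" "\<And>y. s (\<rho> y) = v y" "\<And>y. v y \<le> B" "\<And>j. r \<le> j \<Longrightarrow> s j = 0"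
  shows "runs_within (comp \<rho> e r) (layout s A zeros) (comp_bound e B)
    (layout (s(r := eval A v e)) A zeros)"
  using assms
proof (induction e arbitrary: \<rho> r s v B)
  case (Cst n)
  then show ?case
    unfolding comp.simps by (intro runs_within_eq[OF runs_const_com]) auto
next
  case (Var x)
  let ?n = "v x"
  have x: "\<rho> x < r" "s (\<rho> x) = ?n" "?n \<le> B" using Var by auto
  have 1: "runs_within (Loop (\<rho> x) (Seq (Inc r) (Inc (r + 1)))) (layout s A zeros) (?n * (1 + 1 + 3) + 1)
    (layout (s(\<rho> x := ?n - ?n, r := ?n, r + 1 := ?n)) A zeros)"
  proof (rule runs_Loop_regs[where S = "\<lambda>i. s(\<rho> x := ?n - i, r := i, r + 1 := i)"])
    fix i assume "i < ?n"
    show "runs_within (Seq (Inc r) (Inc (r + 1)))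
          (layout ((s(\<rho> x := v x - i, r := i, r + 1 := i))(\<rho> x := v x - Suc i)) A zeros) (1 + 1)
          (layout (s(\<rho> x := v x - Suc i, r := Suc i, r + 1 := Suc i)) A zeros)"
      by (rule runs_within_eq[OF runs_within_Seq[OF runs_Inc runs_Inc]]) (use x in auto)
  qed (use x Var.prems(4) in auto)
  have 2: "runs_within (Loop (r + 1) (Inc (\<rho> x))) (layout (s(\<rho> x := ?n - ?n, r := ?n, r + 1 := ?n)) A zeros)
    (?n * (1 + 3) + 1) (layout (s(\<rho> x := ?n, r := ?n, r + 1 := ?n - ?n)) A zeros)"
  proof (rule runs_Loop_regs[where S = "\<lambda>i. s(\<rho> x := i, r := ?n, r + 1 := ?n - i)"])
    fix i assume "i < ?n"
    show "runs_within (Inc (\<rho> x))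
          (layout ((s(\<rho> x := i, r := ?n, r + 1 := ?n - i))(r + 1 := ?n - Suc i)) A zeros) 1
          (layout (s(\<rho> x := Suc i, r := ?n, r + 1 := ?n - Suc i)) A zeros)"
      by (rule runs_within_eq[OF runs_Inc]) (use x in auto)
  qed (use x Var.prems(4) in auto)
  have "?n * (1 + 1 + 3) + 1 + (?n * (1 + 3) + 1) \<le> comp_bound (Var x) B"
    using x(3) by simp
  then show ?case
    unfolding comp.simps by (intro runs_within_eq[OF runs_within_Seq[OF 1 2]]) (use x Var.prems(4) in auto)
next
  case (Add e e')
  let ?m = "eval A v e" and ?n = "eval A v e'"
  have n: "?n \<le> eval_bound e' B" by (rule eval_le_bound) (use Add.prems in auto)
  have 1: "runs_within (comp \<rho> e r) (layout s A zeros) (comp_bound e B) (layout (s(r := ?m)) A zeros)"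
    by (rule Add.IH(1)) (use Add.prems in auto)
  have 2: "runs_within (comp \<rho> e' (r + 1)) (layout (s(r := ?m)) A zeros) (comp_bound e' B)
      (layout (s(r := ?m, r + 1 := ?n)) A zeros)"
    by (rule Add.IH(2)) (use Add.prems in \<open>auto simp: less_SucI less_imp_neq[symmetric] dest: less_imp_neq\<close>)
  have 3: "runs_within (Loop (r + 1) (Inc r)) (layout (s(r := ?m, r + 1 := ?n)) A zeros) (?n * (1 + 3) + 1)
      (layout (s(r := ?m + ?n, r + 1 := ?n - ?n)) A zeros)"
  proof (rule runs_Loop_regs[where S = "\<lambda>i. s(r := ?m + i, r + 1 := ?n - i)"])
    fix i assume "i < ?n"
    show "runs_within (Inc r) (layout ((s(r := ?m + i, r + 1 := ?n - i))(r + 1 := ?n - Suc i)) A zeros) 1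
        (layout (s(r := ?m + Suc i, r + 1 := ?n - Suc i)) A zeros)"
      by (rule runs_within_eq[OF runs_Inc]) auto
  qed auto
  show ?case
    unfolding comp.simps by (rule runs_within_eq[OF runs_within_Seq[OF 1 runs_within_Seq[OF 2 3]]])
      (use n Add.prems(4) in auto)
next
  case (Sub e e')
  let ?m = "eval A v e" and ?n = "eval A v e'"
  have n: "?n \<le> eval_bound e' B" by (rule eval_le_bound) (use Sub.prems in auto)
  have 1: "runs_within (comp \<rho> e r) (layout s A zeros) (comp_bound e B) (layout (s(r := ?m)) A zeros)"
    by (rule Sub.IH(1)) (use Sub.prems in auto)
  have 2: "runs_within (comp \<rho> e' (r + 1)) (layout (s(r := ?m)) A zeros) (comp_bound e' B)
      (layout (s(r := ?m, r + 1 := ?n)) A zeros)"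
    by (rule Sub.IH(2)) (use Sub.prems in \<open>auto simp: less_SucI less_imp_neq[symmetric] dest: less_imp_neq\<close>)
  have 3: "runs_within (Loop (r + 1) (Dec r)) (layout (s(r := ?m, r + 1 := ?n)) A zeros) (?n * (2 + 3) + 1)
      (layout (s(r := ?m - ?n, r + 1 := ?n - ?n)) A zeros)"
  proof (rule runs_Loop_regs[where S = "\<lambda>i. s(r := ?m - i, r + 1 := ?n - i)"])
    fix i assume "i < ?n"
    show "runs_within (Dec r) (layout ((s(r := ?m - i, r + 1 := ?n - i))(r + 1 := ?n - Suc i)) A zeros) 2
        (layout (s(r := ?m - Suc i, r + 1 := ?n - Suc i)) A zeros)"
      by (rule runs_within_eq[OF runs_Dec]) auto
  qed auto
  show ?case
    unfolding comp.simps by (rule runs_within_eq[OF runs_within_Seq[OF 1 runs_within_Seq[OF 2 3]]])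
      (use n Sub.prems(4) in auto)
next
  case (Sum x e e')
  define n where "n = eval A v e"
  define B' where "B' = B + eval_bound e B"
  define \<sigma> where "\<sigma> i = (\<Sum>j<i. eval A (v(x := j)) e')" for i
  have n: "n \<le> eval_bound e B" unfolding n_def by (rule eval_le_bound) (use Sum.prems in auto)
  have 1: "runs_within (comp \<rho> e (r + 2)) (layout s A zeros) (comp_bound e B) (layout (s(r + 2 := n)) A zeros)"
    unfolding n_def by (rule Sum.IH(1)) (use Sum.prems in \<open>auto intro: less_SucI\<close>)
  let ?b = "comp_bound e' B' + ((eval_bound e' B' * (1 + 3) + 1) + 1)"
  have 2: "runs_within (Loop (r + 2) (Seq (comp (\<rho>(x := r + 1)) e' (r + 3)) (Seq (Loop (r + 3) (Inc r)) (Inc (r + 1)))))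
     (layout (s(r + 2 := n)) A zeros) (n * (?b + 3) + 1)
     (layout (s(r := \<sigma> n, r + 1 := n, r + 2 := n - n)) A zeros)"
  proof (rule runs_Loop_regs[where S = "\<lambda>i. s(r := \<sigma> i, r + 1 := i, r + 2 := n - i)"])
    fix i assume i: "i < n"
    define s' where "s' = s(r := \<sigma> i, r + 1 := i, r + 2 := n - Suc i)"
    define m where "m = eval A (v(x := i)) e'"
    have s': "(s(r := \<sigma> i, r + 1 := i, r + 2 := n - i))(r + 2 := n - Suc i) = s'"
      by (simp add: s'_def)
    have v: "(v(x := i)) y \<le> B'" for y
      using i n Sum.prems(3)[of y] by (auto simp: B'_def)
    have m: "m \<le> eval_bound e' B'"
      unfolding m_def by (rule eval_le_bound) (rule v)
    have a: "runs_within (comp (\<rho>(x := r + 1)) e' (r + 3)) (layout s' A zeros) (comp_bound e' B')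
        (layout (s'(r + 3 := m)) A zeros)"
      unfolding m_def
    proof (rule Sum.IH(2))
      show "(\<rho>(x := r + 1)) y < r + 3" for y
        using Sum.prems(1)[of y] by auto
      show "s' ((\<rho>(x := r + 1)) y) = (v(x := i)) y" for y
        using Sum.prems(1)[of y] Sum.prems(2)[of y] by (auto simp: s'_def)
      show "s' j = 0" if "r + 3 \<le> j" for j
        using that Sum.prems(4)[of j] by (auto simp: s'_def)
    qed (rule v)
    have b: "runs_within (Loop (r + 3) (Inc r)) (layout (s'(r + 3 := m)) A zeros) (m * (1 + 3) + 1)
        (layout (s'(r := \<sigma> i + m, r + 3 := m - m)) A zeros)"
    proof (rule runs_Loop_regs[where S = "\<lambda>k. s'(r := \<sigma> i + k, r + 3 := m - k)"])
      fix k assume "k < m"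
      show "runs_within (Inc r) (layout ((s'(r := \<sigma> i + k, r + 3 := m - k))(r + 3 := m - Suc k)) A zeros) 1
          (layout (s'(r := \<sigma> i + Suc k, r + 3 := m - Suc k)) A zeros)"
        by (rule runs_within_eq[OF runs_Inc]) auto
    qed (auto simp: s'_def)
    show "runs_within (Seq (comp (\<rho>(x := r + 1)) e' (r + 3)) (Seq (Loop (r + 3) (Inc r)) (Inc (r + 1))))
          (layout ((s(r := \<sigma> i, r + 1 := i, r + 2 := n - i))(r + 2 := n - Suc i)) A zeros) ?b
          (layout (s(r := \<sigma> (Suc i), r + 1 := Suc i, r + 2 := n - Suc i)) A zeros)"
      unfolding s' by (rule runs_within_eq[OF runs_within_Seq[OF a runs_within_Seq[OF b runs_Inc]]])
        (use m Sum.prems(4) in \<open>auto simp: s'_def \<sigma>_def m_def\<close>)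
  qed (use Sum.prems(4) in \<open>auto simp: \<sigma>_def\<close>)
  have 3: "runs_within (Loop (r + 1) Nop) (layout (s(r := \<sigma> n, r + 1 := n, r + 2 := n - n)) A zeros)
     (n * (1 + 3) + 1) (layout (s(r := \<sigma> n, r + 1 := n - n, r + 2 := n - n)) A zeros)"
  proof (rule runs_Loop_regs[where S = "\<lambda>k. s(r := \<sigma> n, r + 1 := n - k, r + 2 := n - n)"])
    fix k assume "k < n"
    show "runs_within Nop (layout ((s(r := \<sigma> n, r + 1 := n - k, r + 2 := n - n))(r + 1 := n - Suc k)) A zeros) 1
      (layout (s(r := \<sigma> n, r + 1 := n - Suc k, r + 2 := n - n)) A zeros)"
      by (rule runs_within_eq[OF runs_Nop]) auto
  qed auto
  have "comp_bound e B + (n * (?b + 3) + 1 + (n * (1 + 3) + 1)) \<le> comp_bound (Sum x e e') B"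
    unfolding comp_bound.simps B'_def using n by (intro add_mono mult_right_mono) auto
  then show ?case
    unfolding comp.simps by (intro runs_within_eq[OF runs_within_Seq[OF 1 runs_within_Seq[OF 2 3]]])
      (use Sum.prems(4) in \<open>auto simp: \<sigma>_def n_def\<close>)
next
  case (Sym k a e)
  define n where "n = eval A v e"
  have n: "n \<le> eval_bound e B" unfolding n_def by (rule eval_le_bound) (use Sym.prems in auto)
  have 1: "runs_within (comp \<rho> e (r + 1)) (layout s A zeros) (comp_bound e B) (layout (s(r + 1 := n)) A zeros)"
    unfolding n_def by (rule Sym.IH) (use Sym.prems in \<open>auto intro: less_SucI\<close>)
  have 2: "runs_within (Loop (r + 1) (Seq (Fwd k) (Inc (r + 2)))) (layout (s(r + 1 := n)) A zeros) (n * (1 + 1 + 3) + 1)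
     (layout (s(r + 1 := n - n, r + 2 := n)) A (zeros(k := n)))"
  proof (rule runs_Loop[where S = "\<lambda>i. s(r + 1 := n - i, r + 2 := i)" and A' = "\<lambda>_. A" and H' = "\<lambda>i. zeros(k := i)"])
    fix i assume "i < n"
    show "runs_within (Seq (Fwd k) (Inc (r + 2)))
        (layout ((s(r + 1 := n - i, r + 2 := i))(r + 1 := n - Suc i)) A (zeros(k := i))) (1 + 1)
        (layout (s(r + 1 := n - Suc i, r + 2 := Suc i)) A (zeros(k := Suc i)))"
      by (rule runs_within_eq[OF runs_within_Seq[OF runs_Fwd runs_Inc]]) auto
  qed (use Sym.prems in auto)
  define b where "b = (if A k n = a then 1 else (0::nat))"
  have 3: "runs_within (Cond (arr k) a (Inc r)) (layout (s(r + 1 := n - n, r + 2 := n)) A (zeros(k := n))) (Suc 1)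
     (layout (s(r := b, r + 1 := n - n, r + 2 := n)) A (zeros(k := n)))"
  proof (rule runs_Cond)
    assume "read_tape (layout (s(r + 1 := n - n, r + 2 := n)) A (zeros(k := n)) (arr k)) = a"
    then have "b = 1" by (simp add: read_arr b_def)
    then show "runs_within (Inc r) (layout (s(r + 1 := n - n, r + 2 := n)) A (zeros(k := n))) 1
     (layout (s(r := b, r + 1 := n - n, r + 2 := n)) A (zeros(k := n)))"
      by (intro runs_within_eq[OF runs_Inc]) (use Sym.prems in auto)
  next
    assume "read_tape (layout (s(r + 1 := n - n, r + 2 := n)) A (zeros(k := n)) (arr k)) \<noteq> a"
    then have "b = 0" by (simp add: read_arr b_def)
    with Sym.prems have "s(r := b) = s" by auto
    then show "layout (s(r := b, r + 1 := n - n, r + 2 := n)) A (zeros(k := n))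
      = layout (s(r + 1 := n - n, r + 2 := n)) A (zeros(k := n))"
      by simp
  qed
  have 4: "runs_within (Loop (r + 2) (Bwd k)) (layout (s(r := b, r + 1 := n - n, r + 2 := n)) A (zeros(k := n)))
     (n * (1 + 3) + 1) (layout (s(r := b, r + 1 := n - n, r + 2 := n - n)) A (zeros(k := n - n)))"
  proof (rule runs_Loop[where S = "\<lambda>i. s(r := b, r + 1 := n - n, r + 2 := n - i)" and A' = "\<lambda>_. A" and H' = "\<lambda>i. zeros(k := n - i)"])
    fix i assume "i < n"
    then show "runs_within (Bwd k)
        (layout ((s(r := b, r + 1 := n - n, r + 2 := n - i))(r + 2 := n - Suc i)) A (zeros(k := n - i))) 1
        (layout (s(r := b, r + 1 := n - n, r + 2 := n - Suc i)) A (zeros(k := n - Suc i)))"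
      by (intro runs_within_eq[OF runs_Bwd]) auto
  qed auto
  show ?case
    unfolding comp.simps
    by (rule runs_within_eq[OF runs_within_Seq[OF 1 runs_within_Seq[OF 2 runs_within_Seq[OF 3 4]]]])
      (use n Sym.prems in \<open>auto simp: b_def n_def\<close>)
qed

section \<open>Commands and their compilation\<close>

text \<open>The range of \<open>For\<close> is evaluated once on entry, and there is no unbounded
  loop, so termination within a polynomial bound is built into the syntax. Variables are changed
  only by being bound in a loop.\<close>

datatype cmd = Put nat exp exp | Then cmd cmd | For nat exp cmd

fun exec :: "cmd \<Rightarrow> (nat \<Rightarrow> nat) \<Rightarrow> arrays \<Rightarrow> arrays" where
  "exec (Put k e e') v A = A(k := (A k)(eval A v e := bit_symbol (eval A v e' \<noteq> 0)))"
| "exec (Then c c') v A = exec c' v (exec c v A)"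
| "exec (For x e c) v A = fold (\<lambda>i. exec c (v(x := i))) [0..<eval A v e] A"

text \<open>For \<open>Put\<close>, registers \<open>r\<close> and \<open>r + 1\<close> hold address
  and value, and \<open>r + 2\<close> records the way back. There is no else branch: True is written
  first and overwritten by False if the value is 0.\<close>

fun comp_cmd :: "(nat \<Rightarrow> nat) \<Rightarrow> cmd \<Rightarrow> nat \<Rightarrow> com" where
  "comp_cmd \<rho> (Put k e e') r =
     Seq (comp \<rho> e r) (Seq (comp \<rho> e' (r + 1))
      (Seq (Loop r (Seq (Fwd k) (Inc (r + 2))))
      (Seq (Mark k True)
      (Seq (Cond (reg (r + 1)) 1 (Mark k False))
      (Seq (Loop (r + 2) (Bwd k)) (Loop (r + 1) Nop))))))"
| "comp_cmd \<rho> (Then c c') r = Seq (comp_cmd \<rho> c r) (comp_cmd \<rho> c' r)"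
| "comp_cmd \<rho> (For x e c) r =
     Seq (comp \<rho> e (r + 1)) (Seq (Loop (r + 1) (Seq (comp_cmd (\<rho>(x := r)) c (r + 2)) (Inc r))) (Loop r Nop))"

fun cmd_bound :: "cmd \<Rightarrow> nat \<Rightarrow> nat" where
  "cmd_bound (Put k e e') B =
     comp_bound e B + (comp_bound e' B + ((eval_bound e B * (1 + 1 + 3) + 1) + (1 + (Suc 1
       + ((eval_bound e B * (1 + 3) + 1) + (eval_bound e' B * (1 + 3) + 1))))))"
| "cmd_bound (Then c c') B = cmd_bound c B + cmd_bound c' B"
| "cmd_bound (For x e c) B =
     comp_bound e B + ((eval_bound e B * (cmd_bound c (B + eval_bound e B) + 1 + 3) + 1)
       + (eval_bound e B * (1 + 3) + 1))"

lemma poly_bounded_cmd_bound: "poly_bounded (cmd_bound c)"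
proof (induction c)
  case (For x e c)
  have "poly_bounded (\<lambda>B. cmd_bound c (B + eval_bound e B))"
    by (rule poly_bounded_comp[OF For]) (intro poly_bounded_intros poly_bounded_eval_bound)
  then have "poly_bounded (\<lambda>B. cmd_bound (For x e c) B)"
    unfolding cmd_bound.simps
    by (intro poly_bounded_intros poly_bounded_eval_bound poly_bounded_comp_bound)
  then show ?case by simp
qed (auto intro!: poly_bounded_intros poly_bounded_eval_bound poly_bounded_comp_bound)

lemma runs_clear:
  "s r = n \<Longrightarrow> runs_within (Loop r Nop) (layout s A H) (n * (1 + 3) + 1) (layout (s(r := 0)) A H)"
  by (rule runs_within_eq[OF runs_Loop_regs[where S = "\<lambda>i. s(r := n - i)"]])
    (auto intro!: runs_within_eq[OF runs_Nop])

lemma runs_forward: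
  assumes "s p = n" "s q = 0" "H k = 0" "p \<noteq> q"
  shows "runs_within (Loop p (Seq (Fwd k) (Inc q))) (layout s A H) (n * (1 + 1 + 3) + 1)
    (layout (s(p := 0, q := n)) A (H(k := n)))"
  by (rule runs_within_eq[OF runs_Loop[where S = "\<lambda>i. s(p := n - i, q := i)" and A' = "\<lambda>_. A"
        and H' = "\<lambda>i. H(k := i)"]])
    (use assms in \<open>auto intro!: runs_within_eq[OF runs_within_Seq[OF runs_Fwd runs_Inc]]\<close>)

lemma runs_backward:
  assumes "s p = n" "H k = n"
  shows "runs_within (Loop p (Bwd k)) (layout s A H) (n * (1 + 3) + 1)
    (layout (s(p := 0)) A (H(k := 0)))"
  by (rule runs_within_eq[OF runs_Loop[where S = "\<lambda>i. s(p := n - i)" and A' = "\<lambda>_. A"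
        and H' = "\<lambda>i. H(k := n - i)"]])
    (use assms in \<open>auto intro!: runs_within_eq[OF runs_Bwd]\<close>)

lemma runs_comp_cmd:
  assumes "\<And>y. \<rho> y < r" "\<And>y. s (\<rho> y) = v y" "\<And>y. v y \<le> B" "\<And>j. r \<le> j \<Longrightarrow> s j = 0"
  shows "runs_within (comp_cmd \<rho> c r) (layout s A zeros) (cmd_bound c B)
    (layout s (exec c v A) zeros)"
  using assms
proof (induction c arbitrary: \<rho> r s v A B)
  case (Put k e e')
  define m n where "m = eval A v e" and "n = eval A v e'"
  have mn: "m \<le> eval_bound e B" "n \<le> eval_bound e' B"
    unfolding m_def n_def by (rule eval_le_bound, use Put.prems in auto)+
  let ?s = "s(r := 0, r + 1 := n, r + 2 := m)" and ?H = "zeros(k := m)"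
  let ?A = "A(k := (A k)(m := bit_symbol True))"
  have 1: "runs_within (comp \<rho> e r) (layout s A zeros) (comp_bound e B) (layout (s(r := m)) A zeros)"
    unfolding m_def by (rule runs_comp) (use Put.prems in auto)
  have 2: "runs_within (comp \<rho> e' (r + 1)) (layout (s(r := m)) A zeros) (comp_bound e' B)
      (layout (s(r := m, r + 1 := n)) A zeros)"
    unfolding n_def by (rule runs_comp) (use Put.prems in \<open>auto simp: less_SucI dest: less_imp_neq\<close>)
  have 3: "runs_within (Loop r (Seq (Fwd k) (Inc (r + 2)))) (layout (s(r := m, r + 1 := n)) A zeros)
    (m * (1 + 1 + 3) + 1) (layout ?s A ?H)"
    by (rule runs_within_eq[OF runs_forward]) (use Put.prems in auto)
  have 4: "runs_within (Mark k True) (layout ?s A ?H) 1 (layout ?s ?A ?H)"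
    by (rule runs_within_eq[OF runs_Mark]) auto
  have 5: "runs_within (Cond (reg (r + 1)) 1 (Mark k False)) (layout ?s ?A ?H) (Suc 1)
    (layout ?s (exec (Put k e e') v A) ?H)"
  proof (rule runs_Cond)
    assume "read_tape (layout ?s ?A ?H (reg (r + 1))) = 1"
    then have "n = 0" by (auto simp: read_reg split: if_splits)
    then show "runs_within (Mark k False) (layout ?s ?A ?H) 1 (layout ?s (exec (Put k e e') v A) ?H)"
      by (intro runs_within_eq[OF runs_Mark]) (auto simp: n_def m_def)
  next
    assume "read_tape (layout ?s ?A ?H (reg (r + 1))) \<noteq> 1"
    then have "n \<noteq> 0" by (auto simp: read_reg split: if_splits)
    then show "layout ?s (exec (Put k e e') v A) ?H = layout ?s ?A ?H"
      by (simp add: m_def n_def)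
  qed
  have 6: "runs_within (Loop (r + 2) (Bwd k)) (layout ?s (exec (Put k e e') v A) ?H) (m * (1 + 3) + 1)
    (layout (s(r + 1 := n)) (exec (Put k e e') v A) zeros)"
    by (rule runs_within_eq[OF runs_backward]) (use Put.prems(4) in auto)
  have 7: "runs_within (Loop (r + 1) Nop) (layout (s(r + 1 := n)) (exec (Put k e e') v A) zeros)
     (n * (1 + 3) + 1) (layout s (exec (Put k e e') v A) zeros)"
    by (rule runs_within_eq[OF runs_clear]) (use Put.prems(4) in auto)
  show ?case
    unfolding comp_cmd.simps
    by (rule runs_within_eq[OF runs_within_Seq[OF 1 runs_within_Seq[OF 2 runs_within_Seq[OF 3
          runs_within_Seq[OF 4 runs_within_Seq[OF 5 runs_within_Seq[OF 6 7]]]]]]])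
      (use mn in auto)
next
  case (Then c c')
  show ?case
    unfolding comp_cmd.simps cmd_bound.simps exec.simps
    by (rule runs_within_Seq[OF Then.IH]) (use Then.prems in auto)
next
  case (For x e c)
  define n where "n = eval A v e"
  define B' where "B' = B + eval_bound e B"
  define A' where "A' i = fold (\<lambda>i. exec c (v(x := i))) [0..<i] A" for i
  have n: "n \<le> eval_bound e B"
    unfolding n_def by (rule eval_le_bound) (use For.prems in auto)
  have 1: "runs_within (comp \<rho> e (r + 1)) (layout s A zeros) (comp_bound e B) (layout (s(r + 1 := n)) A zeros)"
    unfolding n_def by (rule runs_comp) (use For.prems in \<open>auto intro: less_SucI\<close>)
  have 2: "runs_within (Loop (r + 1) (Seq (comp_cmd (\<rho>(x := r)) c (r + 2)) (Inc r)))
     (layout (s(r + 1 := n)) A zeros) (n * (cmd_bound c B' + 1 + 3) + 1)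
     (layout (s(r := n, r + 1 := n - n)) (A' n) zeros)"
  proof (rule runs_Loop[where S = "\<lambda>i. s(r := i, r + 1 := n - i)" and A' = A' and H' = "\<lambda>_ _. 0"])
    fix i assume i: "i < n"
    define s' where "s' = s(r := i, r + 1 := n - Suc i)"
    have s': "(s(r := i, r + 1 := n - i))(r + 1 := n - Suc i) = s'"
      by (simp add: s'_def)
    have "runs_within (comp_cmd (\<rho>(x := r)) c (r + 2)) (layout s' (A' i) zeros) (cmd_bound c B')
      (layout s' (exec c (v(x := i)) (A' i)) zeros)"
    proof (rule For.IH)
      show "(\<rho>(x := r)) y < r + 2" for y
        using For.prems(1)[of y] by auto
      show "s' ((\<rho>(x := r)) y) = (v(x := i)) y" for y
        using For.prems(1)[of y] For.prems(2)[of y] by (auto simp: s'_def)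
      show "(v(x := i)) y \<le> B'" for y
        using i n For.prems(3)[of y] by (auto simp: B'_def)
      show "s' j = 0" if "r + 2 \<le> j" for j
        using that For.prems(4)[of j] by (auto simp: s'_def)
    qed
    from runs_within_Seq[OF this runs_Inc]
    show "runs_within (Seq (comp_cmd (\<rho>(x := r)) c (r + 2)) (Inc r))
       (layout ((s(r := i, r + 1 := n - i))(r + 1 := n - Suc i)) (A' i) zeros) (cmd_bound c B' + 1)
       (layout (s(r := Suc i, r + 1 := n - Suc i)) (A' (Suc i)) zeros)"
      unfolding s' by (rule runs_within_eq) (auto simp: s'_def A'_def)
  qed (use For.prems(4) in \<open>auto simp: A'_def\<close>)
  have 3: "runs_within (Loop r Nop) (layout (s(r := n, r + 1 := n - n)) (A' n) zeros) (n * (1 + 3) + 1)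
    (layout s (A' n) zeros)"
    by (rule runs_within_eq[OF runs_clear]) (use For.prems(4) in auto)
  have "comp_bound e B + (n * (cmd_bound c B' + 1 + 3) + 1 + (n * (1 + 3) + 1)) \<le> cmd_bound (For x e c) B"
    unfolding cmd_bound.simps B'_def using n by (intro add_mono mult_right_mono) auto
  then show ?case
    unfolding comp_cmd.simps
    by (intro runs_within_eq[OF runs_within_Seq[OF 1 runs_within_Seq[OF 2 3]]]) (auto simp: A'_def n_def)
qed

section \<open>Initialisation and the complete machine\<close>

text \<open>All work tapes start blank, which suits arrays, but a register needs symbol 1, the
  encoding of False, in its cell 0.\<close>

fun mark_regs :: "nat \<Rightarrow> com" where
  "mark_regs 0 = Nop"
| "mark_regs (Suc n) = Seq (mark_regs n) (Op (reg n) (Some False) Stay)"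

text \<open>The input contains no blank, so the first blank marks its end. The count is used up to
  bring the head back and is rebuilt through register 1, which ends at 0.\<close>

definition count_input :: com where
  "count_input = Seq (While (arr 0) 0 (Seq (Fwd 0) (Inc 0)))
     (Seq (Loop 0 (Seq (Bwd 0) (Inc 1))) (Loop 1 (Inc 0)))"

definition input_arrays :: "bool list \<Rightarrow> arrays" where
  "input_arrays w k a = (if k = 0 \<and> a < length w then bit_symbol (w ! a) else 0)"

text \<open>Registers from \<open>K\<close> on are taken as marked from the outset; \<open>K\<close>
  will be so large that the machine has no such tapes.\<close>

definition unmarked :: "bool list \<Rightarrow> nat \<Rightarrow> nat \<Rightarrow> tapes" where
  "unmarked w n K = (\<lambda>k. if \<exists>i. n \<le> i \<and> i < K \<and> k = reg i then blank_tape
     else layout zeros (input_arrays w) zeros k)"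

lemma runs_mark_regs:
  "n \<le> K \<Longrightarrow> runs_within (mark_regs n) (unmarked w 0 K) (n + 1) (unmarked w n K)"
proof (induction n)
  case 0
  show ?case using runs_Nop by simp
next
  case (Suc n)
  have "unmarked w (Suc n) K = (unmarked w n K)(reg n := op_tape (Some False) Stay (unmarked w n K (reg n)))"
    using Suc.prems
    by (auto simp: unmarked_def fun_eq_iff op_tape_def blank_tape_def layout_reg_apply Suc_le_eq le_less)
  then have "runs (Op (reg n) (Some False) Stay) (unmarked w n K) 1 (unmarked w (Suc n) K)"
    by (rule runs_Op')
  then have "runs_within (Op (reg n) (Some False) Stay) (unmarked w n K) 1 (unmarked w (Suc n) K)"
    unfolding runs_within_def by blast
  from runs_within_Seq[OF Suc.IH this] Suc.prems show ?case by simp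
qed

lemma bit_symbol_neq_0: "bit_symbol b \<noteq> 0"
  by (cases b) auto

lemma runs_scan:
  assumes "i + d = length w"
  shows "runs_within (While (arr 0) 0 (Seq (Fwd 0) (Inc 0)))
     (layout (zeros(0 := i)) (input_arrays w) (zeros(0 := i))) (d * 4 + 1)
     (layout (zeros(0 := length w)) (input_arrays w) (zeros(0 := length w)))"
  using assms
proof (induction d arbitrary: i)
  case 0
  then show ?case
    unfolding runs_within_def
    using runs_While_stop[of "layout (zeros(0 := i)) (input_arrays w) (zeros(0 := i))" "arr 0" 0]
    by (intro exI[of _ 1]) (auto simp: read_arr input_arrays_def)
next
  case (Suc d)
  let ?T = "\<lambda>i. layout (zeros(0 := i)) (input_arrays w) (zeros(0 := i))"
  have "runs_within (While (arr 0) 0 (Seq (Fwd 0) (Inc 0))) (?T (Suc i)) (d * 4 + 1) (?T (length w))"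
    by (rule Suc.IH) (use Suc.prems in simp)
  then obtain t' where t': "t' \<le> d * 4 + 1"
    "runs (While (arr 0) 0 (Seq (Fwd 0) (Inc 0))) (?T (Suc i)) t' (?T (length w))"
    unfolding runs_within_def by auto
  have "runs_within (Seq (Fwd 0) (Inc 0)) (?T i) (1 + 1) (?T (Suc i))"
    by (rule runs_within_eq[OF runs_within_Seq[OF runs_Fwd runs_Inc]]) auto
  then obtain t where t: "t \<le> 1 + 1" "runs (Seq (Fwd 0) (Inc 0)) (?T i) t (?T (Suc i))"
    unfolding runs_within_def by blast
  have "read_tape (?T i (arr 0)) \<noteq> 0"
    using Suc.prems by (simp add: read_arr input_arrays_def bit_symbol_neq_0)
  from runs_While_step[of _ _ 0, OF this t(2) t'(2)] t(1) t'(1) show ?case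
    unfolding runs_within_def by (intro exI[of _ "Suc (t + Suc t')"]) auto
qed

lemma runs_count_input:
  fixes w :: "bool list"
  defines "A \<equiv> input_arrays w" and "n \<equiv> length w"
  shows "runs_within count_input (layout zeros A zeros)
    (n * 4 + 1 + (n * (1 + 1 + 3) + 1 + (n * (1 + 3) + 1)))
    (layout (zeros(0 := n)) A zeros)"
proof -
  have 1: "runs_within (While (arr 0) 0 (Seq (Fwd 0) (Inc 0))) (layout zeros A zeros) (n * 4 + 1)
     (layout (zeros(0 := n)) A (zeros(0 := n)))"
    using runs_scan[of 0 n w] unfolding A_def n_def by (simp add: fun_upd_idem)
  have 2: "runs_within (Loop 0 (Seq (Bwd 0) (Inc 1))) (layout (zeros(0 := n)) A (zeros(0 := n)))
     (n * (1 + 1 + 3) + 1) (layout (zeros(1 := n)) A zeros)"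
    by (rule runs_within_eq[OF runs_Loop[where S = "\<lambda>i. zeros(0 := n - i, 1 := i)" and A' = "\<lambda>_. A"
        and H' = "\<lambda>i. zeros(0 := n - i)"]])
      (auto intro!: runs_within_eq[OF runs_within_Seq[OF runs_Bwd runs_Inc]])
  have 3: "runs_within (Loop 1 (Inc 0)) (layout (zeros(1 := n)) A zeros)
     (n * (1 + 3) + 1) (layout (zeros(0 := n)) A zeros)"
    by (rule runs_within_eq[OF runs_Loop_regs[where S = "\<lambda>i. zeros(0 := i, 1 := n - i)"]])
      (auto intro!: runs_within_eq[OF runs_Inc])
  show ?thesis
    unfolding count_input_def by (rule runs_within_Seq[OF 1 runs_within_Seq[OF 2 3]])
qed

definition result :: "cmd \<Rightarrow> exp \<Rightarrow> bool list \<Rightarrow> nat" where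
  "result c e w =
     (let v = zeros(0 := length w) in eval (exec c v (input_arrays w)) v e)"

lemma tape_bound_mark_regs: "tape_bound (mark_regs n) \<le> max 1 (2 * n)"
  by (induction n) (auto simp: Nop_def reg_def)

lemma arr_pos: "0 < arr i \<Longrightarrow> 0 < i"
  by (simp add: arr_def)

lemma less_reg: "reg i < 2 * n \<Longrightarrow> i < n"
  by (simp add: reg_def)

theorem poly_time_decidable_result:
  assumes "\<And>x. x \<in> I \<Longrightarrow> P x \<longleftrightarrow> result c e (enc x) \<noteq> 0"
  shows "poly_time_decidable enc I P"
proof -
  \<comment> \<open>Register 0 holds the input length. All other variables share register 1, which
    holds 0, until a loop or a sum binds them to a fresh register.\<close>
  define \<rho> :: "nat \<Rightarrow> nat" where "\<rho> = (\<lambda>_. 1)(0 := 0)"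
  define body where "body = Seq count_input (Seq (comp_cmd \<rho> c 2) (comp \<rho> e 2))"
  \<comment> \<open>This makes 2 K exceed the number of every tape used, including
    \<open>reg 2\<close> = 5, whose register receives the result.\<close>
  define K where "K = tape_bound body + 3"
  define prog where "prog = Seq (mark_regs K) body"
  define bound where "bound n = (K + 1) + ((n * 4 + 1 + (n * (1 + 1 + 3) + 1 + (n * (1 + 3) + 1)))
     + (cmd_bound c n + comp_bound e n)) + 2" for n
  have "poly_bounded bound"
    unfolding bound_def by (intro poly_bounded_intros poly_bounded_cmd_bound poly_bounded_comp_bound)
  then obtain k where k: "\<And>n. bound n \<le> (n + 2) ^ k"
    unfolding poly_bounded_def by blast
  define p :: "nat poly" where "p = [:2, 1:] ^ k"
  have p: "poly p n = (n + 2) ^ k" for n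
    by (simp add: p_def poly_power add.commute)
  have run: "fst ((tm_step (com_tm prog (reg 2)) ^^ poly p (length w)) (init_config (com_tm prog (reg 2)) w))
     = (if result c e w = 0 then 2 else 1)" for w
  proof -
    define v :: "nat \<Rightarrow> nat" where "v = (\<lambda>_. 0)(0 := length w)"
    define A where "A = exec c v (input_arrays w)"
    let ?n = "length w"
    have 1: "runs_within (mark_regs K) (unmarked w 0 K) (K + 1) (layout (\<lambda>_. 0) (input_arrays w) (\<lambda>_. 0))"
    proof -
      have "unmarked w K K = layout (\<lambda>_. 0) (input_arrays w) (\<lambda>_. 0)"
        unfolding unmarked_def by (rule ext) (metis leD)
      then show ?thesis
        using runs_mark_regs[of K K w] by simp
    qed
    have 2: "runs_within (comp_cmd \<rho> c 2) (layout v (input_arrays w) (\<lambda>_. 0)) (cmd_bound c ?n)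
        (layout v A (\<lambda>_. 0))"
      unfolding A_def by (rule runs_comp_cmd) (auto simp: \<rho>_def v_def)
    have 3: "runs_within (comp \<rho> e 2) (layout v A (\<lambda>_. 0)) (comp_bound e ?n)
        (layout (v(2 := eval A v e)) A (\<lambda>_. 0))"
      by (rule runs_comp) (auto simp: \<rho>_def v_def)
    have "runs_within prog (unmarked w 0 K) (bound ?n - 2) (layout (v(2 := eval A v e)) A (\<lambda>_. 0))"
      unfolding prog_def body_def bound_def
      using runs_within_Seq[OF 1 runs_within_Seq[OF runs_count_input[of w, folded v_def]
            runs_within_Seq[OF 2 3]]]
      by simp
    then obtain t where t: "t \<le> bound ?n - 2" "runs prog (unmarked w 0 K) t (layout (v(2 := eval A v e)) A (\<lambda>_. 0))"
      unfolding runs_within_def by auto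
    have "fst ((tm_step (com_tm prog (reg 2)) ^^ poly p (length w)) (init_config (com_tm prog (reg 2)) w))
      = (if read_tape (layout (v(2 := eval A v e)) A (\<lambda>_. 0) (reg 2)) = 1 then 2 else 1)"
    proof (rule runs_com_tm[OF t(2)])
      have "2 \<le> bound ?n" by (simp add: bound_def)
      then show "t + 2 \<le> poly p (length w)"
        using t(1) k[of ?n] unfolding p by linarith
      show "unmarked w 0 K 0 = input_tape w"
        by (auto simp: unmarked_def reg_def input_tape_def layout_def input_arrays_def fun_eq_iff)
    next
      fix m assume m: "0 < m" "m < max (Suc (reg 2)) (tape_bound prog)"
      have "tape_bound (mark_regs K) \<le> 2 * K" "tape_bound body \<le> 2 * K" "Suc (reg 2) \<le> 2 * K"
        using tape_bound_mark_regs[of K] by (auto simp: K_def reg_def)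
      then have "m < 2 * K"
        using m(2) by (auto simp: prog_def)
      then show "unmarked w 0 K m = blank_tape"
      proof (cases m rule: tape_cases)
        case (reg i)
        then show ?thesis
          using \<open>m < 2 * K\<close> less_reg by (auto simp: unmarked_def)
      next
        case (arr i)
        then have "input_arrays w i a = 0" for a
          using m(1) arr_pos[of i] by (simp add: input_arrays_def)
        then show ?thesis
          by (simp add: arr unmarked_def layout_arr_apply blank_tape_def cong: if_cong)
      qed
    qed
    moreover have "result c e w = eval A v e"
      by (simp add: result_def Let_def A_def v_def)
    ultimately show ?thesis
      by (simp add: read_reg)
  qed
  show ?thesis
    unfolding poly_time_decidable_def
    by (rule exI[of _ "com_tm prog (reg 2)"], rule exI[of _ p])
      (use wf_com_tm run assms in \<open>auto simp: Let_def accepts_within_def rejects_within_def\<close>)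
qed

section \<open>Derived expressions\<close>

text \<open>A number above all variables that occur, bound or free. Nested constructs can thus
  choose bound variables without capture.\<close>

fun fresh :: "exp \<Rightarrow> nat" where
  "fresh (Cst n) = 0"
| "fresh (Var x) = Suc x"
| "fresh (Add e e') = max (fresh e) (fresh e')"
| "fresh (Sub e e') = max (fresh e) (fresh e')"
| "fresh (Sum x e e') = max (Suc x) (max (fresh e) (fresh e'))"
| "fresh (Sym k a e) = fresh e"

lemma eval_fresh [simp]: "fresh e \<le> x \<Longrightarrow> eval A (v(x := i)) e = eval A v e"
proof (induction e arbitrary: v)
  case (Sum y e e')
  have "eval A ((v(x := i))(y := j)) e' = eval A (v(y := j)) e'" for j
  proof -
    have "(v(x := i))(y := j) = (v(y := j))(x := i)"
      using Sum.prems by (auto simp: fun_upd_twist)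
    then show ?thesis
      using Sum.IH(2)[of "v(y := j)"] Sum.prems by (simp del: fun_upd_apply)
  qed
  then show ?case
    using Sum.IH(1)[of v] Sum.prems by (simp del: fun_upd_apply)
qed auto

text \<open>A product is a sum of equal terms; the bound variable only has to be fresh for the
  summand. Nonzero values count as true in all the connectives that follow.\<close>

definition Mul :: "exp \<Rightarrow> exp \<Rightarrow> exp" where "Mul e e' = Sum (fresh e') e e'"
definition Not_exp :: "exp \<Rightarrow> exp" where "Not_exp e = Sub (Cst 1) e"
definition Disj :: "exp \<Rightarrow> exp \<Rightarrow> exp" where "Disj e e' = Not_exp (Not_exp (Add e e'))"
definition Conj :: "exp \<Rightarrow> exp \<Rightarrow> exp" where "Conj e e' = Not_exp (Disj (Not_exp e) (Not_exp e'))"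
definition Le :: "exp \<Rightarrow> exp \<Rightarrow> exp" where "Le e e' = Not_exp (Sub e e')"
definition Eq :: "exp \<Rightarrow> exp \<Rightarrow> exp" where "Eq e e' = Conj (Le e e') (Le e' e)"
definition Ite :: "exp \<Rightarrow> exp \<Rightarrow> exp \<Rightarrow> exp" where
  "Ite e e1 e2 = Add (Mul (Not_exp (Not_exp e)) e1) (Mul (Not_exp e) e2)"
definition Exists :: "nat \<Rightarrow> exp \<Rightarrow> exp \<Rightarrow> exp" where "Exists x e e' = Not_exp (Not_exp (Sum x e e'))"
definition Forall :: "nat \<Rightarrow> exp \<Rightarrow> exp \<Rightarrow> exp" where "Forall x e e' = Not_exp (Sum x e (Not_exp e'))"
text \<open>The least solution equals the number of i below the limit for which no j \<le> i is a
  solution; if there is none, every i is counted and the limit results, as for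
  \<open>least_below\<close>.\<close>

definition Mu :: "nat \<Rightarrow> exp \<Rightarrow> exp \<Rightarrow> exp" where
  "Mu x e e' = (let y = max (Suc x) (fresh e')
     in Sum y e (Not_exp (Exists x (Add (Var y) (Cst 1)) e')))"
text \<open>The least r with q e' + r = e for some q \<le> e. For e' = 0 this is e, in agreement
  with \<open>mod\<close>.\<close>

definition Mod_exp :: "exp \<Rightarrow> exp \<Rightarrow> exp" where
  "Mod_exp e e' = (let x = max (fresh e) (fresh e'); b = Add e (Cst 1)
     in Mu x b (Exists (Suc x) b (Eq (Add (Mul (Var (Suc x)) e') (Var x)) e)))"

lemma eval_Mul [simp]: "eval A v (Mul e e') = eval A v e * eval A v e'"
  by (simp add: Mul_def)

lemma eval_Not_exp [simp]: "eval A v (Not_exp e) = of_bool (eval A v e = 0)"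
  by (simp add: Not_exp_def)

lemma eval_Disj [simp]: "eval A v (Disj e e') = of_bool (eval A v e \<noteq> 0 \<or> eval A v e' \<noteq> 0)"
  by (simp add: Disj_def)

lemma eval_Conj [simp]: "eval A v (Conj e e') = of_bool (eval A v e \<noteq> 0 \<and> eval A v e' \<noteq> 0)"
  by (simp add: Conj_def)

lemma eval_Le [simp]: "eval A v (Le e e') = of_bool (eval A v e \<le> eval A v e')"
  by (simp add: Le_def)

lemma eval_Eq [simp]: "eval A v (Eq e e') = of_bool (eval A v e = eval A v e')"
  by (auto simp: Eq_def)

lemma eval_Ite [simp]:
  "eval A v (Ite e e1 e2) = (if eval A v e \<noteq> 0 then eval A v e1 else eval A v e2)"
  by (simp add: Ite_def)

lemma eval_Exists [simp]:
  "eval A v (Exists x e e') = of_bool (\<exists>i<eval A v e. eval A (v(x := i)) e' \<noteq> 0)"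
  by (auto simp: Exists_def)

lemma eval_Forall [simp]:
  "eval A v (Forall x e e') = of_bool (\<forall>i<eval A v e. eval A (v(x := i)) e' \<noteq> 0)"
  by (auto simp: Forall_def)

lemma eval_Mu [simp]:
  "eval A v (Mu x e e') = least_below (eval A v e) (\<lambda>i. eval A (v(x := i)) e' \<noteq> 0)"
proof -
  define n m where "n = eval A v e"
    and "m = least_below (eval A v e) (\<lambda>i. eval A (v(x := i)) e' \<noteq> 0)"
  define y where "y = max (Suc x) (fresh e')"
  have y: "eval A (v(y := i, x := j)) e' = eval A (v(x := j)) e'" for i j
  proof -
    have "v(y := i, x := j) = (v(x := j))(y := i)"
      by (rule fun_upd_twist) (simp add: y_def)
    then show ?thesis by (simp add: y_def)
  qed
  have "eval A v (Mu x e e') = (\<Sum>i<n. of_bool (\<forall>j\<le>i. eval A (v(x := j)) e' = 0))"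
    by (auto simp: Mu_def Let_def n_def y[unfolded y_def] y_def[symmetric] y less_Suc_eq_le intro!: sum.cong)
  also have "\<dots> = (\<Sum>i<n. of_bool (i < m))"
  proof (intro sum.cong refl arg_cong[of _ _ of_bool])
    fix i assume "i \<in> {..<n}"
    then have i: "i < n" by simp
    let ?P = "\<lambda>i. eval A (v(x := i)) e' \<noteq> 0"
    have m: "m = least_below n ?P" by (simp only: m_def n_def)
    show "(\<forall>j\<le>i. eval A (v(x := j)) e' = 0) \<longleftrightarrow> i < m"
    proof
      assume *: "\<forall>j\<le>i. eval A (v(x := j)) e' = 0"
      show "i < m"
      proof (rule ccontr)
        assume "\<not> i < m"
        then have "?P m"
          using least_below_prop[of n ?P] i unfolding m by simp
        with * \<open>\<not> i < m\<close> show False by simp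
      qed
    next
      assume "i < m"
      then show "\<forall>j\<le>i. eval A (v(x := j)) e' = 0"
        using not_less_least_below[of _ n ?P] unfolding m by auto
    qed
  qed
  also have "\<dots> = card ({..<n} \<inter> {..<m})"
    by (simp add: sum.If_cases of_bool_def lessThan_def Int_def del: sum_of_bool_eq)
  also have "\<dots> = m"
    using least_below_le[of n] unfolding m_def n_def by (simp add: Int_absorb1)
  finally show ?thesis
    by (simp add: m_def)
qed

lemma eval_Mod_exp [simp]: "eval A v (Mod_exp e e') = eval A v e mod eval A v e'"
proof -
  let ?m = "eval A v e" and ?n = "eval A v e'"
  have "eval A v (Mod_exp e e') = least_below (Suc ?m) (\<lambda>r. \<exists>q<Suc ?m. q * ?n + r = ?m)"
    by (auto simp: Mod_exp_def Let_def)
  also have "\<dots> = ?m mod ?n"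
  proof (rule least_below_eqI)
    show "?m mod ?n < Suc ?m" by (simp add: le_imp_less_Suc)
    show "\<exists>q<Suc ?m. q * ?n + ?m mod ?n = ?m"
      by (rule exI[of _ "?m div ?n"]) (simp add: le_imp_less_Suc)
    show "\<not> (\<exists>q<Suc ?m. q * ?n + j = ?m)" if "j < ?m mod ?n" for j
    proof
      assume "\<exists>q<Suc ?m. q * ?n + j = ?m"
      then obtain q where q: "q * ?n + j = ?m" by auto
      then have "?m mod ?n = j mod ?n"
        by (metis mod_mult_self3)
      also have "\<dots> \<le> j" by simp
      finally show False using that by simp
    qed
  qed
  finally show ?thesis .
qed

section \<open>Tables as sets of marks\<close>

text \<open>Injective because the value lies between (a+b)^2 and (a+b+1)^2, the latter excluded.
  Surjectivity is given up in exchange for a formula without division.\<close>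

definition pair :: "nat \<Rightarrow> nat \<Rightarrow> nat" where "pair a b = (a + b) * (a + b) + a"

lemma pair_eq_iff [simp]: "pair a b = pair c d \<longleftrightarrow> a = c \<and> b = d"
proof
  assume eq: "pair a b = pair c d"
  have less: "pair a b < pair c d" if "a + b < c + d" for a b c d
  proof -
    have "pair a b < Suc (a + b) * Suc (a + b)"
      by (simp add: pair_def)
    also have "\<dots> \<le> (c + d) * (c + d)"
      using that by (intro mult_le_mono) auto
    finally show ?thesis by (simp add: pair_def)
  qed
  have "a + b = c + d"
    using less[of a b c d] less[of c d a b] eq by (metis linorder_neqE_nat less_irrefl)
  with eq show "a = c \<and> b = d" by (simp add: pair_def)
qed simp

definition Pair_exp :: "exp \<Rightarrow> exp \<Rightarrow> exp" where
  "Pair_exp e e' = Add (Mul (Add e e') (Add e e')) e"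

lemma eval_Pair_exp [simp]: "eval A v (Pair_exp e e') = pair (eval A v e) (eval A v e')"
  by (simp add: Pair_exp_def pair_def)

abbreviation Bit :: "nat \<Rightarrow> exp \<Rightarrow> exp" where "Bit k \<equiv> Sym k 2"

(* The values of a function are stored in one-hot form. *)
definition Lookup :: "nat \<Rightarrow> exp \<Rightarrow> exp \<Rightarrow> exp" where
  "Lookup k b e = (let x = fresh e in Mu x b (Bit k (Pair_exp e (Var x))))"

text \<open>A key without a mark gives \<open>b\<close>, and marks at values from \<open>b\<close>
  on are not seen.\<close>

definition get :: "arrays \<Rightarrow> nat \<Rightarrow> nat \<Rightarrow> nat \<Rightarrow> nat" where
  "get A k b a = least_below b (\<lambda>x. A k (pair a x) = 2)"

lemma eval_Lookup [simp]: "eval A v (Lookup k b e) = get A k (eval A v b) (eval A v e)"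
  by (simp add: Lookup_def get_def Let_def)

definition Store :: "nat \<Rightarrow> exp \<Rightarrow> exp \<Rightarrow> cmd" where
  "Store k a e = Put k (Pair_exp a e) (Cst 1)"

text \<open>The table is described by the exact set of its marks and everything else by reference to
  the initial \<open>A\<close>; a loop invariant is then just a family of sets indexed by the loop
  variable.\<close>

definition stores :: "arrays \<Rightarrow> nat \<Rightarrow> (nat \<times> nat) set \<Rightarrow> arrays \<Rightarrow> bool" where
  "stores A k S A' \<longleftrightarrow> (\<forall>a x. A' k (pair a x) = 2 \<longleftrightarrow> (a, x) \<in> S) \<and> (\<forall>l. l \<noteq> k \<longrightarrow> A' l = A l)"

lemma stores_Store:
  assumes "stores A k S A'" "eval A' v a = a'" "eval A' v e = e'" "insert (a', e') S = S'"
  shows "stores A k S' (exec (Store k a e) v A')"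
  using assms by (auto simp: stores_def Store_def)

lemma stores_For:
  assumes "stores A k (T 0) A'" "eval A' v e = n"
    and "\<And>i B. i < n \<Longrightarrow> stores A k (T i) B \<Longrightarrow> stores A k (T (Suc i)) (exec c (v(x := i)) B)"
  shows "stores A k (T n) (exec (For x e c) v A')"
proof -
  have "stores A k (T i) (fold (\<lambda>i. exec c (v(x := i))) [0..<i] A')" if "i \<le> n" for i
    using that
  proof (induction i)
    case (Suc i)
    then show ?case using assms(3)[of i] by (simp del: fun_upd_apply)
  qed (use assms(1) in simp)
  then show ?thesis using assms(2) by simp
qed

lemma get_eq_if_stores:
  assumes "stores A k S A'" "(a, x) \<in> S" "x < b" "\<And>y. (a, y) \<in> S \<Longrightarrow> y = x"
  shows "get A' k b a = x"
  unfolding get_def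
proof (rule least_below_eqI)
  show "x < b" by (rule assms(3))
  show "A' k (pair a x) = 2" using assms(1,2) by (simp add: stores_def)
  show "A' k (pair a j) \<noteq> 2" if "j < x" for j
    using that assms(1) assms(4)[of j] by (auto simp: stores_def)
qed

fun Pow :: "exp \<Rightarrow> nat \<Rightarrow> exp" where
  "Pow e 0 = Cst 1"
| "Pow e (Suc k) = Mul e (Pow e k)"

lemma eval_Pow [simp]: "eval A v (Pow e k) = eval A v e ^ k"
  by (induction k) auto

section \<open>The decision procedure\<close>

text \<open>Variable 0 holds the input length throughout. Array 0 is the input; arrays 1 to 4 hold
  the entry positions, the residues of numbers, the condensed matrices and the walks. A modulus is
  represented by its predecessor.\<close>

definition Len :: exp where "Len = Var 0"
definition Input :: "exp \<Rightarrow> exp" where "Input s = Sym 0 2 s"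

definition Prime_bound :: exp where "Prime_bound = Pow (Add Len (Cst 2)) 12"
text \<open>Tabulated residues can equal the modulus, which is at most \<open>Prime_bound\<close>; a
  lookup needs a strict bound, hence the 1.\<close>

definition Value_bound :: exp where "Value_bound = Add Prime_bound (Cst 1)"

definition Nat_end :: "exp \<Rightarrow> exp" where
  "Nat_end s = (let x = Suc (fresh s) in
     Add (Add s (Mul (Cst 2) (Mu x Len (Not_exp (Input (Add s (Mul (Cst 2) (Var x)))))))) (Cst 1))"

definition Start :: "exp \<Rightarrow> exp" where "Start k = Lookup 1 (Add Len (Cst 1)) k"

text \<open>The word holds 2 n^2 entries, so n is the least i for which entry 2 i^2 would start at
  the end of the word.\<close>

definition Dim :: exp where
  "Dim = Mu 1 (Add Len (Cst 1)) (Eq (Start (Mul (Mul (Cst 2) (Var 1)) (Var 1))) Len)"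

definition Residue :: "exp \<Rightarrow> exp \<Rightarrow> exp" where "Residue q s = Lookup 2 Value_bound (Pair_exp q s)"

definition Den_residue :: "exp \<Rightarrow> exp \<Rightarrow> exp" where
  "Den_residue q k = Residue q (Nat_end (Add (Start k) (Cst 1)))"

definition Entry_residue :: "exp \<Rightarrow> exp \<Rightarrow> exp" where
  "Entry_residue q k = (let x = Suc (max (fresh q) (fresh k)); a = Residue q (Add (Start k) (Cst 1)) in
     Mu x (Add q (Cst 1))
      (Eq (Mod_exp (Add (Mul (Den_residue q k) (Var x)) (Ite (Input (Start k)) a (Cst 0))) (Add q (Cst 1)))
          (Ite (Input (Start k)) (Cst 0) a)))"

definition Row_residue :: "exp \<Rightarrow> exp \<Rightarrow> exp \<Rightarrow> exp \<Rightarrow> exp \<Rightarrow> exp" where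
  "Row_residue q i0 j0 i j = Ite (Eq i i0) (Eq j j0) (Entry_residue q (Add (Mul i Dim) j))"

definition Cell :: "exp \<Rightarrow> exp \<Rightarrow> exp \<Rightarrow> exp \<Rightarrow> exp \<Rightarrow> exp \<Rightarrow> exp" where
  "Cell q i0 j0 t i j = Lookup 3 Value_bound (Pair_exp q (Pair_exp i0 (Pair_exp j0 (Pair_exp t (Pair_exp i j)))))"

definition Pivot :: "exp \<Rightarrow> exp \<Rightarrow> exp \<Rightarrow> exp \<Rightarrow> exp" where
  "Pivot q i0 j0 t = (let x = Suc (max (max (fresh q) (fresh i0)) (max (fresh j0) (fresh t))) in
     Mu x (Sub (Sub Dim t) (Cst 1)) (Cell q i0 j0 t (Var x) (Cst 0)))"

definition Condense :: "exp \<Rightarrow> exp \<Rightarrow> exp \<Rightarrow> exp \<Rightarrow> exp \<Rightarrow> exp \<Rightarrow> exp" where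
  "Condense q i0 j0 t i j = (let r = Pivot q i0 j0 t; i' = Ite (Le (Add i (Cst 1)) r) i (Add i (Cst 1));
      j' = Add j (Cst 1) in
     Mod_exp (Add (Mul (Cell q i0 j0 t r (Cst 0)) (Cell q i0 j0 t i' j'))
              (Mul (Cell q i0 j0 t i' (Cst 0)) (Sub (Add q (Cst 1)) (Cell q i0 j0 t r j'))))
         (Add q (Cst 1)))"

definition Good_prime :: "exp \<Rightarrow> exp" where
  "Good_prime q = (let x = Suc (fresh q) in
     Conj (Conj (Le (Cst 1) q)
              (Forall x (Add q (Cst 1)) (Disj (Le (Var x) (Cst 1)) (Mod_exp (Add q (Cst 1)) (Var x)))))
         (Forall x (Mul Dim Dim) (Den_residue q (Var x))))"

definition Full_rank :: "exp \<Rightarrow> exp \<Rightarrow> exp \<Rightarrow> exp" where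
  "Full_rank q i0 j0 = (let x = Suc (max (fresh q) (max (fresh i0) (fresh j0))) in
     Forall x Dim (Exists (Suc x) (Sub Dim (Var x)) (Cell q i0 j0 (Var x) (Var (Suc x)) (Cst 0))))"

definition Nonsingular :: "exp \<Rightarrow> exp \<Rightarrow> exp" where
  "Nonsingular i0 j0 = (let x = Suc (max (fresh i0) (fresh j0)) in
     Exists x Prime_bound (Conj (Good_prime (Var x)) (Full_rank (Var x) i0 j0)))"

definition Edge :: "exp \<Rightarrow> exp \<Rightarrow> exp" where
  "Edge i i' = (let x = Suc (max (fresh i) (fresh i')) in
     Exists x Dim (Conj (Input (Add (Start (Add (Add (Mul Dim Dim) (Mul i Dim)) (Var x))) (Cst 1)))
       (Nonsingular i' (Var x))))"

definition Walk :: "exp \<Rightarrow> exp \<Rightarrow> exp" where "Walk t i = Lookup 4 (Cst 2) (Pair_exp t i)"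

text \<open>The dimension is itself computed from this table, so the number of entries is unknown
  here; the loop runs to the input length, and positions past the last entry are never relied
  upon.\<close>

definition starts_cmd :: cmd where
  "starts_cmd = For 1 (Add Len (Cst 1)) (Store 1 (Var 1)
     (Ite (Var 1) (Nat_end (Nat_end (Add (Start (Sub (Var 1) (Cst 1))) (Cst 1)))) (Nat_end (Cst 0))))"

text \<open>Positions are visited from the end of the word downwards, because each residue is
  computed from the one two positions later.\<close>

definition residues_cmd :: cmd where
  "residues_cmd = (let s = Sub Len (Var 2) in
     For 1 Prime_bound (For 2 (Add Len (Cst 1)) (Store 2 (Pair_exp (Var 1) s)
       (Ite (Conj (Le (Add s (Cst 2)) Len) (Input s))
         (Mod_exp (Add (Input (Add s (Cst 1))) (Mul (Cst 2) (Residue (Var 1) (Add s (Cst 2))))) (Add (Var 1) (Cst 1)))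
         (Cst 0)))))"

text \<open>Variables 1 to 6 are the modulus, the replaced row and column, the stage and the two
  indices. The row ranges over one value more than the column, to include the unmodified matrix; the
  stage encloses the indices, so the previous stage is complete when it is read.\<close>

definition cells_cmd :: cmd where
  "cells_cmd =
     For 1 Prime_bound (For 2 (Add Dim (Cst 1)) (For 3 Dim (For 4 Dim
       (For 5 (Sub Dim (Var 4)) (For 6 (Sub Dim (Var 4))
         (Store 3 (Pair_exp (Var 1) (Pair_exp (Var 2) (Pair_exp (Var 3) (Pair_exp (Var 4) (Pair_exp (Var 5) (Var 6))))))
           (Ite (Var 4) (Condense (Var 1) (Var 2) (Var 3) (Sub (Var 4) (Cst 1)) (Var 5) (Var 6))
                       (Row_residue (Var 1) (Var 2) (Var 3) (Var 5) (Var 6)))))))))"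

definition walks_cmd :: cmd where
  "walks_cmd = For 1 (Add Dim (Cst 1)) (For 2 Dim (Store 4 (Pair_exp (Var 1) (Var 2))
     (Ite (Var 1) (Exists 3 Dim (Conj (Edge (Var 2) (Var 3)) (Walk (Sub (Var 1) (Cst 1)) (Var 3)))) (Cst 1))))"

definition radius_cmd :: cmd where
  "radius_cmd = Then starts_cmd (Then residues_cmd (Then cells_cmd walks_cmd))"

definition radius_exp :: exp where
  "radius_exp = Conj (Nonsingular Dim (Cst 0)) (Forall 1 Dim (Not_exp (Walk Dim (Var 1))))"

section \<open>Correctness of the decision procedure\<close>

context radius_instance
begin

definition prime_bound :: nat where "prime_bound = (length w + 2) ^ 12"

definition ready :: "(nat \<Rightarrow> nat) \<Rightarrow> arrays \<Rightarrow> bool" where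
  "ready v B \<longleftrightarrow> v 0 = length w \<and> (\<forall>s. B 0 s = 2 \<longleftrightarrow> bit_at w s)"

lemma ready_upd [simp]: "x \<noteq> 0 \<Longrightarrow> ready (v(x := i)) B \<longleftrightarrow> ready v B"
  by (simp add: ready_def)

lemma eval_Len [simp]: "ready v B \<Longrightarrow> eval B v Len = length w"
  by (simp add: ready_def Len_def)

lemma eval_Input [simp]: "ready v B \<Longrightarrow> eval B v (Input s) = of_bool (bit_at w (eval B v s))"
  by (simp add: ready_def Input_def)

lemma ready_stores:
  assumes "stores B k S B'" "k \<noteq> 0"
  shows "ready v B' \<longleftrightarrow> ready v B"
proof -
  have "B' 0 = B 0" using assms unfolding stores_def by metis
  then show ?thesis by (simp add: ready_def)
qed

lemma eval_Prime_bound [simp]: "ready v B \<Longrightarrow> eval B v Prime_bound = prime_bound"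
  by (simp add: Prime_bound_def prime_bound_def)

lemma eval_Value_bound [simp]: "ready v B \<Longrightarrow> eval B v Value_bound = Suc prime_bound"
  by (simp add: Value_bound_def)

lemma eval_Nat_end [simp]: "ready v B \<Longrightarrow> eval B v (Nat_end s) = nat_end w (eval B v s)"
  by (simp add: Nat_end_def Let_def nat_end_def)

definition has_starts :: "arrays \<Rightarrow> bool" where
  "has_starts B \<longleftrightarrow> (\<forall>k \<le> 2 * n * n. get B 1 (Suc (length w)) k = entry_start w k)"

lemma starts_cmd_correct:
  assumes v: "ready v B" and B: "stores B 1 {} B"
  obtains S where "stores B 1 S (exec starts_cmd v B)" "has_starts (exec starts_cmd v B)"
proof -
  \<comment> \<open>The sequence that the program really computes, including the values past the
    last entry, where a lookup may fail and return its limit. It coincides with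
    \<open>entry_start\<close> as long as entries exist.\<close>
  define f where "f = rec_nat (nat_end w 0)
    (\<lambda>k u. nat_end w (nat_end w (Suc (if u < Suc (length w) then u else Suc (length w)))))"
  have f_simps: "f 0 = nat_end w 0"
    "f (Suc k) = nat_end w (nat_end w (Suc (if f k < Suc (length w) then f k else Suc (length w))))" for k
    by (simp_all add: f_def)
  let ?T = "\<lambda>i. (\<lambda>k. (k, f k)) ` {..<i}"
  have get_T: "get B' 1 (Suc (length w)) k = (if f k < Suc (length w) then f k else Suc (length w))"
    if "k < i" "stores B 1 (?T i) B'" for i k B'
  proof (cases "f k < Suc (length w)")
    case True
    have "get B' 1 (Suc (length w)) k = f k"
      by (rule get_eq_if_stores[OF that(2) _ True]) (use that(1) in auto)
    with True show ?thesis by simp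
  next
    case False
    have "\<not> get B' 1 (Suc (length w)) k < Suc (length w)"
      using least_below_prop[of "Suc (length w)" "\<lambda>x. B' 1 (pair k x) = 2"] that(2) False
      by (auto simp: get_def stores_def)
    then show ?thesis
      using least_below_le[of "Suc (length w)"] False unfolding get_def by (metis le_antisym not_less)
  qed
  have T: "stores B 1 (?T (Suc (length w))) (exec starts_cmd v B)"
    unfolding starts_cmd_def
  proof (rule stores_For)
    show "stores B 1 (?T 0) B" using B by simp
    show "eval B v (Add Len (Cst 1)) = Suc (length w)" using v by simp
    fix i B' assume i: "i < Suc (length w)" and B': "stores B 1 (?T i) B'"
    have r: "ready v B'" using ready_stores[OF B'] v by simp
    show "stores B 1 (?T (Suc i)) (exec (Store 1 (Var 1)
     (Ite (Var 1) (Nat_end (Nat_end (Add (Start (Sub (Var 1) (Cst 1))) (Cst 1)))) (Nat_end (Cst 0)))) (v(1 := i)) B')"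
    proof (rule stores_Store[OF B'])
      show "eval B' (v(1 := i)) (Ite (Var 1) (Nat_end (Nat_end (Add (Start (Sub (Var 1) (Cst 1))) (Cst 1)))) (Nat_end (Cst 0))) = f i"
        using r get_T[OF _ B', of "i - 1"] by (cases i) (auto simp: Start_def f_simps)
    qed (auto simp: lessThan_Suc)
  qed
  have f: "k \<le> 2 * n * n \<Longrightarrow> f k = entry_start w k" for k
  proof (induction k)
    case (Suc k)
    then show ?case
      using entry_start_le[of k] by (simp add: f_simps length_xs less_Suc_eq_le)
  qed (simp add: f_simps)
  have "has_starts (exec starts_cmd v B)"
    unfolding has_starts_def
  proof (intro allI impI)
    fix k assume k: "k \<le> 2 * n * n"
    then have "k < Suc (length w)"
      using length_xs_le by (simp add: length_xs)
    then show "get (exec starts_cmd v B) 1 (Suc (length w)) k = entry_start w k"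
      using get_T[OF _ T, of k] f[OF k] entry_start_le[of k] k by (simp add: length_xs less_Suc_eq_le)
  qed
  with T show thesis by (rule that)
qed

lemma eval_Start [simp]:
  "ready v B \<Longrightarrow> has_starts B \<Longrightarrow> eval B v k \<le> 2 * n * n \<Longrightarrow> eval B v (Start k) = entry_start w (eval B v k)"
  by (simp add: Start_def has_starts_def)

lemma eval_Dim [simp]:
  assumes "ready v B" "has_starts B"
  shows "eval B v Dim = n"
proof -
  let ?s = "Start (Mul (Mul (Cst 2) (Var 1)) (Var 1))"
  have "eval B v Dim = least_below (Suc (length w)) (\<lambda>i. eval B (v(1 := i)) ?s = length w)"
    using assms by (simp add: Dim_def)
  also have "\<dots> = n"
  proof (rule least_below_eqI)
    \<comment> \<open>Only candidates up to n are ever examined, and for these the table of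
      positions is known to be right.\<close>
    have start: "eval B (v(1 := i)) ?s = entry_start w (2 * i * i)" if "i \<le> n" for i
    proof -
      have "2 * i * i \<le> 2 * n * n" using that by (intro mult_le_mono) auto
      then show ?thesis using assms by (subst eval_Start) auto
    qed
    show "n < Suc (length w)" using n_le by simp
    show "eval B (v(1 := n)) ?s = length w"
      unfolding start[OF order_refl] by (subst entry_start_eq_length_iff) (simp_all add: length_xs)
    fix i assume i: "i < n"
    then have "2 * i * i < 2 * n * n"
      using mult_strict_mono[of i n i n] by (simp add: mult.assoc)
    then have "entry_start w (2 * i * i) \<noteq> length w"
      by (subst entry_start_eq_length_iff) (simp_all add: length_xs)
    then show "eval B (v(1 := i)) ?s \<noteq> length w"
      using start[of i] i by simp
  qed
  finally show ?thesis .
qed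

lemma get_stores: "stores B k S B' \<Longrightarrow> l \<noteq> k \<Longrightarrow> get B' l = get B l"
  unfolding stores_def get_def by metis

lemma has_starts_stores: "stores B k S B' \<Longrightarrow> k \<noteq> 1 \<Longrightarrow> has_starts B' \<longleftrightarrow> has_starts B"
  using get_stores[of B k S B' 1] by (simp add: has_starts_def)

lemma residue_at_less: "residue_at w (Suc q) s < Suc q"
  by (subst residue_at.simps) simp

definition has_residues :: "arrays \<Rightarrow> bool" where
  "has_residues B \<longleftrightarrow> (\<forall>q < prime_bound. \<forall>s \<le> length w.
     get B 2 (Suc prime_bound) (pair q s) = residue_at w (Suc q) s)"

lemma has_residues_stores: "stores B k S B' \<Longrightarrow> k \<noteq> 2 \<Longrightarrow> has_residues B' \<longleftrightarrow> has_residues B"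
  using get_stores[of B k S B' 2] by (simp add: has_residues_def)

lemma residues_cmd_correct:
  assumes v: "ready v B" and B: "stores B 2 {} B"
  obtains S where "stores B 2 S (exec residues_cmd v B)" "has_residues (exec residues_cmd v B)"
proof -
  \<comment> \<open>State after all moduli below \<open>q\<close> and, for \<open>q\<close> itself,
    the last \<open>i\<close> positions from \<open>length w\<close> downwards.\<close>
  define T where "T q i = {(pair q' s, residue_at w (Suc q') s) | q' s.
    s \<le> length w \<and> (q' < q \<or> q' = q \<and> length w < s + i)}" for q i
  have get_T: "get B' 2 (Suc prime_bound) (pair q' s) = residue_at w (Suc q') s"
    if "stores B 2 (T q i) B'" "s \<le> length w" "q' < q \<or> q' = q \<and> length w < s + i" "q' < prime_bound" for B' q i q' s
    by (rule get_eq_if_stores[OF that(1)]) (use that residue_at_less[of q' s] in \<open>auto simp: T_def\<close>)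
  let ?s = "Sub Len (Var 2)"
  let ?e = "Ite (Conj (Le (Add ?s (Cst 2)) Len) (Input ?s))
         (Mod_exp (Add (Input (Add ?s (Cst 1))) (Mul (Cst 2) (Residue (Var 1) (Add ?s (Cst 2))))) (Add (Var 1) (Cst 1)))
         (Cst 0)"
  have T: "stores B 2 (T prime_bound 0) (exec residues_cmd v B)"
    unfolding residues_cmd_def Let_def
  proof (rule stores_For[where T = "\<lambda>q. T q 0"])
    have "T 0 0 = {}" by (auto simp: T_def)
    with B show "stores B 2 (T 0 0) B" by simp
    show "eval B v Prime_bound = prime_bound" using v by simp
    fix q B1 assume q: "q < prime_bound" and B1: "stores B 2 (T q 0) B1"
    have r: "ready v B1" using ready_stores[OF B1] v by simp
    have "stores B 2 (T q (Suc (length w))) (exec (For 2 (Add Len (Cst 1)) (Store 2 (Pair_exp (Var 1) ?s) ?e)) (v(1 := q)) B1)"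
    proof (rule stores_For[where T = "T q"])
      show "eval B1 (v(1 := q)) (Add Len (Cst 1)) = Suc (length w)" using r by simp
      fix i B2 assume i: "i < Suc (length w)" and B2: "stores B 2 (T q i) B2"
      have r: "ready v B2" using ready_stores[OF B2] v by simp
      let ?i = "length w - i"
      show "stores B 2 (T q (Suc i)) (exec (Store 2 (Pair_exp (Var 1) ?s) ?e) (v(1 := q, 2 := i)) B2)"
      proof (rule stores_Store[OF B2])
        show "eval B2 (v(1 := q, 2 := i)) (Pair_exp (Var 1) ?s) = pair q ?i"
          using r by simp
        have res: "eval B2 (v(1 := q, 2 := i)) (Residue (Var 1) (Add ?s (Cst 2))) = residue_at w (Suc q) (?i + 2)"
          if "?i + 2 \<le> length w"
          using r get_T[OF B2 that, of q] q i by (simp add: Residue_def)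
        show "eval B2 (v(1 := q, 2 := i)) ?e = residue_at w (Suc q) ?i"
          using r res by (subst residue_at.simps) auto
        show "insert (pair q ?i, residue_at w (Suc q) ?i) (T q i) = T q (Suc i)"
        proof -
          have "length w < Suc (s + i) \<longleftrightarrow> length w < s + i \<or> s = ?i" for s
            using i by auto
          then show ?thesis using i by (auto simp: T_def)
        qed
      qed
    qed (rule B1)
    moreover have "T q (Suc (length w)) = T (Suc q) 0"
      by (auto simp: T_def less_Suc_eq)
    ultimately show "stores B 2 (T (Suc q) 0) (exec (For 2 (Add Len (Cst 1)) (Store 2 (Pair_exp (Var 1) ?s) ?e)) (v(1 := q)) B1)"
      by simp
  qed
  moreover have "has_residues (exec residues_cmd v B)"
    unfolding has_residues_def using get_T[OF T] by blast
  ultimately show thesis by (rule that)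
qed

lemma start_bounds:
  assumes "k < 2 * n * n"
  shows "Suc (entry_start w k) \<le> length w" "nat_end w (Suc (entry_start w k)) \<le> length w"
proof -
  obtain a b where ab: "quotient_of (xs ! k) = (a, b)" by fastforce
  have "k < length xs" using assms by (simp add: length_xs)
  from entry(7,8)[OF this ab] show "Suc (entry_start w k) \<le> length w" "nat_end w (Suc (entry_start w k)) \<le> length w"
    by simp_all
qed

lemma eval_Residue [simp]:
  "ready v B \<Longrightarrow> has_residues B \<Longrightarrow> eval B v q < prime_bound \<Longrightarrow> eval B v s \<le> length w \<Longrightarrow>
    eval B v (Residue q s) = residue_at w (Suc (eval B v q)) (eval B v s)"
  by (simp add: Residue_def has_residues_def)

lemma eval_Den_residue [simp]:
  assumes "ready v B" "has_starts B" "has_residues B" "eval B v q < prime_bound" "eval B v k < 2 * n * n"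
  shows "eval B v (Den_residue q k) = den_residue (Suc (eval B v q)) (eval B v k)"
  using assms start_bounds[of "eval B v k"] by (simp add: Den_residue_def den_residue_def)

lemma eval_Entry_residue [simp]:
  assumes "ready v B" "has_starts B" "has_residues B" "eval B v q < prime_bound" "eval B v k < 2 * n * n"
  shows "eval B v (Entry_residue q k) = entry_residue (Suc (eval B v q)) (eval B v k)"
  using assms start_bounds[of "eval B v k"]
  by (simp add: Entry_residue_def Let_def entry_residue_def quotient_mod_def if_distrib cong: if_cong)

definition cell :: "nat \<Rightarrow> nat \<Rightarrow> nat \<Rightarrow> nat \<Rightarrow> nat \<Rightarrow> nat \<Rightarrow> nat" where
  "cell q i0 j0 = chio (Suc q) n (row_residue (Suc q) i0 j0)"

definition key :: "nat \<Rightarrow> nat \<Rightarrow> nat \<Rightarrow> nat \<Rightarrow> nat \<Rightarrow> nat \<Rightarrow> nat" where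
  "key q i0 j0 t i j = pair q (pair i0 (pair j0 (pair t (pair i j))))"

lemma key_eq_iff [simp]:
  "key q i0 j0 t i j = key q' i0' j0' t' i' j' \<longleftrightarrow>
    q = q' \<and> i0 = i0' \<and> j0 = j0' \<and> t = t' \<and> i = i' \<and> j = j'"
  by (simp add: key_def)

text \<open>Equality can occur at stage 0: the table is also filled for moduli that are not prime,
  where the search for a quotient may fail and return the modulus.\<close>

lemma cell_le: "cell q i0 j0 t i j \<le> Suc q"
proof (cases t)
  case 0
  then show ?thesis
    by (auto simp: cell_def row_residue_def entry_residue_def quotient_mod_def least_below_le)
next
  case (Suc t')
  have "cell q i0 j0 (Suc t') i j < Suc q"
    by (simp add: cell_def condense_def Let_def)
  with Suc show ?thesis by simp
qed

definition cells :: "(nat \<Rightarrow> nat \<Rightarrow> nat \<Rightarrow> nat \<Rightarrow> nat \<Rightarrow> nat \<Rightarrow> bool) \<Rightarrow> (nat \<times> nat) set" where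
  "cells P = {(key q i0 j0 t i j, cell q i0 j0 t i j) | q i0 j0 t i j. P q i0 j0 t i j \<and>
     i0 \<le> n \<and> j0 < n \<and> t < n \<and> i < n - t \<and> j < n - t}"

lemma get_cells:
  assumes "stores B 3 (cells P) B'" "P q i0 j0 t i j" "q < prime_bound" "i0 \<le> n" "j0 < n" "t < n"
    "i < n - t" "j < n - t"
  shows "get B' 3 (Suc prime_bound) (key q i0 j0 t i j) = cell q i0 j0 t i j"
  by (rule get_eq_if_stores[OF assms(1)])
    (use assms(2-) cell_le[of q i0 j0 t i j] in \<open>auto simp: cells_def\<close>)

lemma cells_eqI:
  assumes "\<And>q i0 j0 t i j. i0 \<le> n \<Longrightarrow> j0 < n \<Longrightarrow> t < n \<Longrightarrow> i < n - t \<Longrightarrow> j < n - t \<Longrightarrow>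
    P q i0 j0 t i j \<longleftrightarrow> P' q i0 j0 t i j"
  shows "cells P = cells P'"
  unfolding cells_def using assms by blast

(* The order is the lexicographic one, in which the nested loops write the cells. *)
definition before :: "nat \<Rightarrow> nat \<Rightarrow> nat \<Rightarrow> nat \<Rightarrow> nat \<Rightarrow> nat \<Rightarrow> (nat \<times> nat) set" where
  "before q i0 j0 t i j = cells (\<lambda>q' i0' j0' t' i' j'. q' < q \<or> q' = q \<and> (i0' < i0 \<or> i0' = i0 \<and>
    (j0' < j0 \<or> j0' = j0 \<and> (t' < t \<or> t' = t \<and> (i' < i \<or> i' = i \<and> j' < j)))))"

text \<open>Completing an inner loop is the same as advancing the next outer index by one with the
  inner ones reset; this links the invariants of the six nested loops.\<close>

lemma before_carry:
  "before q i0 j0 t i (n - t) = before q i0 j0 t (Suc i) 0"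
  "before q i0 j0 t (n - t) 0 = before q i0 j0 (Suc t) 0 0"
  "before q i0 j0 n 0 0 = before q i0 (Suc j0) 0 0 0"
  "before q i0 n 0 0 0 = before q (Suc i0) 0 0 0 0"
  "before q (Suc n) 0 0 0 0 = before (Suc q) 0 0 0 0 0"
  unfolding before_def by (rule cells_eqI; auto simp: less_Suc_eq less_Suc_eq_le)+

lemma before_Suc:
  assumes "i0 \<le> n" "j0 < n" "t < n" "i < n - t" "j < n - t"
  shows "insert (key q i0 j0 t i j, cell q i0 j0 t i j) (before q i0 j0 t i j) = before q i0 j0 t i (Suc j)"
  unfolding before_def cells_def using assms by (auto simp: less_Suc_eq)

lemma eval_Cell [simp]:
  "ready v B \<Longrightarrow> eval B v (Cell q i0 j0 t i j) = get B 3 (Suc prime_bound)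
    (key (eval B v q) (eval B v i0) (eval B v j0) (eval B v t) (eval B v i) (eval B v j))"
  by (simp add: Cell_def key_def)

lemma least_below_cong: "(\<And>i. i < m \<Longrightarrow> P i \<longleftrightarrow> Q i) \<Longrightarrow> least_below m P = least_below m Q"
  unfolding least_below_def by metis

lemma eval_Pivot:
  assumes "ready v B" "has_starts B"
  shows "eval B v (Pivot q i0 j0 t) = least_below (n - eval B v t - 1)
    (\<lambda>r. get B 3 (Suc prime_bound) (key (eval B v q) (eval B v i0) (eval B v j0) (eval B v t) r 0) \<noteq> 0)"
  using assms by (simp add: Pivot_def Let_def)

lemma eval_Condense:
  assumes r: "ready v B" "has_starts B" and t: "eval B v t < n"
    and cells: "\<And>i j. i < n - eval B v t \<Longrightarrow> j < n - eval B v t \<Longrightarrow>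
      get B 3 (Suc prime_bound) (key (eval B v q) (eval B v i0) (eval B v j0) (eval B v t) i j) =
      cell (eval B v q) (eval B v i0) (eval B v j0) (eval B v t) i j"
    and ij: "eval B v i < n - Suc (eval B v t)" "eval B v j < n - Suc (eval B v t)"
  shows "eval B v (Condense q i0 j0 t i j) =
    cell (eval B v q) (eval B v i0) (eval B v j0) (Suc (eval B v t)) (eval B v i) (eval B v j)"
proof -
  let ?q = "eval B v q"
  let ?I = "eval B v i0"
  let ?J = "eval B v j0"
  let ?t = "eval B v t"
  let ?i = "eval B v i"
  let ?j = "eval B v j"
  define g where "g = cell (?q) (?I) (?J) (?t)"
  define p where "p = least_below (n - ?t - 1) (\<lambda>r. g r 0 \<noteq> 0)"
  have p: "p < n - ?t"
    using least_below_le[of "n - ?t - 1" "\<lambda>r. g r 0 \<noteq> 0"] t unfolding p_def by linarith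
  have piv: "eval B v (Pivot q i0 j0 t) = p"
    unfolding eval_Pivot[OF r] p_def
  proof (rule least_below_cong)
    fix a assume "a < n - ?t - 1"
    then have "get B 3 (Suc prime_bound) (key (?q) (?I) (?J) (?t) a 0) = g a 0"
      unfolding g_def by (intro cells) auto
    then show "get B 3 (Suc prime_bound) (key (?q) (?I) (?J) (?t) a 0) \<noteq> 0 \<longleftrightarrow> g a 0 \<noteq> 0"
      by simp
  qed
  have c: "get B 3 (Suc prime_bound) (key (?q) (?I) (?J) (?t) a b) = g a b"
    if "a < n - ?t" "b < n - ?t" for a b
    unfolding g_def using that by (rule cells)
  have pos: "0 < n - ?t" "?j + 1 < n - ?t" "?i + 1 < n - ?t"
    "?i < n - ?t"
    using t ij by auto
  let ?i' = "Ite (Le (Add i (Cst 1)) (Pivot q i0 j0 t)) i (Add i (Cst 1))"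
  have i': "eval B v ?i' = insert_index p (?i)"
    by (simp add: piv insert_index_def Suc_le_eq)
  have i'_less: "insert_index p (?i) < n - ?t"
    using pos by (simp add: insert_index_def)
  have "eval B v (Condense q i0 j0 t i j) =
    (g p 0 * g (insert_index p (?i)) (?j + 1)
      + g (insert_index p (?i)) 0 * (?q + 1 - g p (?j + 1))) mod (?q + 1)"
    unfolding Condense_def Let_def
    by (simp only: eval_Mod_exp eval_Mul eval_Cell[OF r(1)] eval.simps piv i'
        c[OF p pos(1)] c[OF p pos(2)] c[OF i'_less pos(1)] c[OF i'_less pos(2)])
  moreover have "cell (?q) (?I) (?J) (Suc (?t)) (?i) (?j)
    = condense (Suc (?q)) (n - ?t) g (?i) (?j)"
    by (simp add: cell_def g_def)
  ultimately show ?thesis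
    by (simp only: condense_def Let_def p_def[symmetric] Suc_eq_plus1)
qed

lemma eval_Row_residue:
  assumes "ready v B" "has_starts B" "has_residues B" "eval B v q < prime_bound" "eval B v i < n" "eval B v j < n"
  shows "eval B v (Row_residue q i0 j0 i j) =
    cell (eval B v q) (eval B v i0) (eval B v j0) 0 (eval B v i) (eval B v j)"
proof -
  have "eval B v i * n + eval B v j < 2 * n * n"
    using index_less[OF assms(5,6)] by simp
  then show ?thesis
    using assms by (simp add: Row_residue_def cell_def row_residue_def)
qed

definition has_cells :: "arrays \<Rightarrow> bool" where
  "has_cells B \<longleftrightarrow> (\<forall>q i0 j0 t i j. q < prime_bound \<and> i0 \<le> n \<and> j0 < n \<and> t < n \<and> i < n - t \<and> j < n - t \<longrightarrow>
     get B 3 (Suc prime_bound) (key q i0 j0 t i j) = cell q i0 j0 t i j)"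

lemma has_cells_stores: "stores B k S B' \<Longrightarrow> k \<noteq> 3 \<Longrightarrow> has_cells B' \<longleftrightarrow> has_cells B"
  using get_stores[of B k S B' 3] by (simp add: has_cells_def)

lemma cells_cmd_correct:
  assumes v: "ready v B" "has_starts B" "has_residues B" and B: "stores B 3 {} B"
  obtains S where "stores B 3 S (exec cells_cmd v B)" "has_cells (exec cells_cmd v B)"
proof -
  have keep: "ready v B'" "has_starts B'" "has_residues B'" if "stores B 3 S B'" for S B'
    using v ready_stores[OF that] has_starts_stores[OF that] has_residues_stores[OF that] by simp_all
  let ?e = "Ite (Var 4) (Condense (Var 1) (Var 2) (Var 3) (Sub (Var 4) (Cst 1)) (Var 5) (Var 6))
    (Row_residue (Var 1) (Var 2) (Var 3) (Var 5) (Var 6))"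
  let ?c7 = "Store 3 (Pair_exp (Var 1) (Pair_exp (Var 2) (Pair_exp (Var 3) (Pair_exp (Var 4) (Pair_exp (Var 5) (Var 6)))))) ?e"
  let ?c6 = "For 6 (Sub Dim (Var 4)) ?c7"
  let ?c5 = "For 5 (Sub Dim (Var 4)) ?c6"
  let ?c4 = "For 4 Dim ?c5"
  let ?c3 = "For 3 Dim ?c4"
  let ?c2 = "For 2 (Add Dim (Cst 1)) ?c3"
  have T: "stores B 3 (before prime_bound 0 0 0 0 0) (exec cells_cmd v B)"
    unfolding cells_cmd_def
  proof (rule stores_For[where T = "\<lambda>q. before q 0 0 0 0 0"])
    have "before 0 0 0 0 0 0 = {}" by (simp add: before_def cells_def)
    with B show "stores B 3 (before 0 0 0 0 0 0) B" by simp
    show "eval B v Prime_bound = prime_bound" using v by simp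
    fix q B1 assume q: "q < prime_bound" and B1: "stores B 3 (before q 0 0 0 0 0) B1"
    note k1 = keep[OF B1]
    show "stores B 3 (before (Suc q) 0 0 0 0 0) (exec ?c2 (v(1 := q)) B1)"
      unfolding before_carry(5)[symmetric]
    proof (rule stores_For[where T = "\<lambda>i0. before q i0 0 0 0 0", OF B1])
      show "eval B1 (v(1 := q)) (Add Dim (Cst 1)) = Suc n" using k1 by simp
      fix i0 B2 assume i0: "i0 < Suc n" and B2: "stores B 3 (before q i0 0 0 0 0) B2"
      note k2 = keep[OF B2]
      show "stores B 3 (before q (Suc i0) 0 0 0 0) (exec ?c3 (v(1 := q, 2 := i0)) B2)"
        unfolding before_carry(4)[symmetric]
      proof (rule stores_For[where T = "\<lambda>j0. before q i0 j0 0 0 0", OF B2])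
        show "eval B2 (v(1 := q, 2 := i0)) Dim = n" using k2 by simp
        fix j0 B3 assume j0: "j0 < n" and B3: "stores B 3 (before q i0 j0 0 0 0) B3"
        note k3 = keep[OF B3]
        show "stores B 3 (before q i0 (Suc j0) 0 0 0) (exec ?c4 (v(1 := q, 2 := i0, 3 := j0)) B3)"
          unfolding before_carry(3)[symmetric]
        proof (rule stores_For[where T = "\<lambda>t. before q i0 j0 t 0 0", OF B3])
          show "eval B3 (v(1 := q, 2 := i0, 3 := j0)) Dim = n" using k3 by simp
          fix t B4 assume t: "t < n" and B4: "stores B 3 (before q i0 j0 t 0 0) B4"
          note k4 = keep[OF B4]
          show "stores B 3 (before q i0 j0 (Suc t) 0 0) (exec ?c5 (v(1 := q, 2 := i0, 3 := j0, 4 := t)) B4)"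
            unfolding before_carry(2)[symmetric]
          proof (rule stores_For[where T = "\<lambda>i. before q i0 j0 t i 0", OF B4])
            show "eval B4 (v(1 := q, 2 := i0, 3 := j0, 4 := t)) (Sub Dim (Var 4)) = n - t" using k4 by simp
            fix i B5 assume i: "i < n - t" and B5: "stores B 3 (before q i0 j0 t i 0) B5"
            note k5 = keep[OF B5]
            show "stores B 3 (before q i0 j0 t (Suc i) 0) (exec ?c6 (v(1 := q, 2 := i0, 3 := j0, 4 := t, 5 := i)) B5)"
              unfolding before_carry(1)[symmetric]
            proof (rule stores_For[where T = "\<lambda>j. before q i0 j0 t i j", OF B5])
              show "eval B5 (v(1 := q, 2 := i0, 3 := j0, 4 := t, 5 := i)) (Sub Dim (Var 4)) = n - t" using k5 by simp
              fix j B6 assume j: "j < n - t" and B6: "stores B 3 (before q i0 j0 t i j) B6"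
              note k6 = keep[OF B6]
              define v' where "v' = v(1 := q, 2 := i0, 3 := j0, 4 := t, 5 := i, 6 := j)"
              have v': "v' 1 = q" "v' 2 = i0" "v' 3 = j0" "v' 4 = t" "v' 5 = i" "v' 6 = j" "ready v' B6"
                using k6 by (simp_all add: v'_def)
              show "stores B 3 (before q i0 j0 t i (Suc j)) (exec ?c7 (v(1 := q, 2 := i0, 3 := j0, 4 := t, 5 := i, 6 := j)) B6)"
                unfolding v'_def[symmetric]
              proof (rule stores_Store[OF B6])
                show "eval B6 v' (Pair_exp (Var 1) (Pair_exp (Var 2) (Pair_exp (Var 3) (Pair_exp (Var 4) (Pair_exp (Var 5) (Var 6)))))) = key q i0 j0 t i j"
                  using v' by (simp add: key_def)
                show "insert (key q i0 j0 t i j, cell q i0 j0 t i j) (before q i0 j0 t i j) = before q i0 j0 t i (Suc j)"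
                  using i0 j0 t i j by (intro before_Suc) auto
                show "eval B6 v' ?e = cell q i0 j0 t i j"
                proof (cases t)
                  case 0
                  then show ?thesis
                    using eval_Row_residue[OF v'(7) k6(2,3), of "Var 1" "Var 5" "Var 6"] v' q i j by simp
                next
                  \<comment> \<open>All cells of stage t' for the same modulus and replacement
                    precede the current one lexicographically, so they are already stored.\<close>
                  case (Suc t')
                  let ?E = "eval B6 v'"
                  have "?E (Condense (Var 1) (Var 2) (Var 3) (Sub (Var 4) (Cst 1)) (Var 5) (Var 6)) =
                    cell (?E (Var 1)) (?E (Var 2)) (?E (Var 3)) (Suc (?E (Sub (Var 4) (Cst 1)))) (?E (Var 5)) (?E (Var 6))"
                  proof (rule eval_Condense[OF v'(7) k6(2)])
                    fix a b assume "a < n - ?E (Sub (Var 4) (Cst 1))" "b < n - ?E (Sub (Var 4) (Cst 1))"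
                    then show "get B6 3 (Suc prime_bound) (key (?E (Var 1)) (?E (Var 2)) (?E (Var 3)) (?E (Sub (Var 4) (Cst 1))) a b)
                      = cell (?E (Var 1)) (?E (Var 2)) (?E (Var 3)) (?E (Sub (Var 4) (Cst 1))) a b"
                      using v' Suc q i0 j0 t
                      by (simp, intro get_cells[OF B6[unfolded before_def]]) auto
                  qed (use v' Suc t i j in auto)
                  then show ?thesis using v' Suc by simp
                qed
              qed
            qed
          qed
        qed
      qed
    qed
  qed
  moreover have "has_cells (exec cells_cmd v B)"
    unfolding has_cells_def using get_cells[OF T[unfolded before_def]] by blast
  ultimately show thesis by (rule that)
qed

lemma prime_Suc_iff: "prime (Suc q) \<longleftrightarrow> 1 \<le> q \<and> (\<forall>d < Suc q. d \<le> 1 \<or> Suc q mod d \<noteq> 0)"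
proof -
  have "d \<le> 1 \<longleftrightarrow> \<not> 2 \<le> d" for d :: nat
    by auto
  moreover have "1 < Suc q \<longleftrightarrow> 1 \<le> q"
    by auto
  ultimately show ?thesis
    unfolding prime_nat_iff' dvd_eq_mod_eq_0 Ball_def atLeastLessThan_iff by blast
qed

lemma eval_Good_prime [simp]:
  assumes "ready v B" "has_starts B" "has_residues B" "eval B v q < prime_bound"
  shows "eval B v (Good_prime q) = of_bool (good_prime (Suc (eval B v q)))"
proof -
  let ?x = "Suc (fresh q)"
  have "eval B (v(?x := k)) (Den_residue q (Var ?x)) = den_residue (Suc (eval B v q)) k" if "k < n * n" for k
    using assms that by (subst eval_Den_residue) auto
  then show ?thesis
    using assms unfolding good_prime_def prime_Suc_iff
    by (simp add: Good_prime_def Let_def)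
qed

lemma eval_Full_rank [simp]:
  assumes "ready v B" "has_starts B" "has_cells B" "eval B v q < prime_bound" "eval B v i0 \<le> n"
    "n = 0 \<or> eval B v j0 < n"
  shows "eval B v (Full_rank q i0 j0) = of_bool (full_rank (Suc (eval B v q)) (eval B v i0) (eval B v j0))"
proof -
  let ?q = "eval B v q"
  let ?I = "eval B v i0"
  let ?J = "eval B v j0"
  have "get B 3 (Suc prime_bound) (key (?q) (?I) (?J) t r 0)
    = chio (Suc (?q)) n (row_residue (Suc (?q)) (?I) (?J)) t r 0"
    if "t < n" "r < n - t" for t r
    using assms that unfolding cell_def[symmetric] by (auto simp: has_cells_def)
  then show ?thesis
    using assms unfolding full_rank_def by (simp add: Full_rank_def Let_def)
qed

lemma eval_Nonsingular [simp]:
  assumes "ready v B" "has_starts B" "has_residues B" "has_cells B" "eval B v i0 \<le> n" "n = 0 \<or> eval B v j0 < n"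
  shows "eval B v (Nonsingular i0 j0) = of_bool (nonsingular (eval B v i0) (eval B v j0))"
proof -
  define x where "x = Suc (max (fresh i0) (fresh j0))"
  have x: "x \<noteq> 0" "fresh i0 \<le> x" "fresh j0 \<le> x" by (auto simp: x_def)
  have "eval B (v(x := q)) (Good_prime (Var x)) = of_bool (good_prime (Suc q))"
    "eval B (v(x := q)) (Full_rank (Var x) i0 j0) = of_bool (full_rank (Suc q) (eval B v i0) (eval B v j0))"
    if "q < prime_bound" for q
    using assms that x by (subst eval_Good_prime eval_Full_rank; simp)+
  then show ?thesis
    using assms unfolding nonsingular_def prime_bound_def[symmetric]
    by (simp add: Nonsingular_def Let_def x_def[symmetric] del: fun_upd_apply)
qed

lemma eval_Edge [simp]:
  assumes "ready v B" "has_starts B" "has_residues B" "has_cells B" "eval B v i < n" "eval B v i' < n"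
  shows "eval B v (Edge i i') = of_bool (edge (eval B v i) (eval B v i'))"
proof -
  define x where "x = Suc (max (fresh i) (fresh i'))"
  have x: "x \<noteq> 0" "fresh i \<le> x" "fresh i' \<le> x" by (auto simp: x_def)
  let ?s = "Start (Add (Add (Mul Dim Dim) (Mul i Dim)) (Var x))"
  have "eval B (v(x := j)) ?s
      = entry_start w (n * n + eval B v i * n + j)"
    "eval B (v(x := j)) (Nonsingular i' (Var x)) = of_bool (nonsingular (eval B v i') j)"
    if "j < n" for j
  proof -
    have "n * n + eval B v i * n + j \<le> 2 * n * n"
      using index_less[OF assms(5) that] by simp
    then show "eval B (v(x := j)) ?s
      = entry_start w (n * n + eval B v i * n + j)"
      using assms x by (subst eval_Start; simp)
    show "eval B (v(x := j)) (Nonsingular i' (Var x)) = of_bool (nonsingular (eval B v i') j)"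
      using assms x that by (subst eval_Nonsingular; simp)
  qed
  then show ?thesis
    using assms x unfolding edge_def
    by (simp add: Edge_def Let_def x_def[symmetric] del: fun_upd_apply cong: conj_cong)
qed

definition has_walks :: "arrays \<Rightarrow> bool" where
  "has_walks B \<longleftrightarrow> (\<forall>t \<le> n. \<forall>i < n. get B 4 2 (pair t i) = of_bool (walk n edge t i))"

lemma walks_cmd_correct:
  assumes v: "ready v B" "has_starts B" "has_residues B" "has_cells B" and B: "stores B 4 {} B"
  obtains S where "stores B 4 S (exec walks_cmd v B)" "has_walks (exec walks_cmd v B)"
proof -
  have keep: "ready v B'" "has_starts B'" "has_residues B'" "has_cells B'" if "stores B 4 S B'" for S B'
    using v ready_stores[OF that] has_starts_stores[OF that] has_residues_stores[OF that] has_cells_stores[OF that]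
    by simp_all
  define T where "T t i = {(pair t' i', of_bool (walk n edge t' i') :: nat) | t' i'.
    i' < n \<and> (t' < t \<or> t' = t \<and> i' < i)}" for t i
  have get_T: "get B' 4 2 (pair t' i') = of_bool (walk n edge t' i')"
    if "stores B 4 (T t i) B'" "i' < n" "t' < t \<or> t' = t \<and> i' < i" for B' t i t' i'
    by (rule get_eq_if_stores[OF that(1)]) (use that in \<open>auto simp: T_def\<close>)
  let ?e = "Ite (Var 1) (Exists 3 Dim (Conj (Edge (Var 2) (Var 3)) (Walk (Sub (Var 1) (Cst 1)) (Var 3)))) (Cst 1)"
  let ?c = "Store 4 (Pair_exp (Var 1) (Var 2)) ?e"
  have T: "stores B 4 (T (Suc n) 0) (exec walks_cmd v B)"
    unfolding walks_cmd_def
  proof (rule stores_For[where T = "\<lambda>t. T t 0"])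
    have "T 0 0 = {}" by (auto simp: T_def)
    with B show "stores B 4 (T 0 0) B" by simp
    show "eval B v (Add Dim (Cst 1)) = Suc n" using v by simp
    fix t B1 assume t: "t < Suc n" and B1: "stores B 4 (T t 0) B1"
    note k1 = keep[OF B1]
    have "stores B 4 (T t n) (exec (For 2 Dim ?c) (v(1 := t)) B1)"
    proof (rule stores_For[where T = "T t", OF B1])
      show "eval B1 (v(1 := t)) Dim = n" using k1 by simp
      fix i B2 assume i: "i < n" and B2: "stores B 4 (T t i) B2"
      note k2 = keep[OF B2]
      show "stores B 4 (T t (Suc i)) (exec ?c (v(1 := t, 2 := i)) B2)"
      proof (rule stores_Store[OF B2])
        show "eval B2 (v(1 := t, 2 := i)) (Pair_exp (Var 1) (Var 2)) = pair t i" by simp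
        show "insert (pair t i, of_bool (walk n edge t i)) (T t i) = T t (Suc i)"
          using i by (auto simp: T_def less_Suc_eq)
        show "eval B2 (v(1 := t, 2 := i)) ?e = of_bool (walk n edge t i)"
        proof (cases t)
          case (Suc t')
          have "eval B2 (v(1 := t, 2 := i, 3 := i')) (Edge (Var 2) (Var 3)) = of_bool (edge i i')"
            "eval B2 (v(1 := t, 2 := i, 3 := i')) (Walk (Sub (Var 1) (Cst 1)) (Var 3)) = of_bool (walk n edge t' i')"
            if "i' < n" for i'
          proof -
            show "eval B2 (v(1 := t, 2 := i, 3 := i')) (Edge (Var 2) (Var 3)) = of_bool (edge i i')"
              using k2 i that by (subst eval_Edge) auto
            show "eval B2 (v(1 := t, 2 := i, 3 := i')) (Walk (Sub (Var 1) (Cst 1)) (Var 3)) = of_bool (walk n edge t' i')"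
              using get_T[OF B2 that, of t'] Suc by (simp add: Walk_def)
          qed
          then show ?thesis
            using k2 Suc by (auto simp del: fun_upd_apply simp add: fun_upd_other fun_upd_same)
        qed simp
      qed
    qed
    moreover have "T t n = T (Suc t) 0"
      by (auto simp: T_def less_Suc_eq)
    ultimately show "stores B 4 (T (Suc t) 0) (exec (For 2 Dim ?c) (v(1 := t)) B1)"
      by simp
  qed
  moreover have "has_walks (exec walks_cmd v B)"
    unfolding has_walks_def using get_T[OF T] by (simp add: less_Suc_eq_le)
  ultimately show thesis by (rule that)
qed

theorem result_radius: "result radius_cmd radius_exp w \<noteq> 0 \<longleftrightarrow>
  regularity_radius (map_mat of_rat A) (map_mat of_rat D) = \<infinity>"
proof -
  define v where "v = (\<lambda>_::nat. 0::nat)(0 := length w)"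
  define B0 where "B0 = input_arrays w"
  have bit: "bit_symbol b = 2 \<longleftrightarrow> b" for b by (cases b) auto
  have r0: "ready v B0"
    by (auto simp: ready_def v_def B0_def input_arrays_def bit_at_def bit)
  \<comment> \<open>Each stage starts with its own array still blank, as earlier stages write to
    other arrays only; for the same reason later stages preserve the earlier tables.\<close>
  have empty: "stores B k {} B" if "B k = B0 k" "k \<noteq> 0" for B k
    using that by (auto simp: stores_def B0_def input_arrays_def)
  have other: "stores B k S B' \<Longrightarrow> l \<noteq> k \<Longrightarrow> B' l = B l" for B k S B' l
    by (simp add: stores_def)
  define B1 where "B1 = exec starts_cmd v B0"
  obtain S1 where S1: "stores B0 1 S1 B1" "has_starts B1"
    unfolding B1_def using starts_cmd_correct[OF r0 empty] by auto
  have r1: "ready v B1" using ready_stores[OF S1(1)] r0 by simp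
  define B2 where "B2 = exec residues_cmd v B1"
  have "stores B1 2 {} B1" using other[OF S1(1), of 2] by (intro empty) auto
  then obtain S2 where S2: "stores B1 2 S2 B2" "has_residues B2"
    unfolding B2_def using residues_cmd_correct[OF r1] by auto
  have r2: "ready v B2" "has_starts B2"
    using ready_stores[OF S2(1)] r1 has_starts_stores[OF S2(1)] S1(2) by simp_all
  define B3 where "B3 = exec cells_cmd v B2"
  have "stores B2 3 {} B2" using other[OF S1(1), of 3] other[OF S2(1), of 3] by (intro empty) auto
  then obtain S3 where S3: "stores B2 3 S3 B3" "has_cells B3"
    unfolding B3_def using cells_cmd_correct[OF r2 S2(2)] by auto
  have r3: "ready v B3" "has_starts B3" "has_residues B3"
    using ready_stores[OF S3(1)] has_starts_stores[OF S3(1)] has_residues_stores[OF S3(1)] r2 S2(2) by simp_all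
  define B4 where "B4 = exec walks_cmd v B3"
  have "stores B3 4 {} B3" using other[OF S1(1), of 4] other[OF S2(1), of 4] other[OF S3(1), of 4] by (intro empty) auto
  then obtain S4 where S4: "stores B3 4 S4 B4" "has_walks B4"
    unfolding B4_def using walks_cmd_correct[OF r3 S3(2)] by auto
  have r4: "ready v B4" "has_starts B4" "has_residues B4" "has_cells B4"
    using ready_stores[OF S4(1)] has_starts_stores[OF S4(1)] has_residues_stores[OF S4(1)]
      has_cells_stores[OF S4(1)] r3 S3(2) by simp_all
  have nonsing: "eval B4 v (Nonsingular Dim (Cst 0)) = of_bool (nonsingular n 0)"
    using r4 by (subst eval_Nonsingular) auto
  have "result radius_cmd radius_exp w = eval B4 v radius_exp"
    by (simp add: result_def Let_def radius_cmd_def B4_def B3_def B2_def B1_def B0_def v_def)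
  also have "\<dots> \<noteq> 0 \<longleftrightarrow> nonsingular n 0 \<and> (\<forall>i<n. \<not> walk n edge n i)"
    using r4 S4(2) by (auto simp: radius_exp_def nonsing Walk_def has_walks_def)
  also have "\<dots> \<longleftrightarrow> regularity_radius (map_mat of_rat A) (map_mat of_rat D) = \<infinity>"
    by (rule regularity_radius_iff[symmetric])
  finally show ?thesis .
qed

end

theorem theorem3p2:
  shows "poly_time_decidable enc_mat_pair
    {(A :: rat mat, \<Delta> :: rat mat).
       \<exists>n. A \<in> carrier_mat n n \<and> \<Delta> \<in> carrier_mat n n \<and> 0\<^sub>m n n \<le> \<Delta>}
    (\<lambda>(A, \<Delta>). regularity_radius (map_mat of_rat A) (map_mat of_rat \<Delta>) = \<infinity>)"
proof (rule poly_time_decidable_result)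
  fix x :: "rat mat \<times> rat mat"
  assume "x \<in> {(A, \<Delta>). \<exists>n. A \<in> carrier_mat n n \<and> \<Delta> \<in> carrier_mat n n \<and> 0\<^sub>m n n \<le> \<Delta>}"
  then obtain A \<Delta> n where x: "x = (A, \<Delta>)"
    and "A \<in> carrier_mat n n" "\<Delta> \<in> carrier_mat n n" "0\<^sub>m n n \<le> \<Delta>"
    by auto
  then interpret radius_instance A \<Delta> n
    by unfold_locales
  show "(case x of (A, \<Delta>) \<Rightarrow> regularity_radius (map_mat of_rat A) (map_mat of_rat \<Delta>) = \<infinity>) \<longleftrightarrow>
    result radius_cmd radius_exp (enc_mat_pair x) \<noteq> 0"
    using result_radius by (simp add: x w_def)
qed

end
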